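(* Consider uniformly random rhombus tilings of the $abc$-hexagon with $a=\alpha n$, $b=\beta n$, $c=\gamma n$, where $\alpha\ge\beta>0$ and $\gamma>0$ are fixed, and the holes on the line $\mathcal L_m$, $m=\tau n$, where $\tau\in(0,\alpha+\beta)$ is fixed, as $n\to\infty$. Let $x>0$ be rational such that $nx\in\{0,1,\dots,N-1\}$ (with $n\to\infty$ through values for which $a,b,c,m,nx$ are integers) and such that the site of $\mathcal L_m$ at distance $nx$ from its lowest point $Q_m$ lies in the temperate zone, with its rescaled position bounded away from the expected boundary between the polar and temperate zones uniformly in $n$. Let $j_1,\dots,j_M$ be fixed distinct nonzero integers, $B_m=\{nx,nx+j_1,\dots,nx+j_M\}$ and $\mathbb B=\{0,j_1,\dots,j_M\}$. Then there is a constant $c(x)$ such that for each $p$ (with $0\le p\le M+1$), $$\lim_{n\to\infty}\mathbb P(\text{there are precisely }p\text{ holes in the set }B_m)=\frac1{p!}\left(-\frac{d}{dt}\right)^p\bigg|_{t=1}\det\left(1-t\,\mathcal S|_{\mathbb B}\right),$$ where $\mathcal S$ acts on $\ell^2(\mathbb Z)$ with kernel $$\mathcal S(i,j)=\frac{\sin(c(x)(i-j))}{\pi(i-j)}$$ (with diagonal value $c(x)/\pi$).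
   Context: Hexagon. For positive integers $a\ge b$ and $c$, the $abc$-hexagon has all interior angles $2\pi/3$ and side lengths $b,a,c,b,a,c$ in counterclockwise order, placed so that the sides of length $c$ are vertical: starting from the left vertical side (length $c$) and going counterclockwise one meets the lower-left side (length $b$), the lower-right side (length $a$), the right vertical side ($c$), the upper-right side ($b$), the upper-left side ($a$). The hexagon is tiled by unit-side rhombi whose vertices are in the triangular lattice of unit spacing containing the vertices of the hexagon; all tilings are equally likely. Rhombi with a pair of vertical sides are called horizontal rhombi (two orientations), rhombi with no vertical sides are called vertical rhombi. Particles and holes. For $0<m<a+b$ consider the $m$-th vertical lattice line from the left (at horizontal distance $m\sqrt3/2$ from the left side). $\mathcal L_m$ is the set of lattice points of the hexagon on this line, excluding the top one; $Q_m$ is the lowest point. Each point of $\mathcal L_m$ is the lower endpoint of a unit vertical segment in the hexagon; in a tiling, this segment is either a side of horizontal rhombi, in which case the point is a particle, or the short diagonal of a vertical rhombus, in which case it is a hole. There are always $c$ particles and $L_m=\min(m,b,a+b-m)$ holes on $\mathcal L_m$; $N=c+L_m$ is the number of points of $\mathcal L_m$. Sites of $\mathcal L_m$, and in particular holes, are identified with their distances in $\{0,1,\dots,N-1\}$ from $Q_m$. Zones. Rescale all lengths by $1/n$, so that the hexagon becomes a fixed hexagon with side lengths $\beta,\alpha,\gamma,\beta,\alpha,\gamma$. The expected boundary between polar and temperate zones is the ellipse inscribed in (tangent to all six sides of) this hexagon; the temperate zone is the inside of the ellipse and the polar zones are the components of its complement in the hexagon. *)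

theory Defs
  imports "HOL-Probability.Probability" "Jordan_Normal_Form.Determinant"
begin

text \<open>
  The plane is \<^typ>\<open>complex\<close>. The hexagon is placed with the lower end of its left vertical
  side at the origin. Its side lengths are taken in the reals, so that the same definition
  gives the lattice hexagon (integer sides) and the rescaled limiting hexagon.
\<close>

text \<open>The vertices, counterclockwise; the k-th side joins vertex k to vertex k + 1. The sides
  thus have lengths b, a, c, b, a, c, beginning with the lower-left one.\<close>

definition hex_vertices :: "real \<Rightarrow> real \<Rightarrow> real \<Rightarrow> complex list" where
  "hex_vertices a b c =
     [0,
      of_real b * cis (- pi / 6),
      of_real b * cis (- pi / 6) + of_real a * cis (pi / 6),
      of_real b * cis (- pi / 6) + of_real a * cis (pi / 6) + of_real c * \<i>,
      of_real a * cis (pi / 6) + of_real c * \<i>,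
      of_real c * \<i>]"

definition hex_side :: "real \<Rightarrow> real \<Rightarrow> real \<Rightarrow> nat \<Rightarrow> complex set" where
  "hex_side a b c k =
     closed_segment (hex_vertices a b c ! k) (hex_vertices a b c ! ((k + 1) mod 6))"

definition hexagon :: "real \<Rightarrow> real \<Rightarrow> real \<Rightarrow> complex set" where
  "hexagon a b c = convex hull (set (hex_vertices a b c))"

definition tri_lattice :: "complex set" where
  "tri_lattice = {of_int i * cis (pi / 6) + of_int j * \<i> | i j. True}"

definition rhombus :: "complex \<Rightarrow> complex \<Rightarrow> complex \<Rightarrow> complex set" where
  "rhombus P u v = convex hull {P, P + u, P + u + v, P + v}"

definition lattice_rhombus :: "complex \<Rightarrow> complex \<Rightarrow> complex \<Rightarrow> bool" where
  "lattice_rhombus P u v \<longleftrightarrow>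
     {P, P + u, P + u + v, P + v} \<subseteq> tri_lattice \<and>
     norm u = 1 \<and> norm v = 1 \<and> v \<noteq> u \<and> v \<noteq> - u"

definition tilings :: "real \<Rightarrow> real \<Rightarrow> real \<Rightarrow> complex set set set" where
  "tilings a b c =
     {T. T \<subseteq> {rhombus P u v | P u v. lattice_rhombus P u v} \<and>
         pairwise (\<lambda>R R'. interior R \<inter> interior R' = {}) T \<and>
         \<Union>T = hexagon a b c}"

definition column :: "real \<Rightarrow> real \<Rightarrow> real \<Rightarrow> real \<Rightarrow> complex set" where
  "column a b c m = {z \<in> tri_lattice \<inter> hexagon a b c. Re z = m * sqrt 3 / 2}"

definition lowest_point :: "real \<Rightarrow> real \<Rightarrow> real \<Rightarrow> real \<Rightarrow> complex" where
  "lowest_point a b c m = arg_min_on Im (column a b c m)"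

definition sites :: "real \<Rightarrow> real \<Rightarrow> real \<Rightarrow> real \<Rightarrow> complex set" where
  "sites a b c m = column a b c m - {arg_max_on Im (column a b c m)}"

text \<open>The diagonals of \<^term>\<open>rhombus P u v\<close> join P to P + u + v and P + u to P + v. Every
  rhombus has representations in which either of its diagonals is the latter one. In a
  rhombus without vertical sides a diagonal of length 1 is the short one.\<close>

definition is_hole :: "complex set set \<Rightarrow> complex \<Rightarrow> bool" where
  "is_hole T z \<longleftrightarrow>
     (\<exists>P u v. lattice_rhombus P u v \<and> rhombus P u v \<in> T \<and> Re u \<noteq> 0 \<and> Re v \<noteq> 0 \<and>
              closed_segment (P + u) (P + v) = closed_segment z (z + \<i>))"

text \<open>Holes are recorded by their distances from the lowest site.\<close>

definition holes :: "real \<Rightarrow> real \<Rightarrow> real \<Rightarrow> real \<Rightarrow> complex set set \<Rightarrow> real set" where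
  "holes a b c m T = {dist (lowest_point a b c m) z | z. z \<in> sites a b c m \<and> is_hole T z}"

definition is_ellipse :: "complex set \<Rightarrow> bool" where
  "is_ellipse E \<longleftrightarrow> (\<exists>z0 (f :: complex \<Rightarrow> complex). linear f \<and> bij f \<and> E = (\<lambda>z. z0 + f z) ` sphere 0 1)"

text \<open>An ellipse is tangent to a line exactly if it meets the line in a single point. Here
  the point of tangency must lie on the side itself, not merely on its extension.\<close>

definition inscribed_ellipse :: "real \<Rightarrow> real \<Rightarrow> real \<Rightarrow> complex set \<Rightarrow> bool" where
  "inscribed_ellipse \<alpha> \<beta> \<gamma> E \<longleftrightarrow>
     is_ellipse E \<and>
     (\<forall>k<6. \<exists>z\<in>hex_side \<alpha> \<beta> \<gamma> k. E \<inter> affine hull (hex_side \<alpha> \<beta> \<gamma> k) = {z})"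

definition scales :: "real \<Rightarrow> real \<Rightarrow> real \<Rightarrow> real \<Rightarrow> real \<Rightarrow> nat set" where
  "scales \<alpha> \<beta> \<gamma> \<tau> x =
     {n. n > 0 \<and> real n * \<alpha> \<in> \<nat> \<and> real n * \<beta> \<in> \<nat> \<and> real n * \<gamma> \<in> \<nat> \<and> real n * \<tau> \<in> \<nat> \<and>
         real n * x \<in> \<nat>}"

definition rescaled_site :: "real \<Rightarrow> real \<Rightarrow> real \<Rightarrow> real \<Rightarrow> real \<Rightarrow> nat \<Rightarrow> complex" where
  "rescaled_site \<alpha> \<beta> \<gamma> \<tau> x n =
     (lowest_point (n * \<alpha>) (n * \<beta>) (n * \<gamma>) (n * \<tau>) + of_real (n * x) * \<i>) / of_nat n"

definition sine_kernel :: "real \<Rightarrow> int \<Rightarrow> int \<Rightarrow> real" where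
  "sine_kernel \<kappa> i j =
     (if i = j then \<kappa> / pi else sin (\<kappa> * of_int (i - j)) / (pi * of_int (i - j)))"

text \<open>The matrix of the sine kernel restricted to the finite set of the entries of a
  (distinct) list.\<close>

definition sine_matrix :: "real \<Rightarrow> int list \<Rightarrow> real mat" where
  "sine_matrix \<kappa> bs =
     mat (length bs) (length bs) (\<lambda>(r, s). sine_kernel \<kappa> (bs ! r) (bs ! s))"

definition hole_prob :: "real \<Rightarrow> real \<Rightarrow> real \<Rightarrow> real \<Rightarrow> real set \<Rightarrow> nat \<Rightarrow> real" where
  "hole_prob a b c m B p =
     measure_pmf.prob (pmf_of_set (tilings a b c)) {T. card (B \<inter> holes a b c m T) = p}"

end

theory Submission
  imports Defs
begin

text \<open>
  A tiling is a family of c nonintersecting lattice paths through the particles, one down or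
  flat step per column. Counting the paths to the left and to the right of the m-th line by
  determinants of binomial coefficients shows that the particle set P on this line has
  probability proportional to the squared Vandermonde determinant of P times a product of
  Hahn-type weights. Hence the particles form a determinantal process whose kernel is the
  orthogonal projection onto the polynomials of degree below c in a weighted space. A
  second-order difference operator preserves each space of polynomials of bounded degree and
  is symmetric for the weight, so that the projection is the spectral projection of a Jacobi
  matrix onto its c lowest eigenvalues. Near the site n x the rescaled Jacobi matrix converges
  entrywise to a Toeplitz matrix with symbol d + 2 o cos t. Moments, hence continuous
  functions, of the matrix converge locally; since the symbol takes no value on a set of
  positive measure, so do the spectral projections, and the limit is one minus the sine kernel.
\<close>

section \<open>Lattice coordinates and rhombi\<close>

text \<open>No asymptotics of orthogonal polynomials and no normalizing constant is computed. The
  factors in front of the determinants are only shown to exist; they are fixed at the end, because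
  the squared determinants of the orthonormal eigenfunctions sum to 1 over all particle sets.
  Asymptotics are replaced by the fact that the eigenvalue k (2N - 1 + p + q - k) increases for k <
  N: a degree below c is the same as an eigenvalue below a threshold, and after division by the
  square of n this threshold \<open>thr\<close> converges, as do the matrix entries near n x. The
  obstacle is that the cut is a discontinuous function of the eigenvalue; the error of smoothing it
  is controlled by diagonal entries alone. The symbol is below \<open>thr\<close> for angles above
  \<open>kappa\<close>, the arccos of (thr - d) / (2 offd). The particles fill these angles, so the
  holes keep the angles below \<open>kappa\<close>, and \<open>kappa\<close> is the constant c(x).
  For a particle kernel K, the number of holes in a finite set has the generating polynomial det (K
  + u (1 - K)). With u = 1 - t, its Taylor coefficients at u = 0 are the derivatives at t = 1 in the
  statement.\<close>

definition pt :: "real \<Rightarrow> real \<Rightarrow> complex" where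
  "pt x y = of_real x * cis (pi / 6) + of_real y * \<i>"

text \<open>The coordinate \<open>cx\<close> numbers the vertical lattice lines. Lattice points
  become integer pairs, and the three directions of lattice lines become the level sets of
  \<open>cx\<close>, \<open>cy\<close> and \<open>cx + cy\<close>, so that the geometry below is
  linear arithmetic.\<close>

definition cx :: "complex \<Rightarrow> real" where "cx z = 2 * Re z / sqrt 3"
definition cy :: "complex \<Rightarrow> real" where "cy z = Im z - Re z / sqrt 3"

lemma Re_pt: "Re (pt x y) = x * sqrt 3 / 2" and Im_pt: "Im (pt x y) = y + x / 2"
  by (auto simp: pt_def cos_30 sin_30)

lemma cx_pt [simp]: "cx (pt x y) = x" and cy_pt [simp]: "cy (pt x y) = y"
  by (auto simp: cx_def cy_def Re_pt Im_pt field_simps)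

lemma pt_cx_cy [simp]: "pt (cx z) (cy z) = z"
  by (simp add: complex_eq_iff Re_pt Im_pt cx_def cy_def)

lemma complex_eq_iff_cx_cy: "z = w \<longleftrightarrow> cx z = cx w \<and> cy z = cy w"
  by (metis pt_cx_cy)

lemma pt_eq_iff [simp]: "pt x y = pt x' y' \<longleftrightarrow> x = x' \<and> y = y'"
  by (simp add: complex_eq_iff_cx_cy)

lemma cx_simps [simp]:
  "cx (z + w) = cx z + cx w" "cx (z - w) = cx z - cx w" "cx (- z) = - cx z"
  "cx (of_real r * z) = r * cx z" "cx (r *\<^sub>R z) = r * cx z" "cx 0 = 0"
  "cx \<i> = 0" "cx (cis (pi / 6)) = 1" "cx (cis (- (pi / 6))) = 1"
  by (auto simp: cx_def cos_30 add_divide_distrib diff_divide_distrib algebra_simps)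

lemma cy_simps [simp]:
  "cy (z + w) = cy z + cy w" "cy (z - w) = cy z - cy w" "cy (- z) = - cy z"
  "cy (of_real r * z) = r * cy z" "cy (r *\<^sub>R z) = r * cy z" "cy 0 = 0"
  "cy \<i> = 1" "cy (cis (pi / 6)) = 0" "cy (cis (- (pi / 6))) = -1"
  by (auto simp: cy_def cos_30 sin_30 add_divide_distrib diff_divide_distrib algebra_simps)

lemma pt_add: "pt x y + pt x' y' = pt (x + x') (y + y')"
  and pt_minus: "- pt x y = pt (- x) (- y)"
  and pt_diff: "pt x y - pt x' y' = pt (x - x') (y - y')"
  by (auto simp: complex_eq_iff_cx_cy)

lemma norm_pt: "(norm (pt x y))\<^sup>2 = x\<^sup>2 + x * y + y\<^sup>2"
  unfolding cmod_power2 Re_pt Im_pt by (auto simp: power2_eq_square field_simps)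

lemma tri_lattice_pt: "tri_lattice = {pt (of_int i) (of_int j) | i j. True}"
  by (auto simp: tri_lattice_def pt_def)

text \<open>The squared norm is the form pp + pq + qq. Completing the square in either variable
  bounds both integers by 1 in absolute value, which leaves finitely many pairs to test.\<close>

lemma lattice_unit_vectors:
  assumes "norm (pt (of_int p) (of_int q)) = 1"
  shows "(p, q) \<in> {(1, 0), (-1, 0), (0, 1), (0, -1), (1, -1), (-1, 1)}"
proof -
  have "(of_int (p\<^sup>2 + p * q + q\<^sup>2) :: real) = of_int 1"
    using norm_pt[of "of_int p" "of_int q"] assms by simp
  hence *: "p\<^sup>2 + p * q + q\<^sup>2 = 1" by (simp only: of_int_eq_iff)
  have "(2 * p + q)\<^sup>2 + 3 * q\<^sup>2 = 4" "(2 * q + p)\<^sup>2 + 3 * p\<^sup>2 = 4"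
    using * by (auto simp: power2_eq_square algebra_simps)
  hence "3 * q\<^sup>2 \<le> 4" "3 * p\<^sup>2 \<le> 4"
    by (metis le_add_same_cancel2 zero_le_power2)+
  hence "q\<^sup>2 \<le> 1" "p\<^sup>2 \<le> 1" by auto
  hence "\<bar>q\<bar> \<le> 1" "\<bar>p\<bar> \<le> 1" by (auto simp: abs_square_le_1)
  hence "q \<in> {-1, 0, 1}" "p \<in> {-1, 0, 1}" by auto
  thus ?thesis using * by auto
qed

lemma rhombus_swap: "rhombus P u v = rhombus P v u"
  unfolding rhombus_def by (simp add: insert_commute add_ac)

lemma rhombus_neg: "rhombus P u v = rhombus (P + u) (- u) v"
  unfolding rhombus_def by (simp add: insert_commute add_ac)

lemma rhombus_eq: "rhombus P u v = {P + s *\<^sub>R u + t *\<^sub>R v | s t. s \<in> {0..1} \<and> t \<in> {0..1}}" (is "_ = ?S")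
proof
  have "convex ?S"
    unfolding convex_alt
  proof (intro ballI allI impI)
    fix x y and w :: real assume x: "x \<in> ?S" and y: "y \<in> ?S" and w: "0 \<le> w \<and> w \<le> 1"
    obtain s t where s: "x = P + s *\<^sub>R u + t *\<^sub>R v" "s \<in> {0..1}" "t \<in> {0..1}" using x by auto
    obtain s' t' where s': "y = P + s' *\<^sub>R u + t' *\<^sub>R v" "s' \<in> {0..1}" "t' \<in> {0..1}" using y by auto
    have "(1 - w) *\<^sub>R x + w *\<^sub>R y =
       P + ((1 - w) * s + w * s') *\<^sub>R u + ((1 - w) * t + w * t') *\<^sub>R v"
      unfolding s s' by (simp add: algebra_simps)
    moreover have "(1 - w) * s + w * s' \<in> {0..1}" "(1 - w) * t + w * t' \<in> {0..1}"
      using s s' w by (auto intro!: convex_bound_le)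
    ultimately show "(1 - w) *\<^sub>R x + w *\<^sub>R y \<in> ?S" by blast
  qed
  moreover have "P + s *\<^sub>R u + t *\<^sub>R v \<in> ?S" if "s \<in> {0..1}" "t \<in> {0..1}" for s t using that by blast
  from this[of 0 0] this[of 1 0] this[of 1 1] this[of 0 1]
  have "{P, P + u, P + u + v, P + v} \<subseteq> ?S" by auto
  ultimately show "rhombus P u v \<subseteq> ?S" unfolding rhombus_def by (simp add: hull_minimal)
next
  show "?S \<subseteq> rhombus P u v"
  proof
    fix z assume "z \<in> ?S"
    then obtain s t where z: "z = P + s *\<^sub>R u + t *\<^sub>R v" "s \<in> {0..1}" "t \<in> {0..1}" by auto
    let ?C = "convex hull {P, P + u, P + u + v, P + v}"
    have mem: "P \<in> ?C" "P + u \<in> ?C" "P + u + v \<in> ?C" "P + v \<in> ?C" by (rule hull_inc, simp)+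
    have "(1 - s) *\<^sub>R P + s *\<^sub>R (P + u) \<in> ?C" "(1 - s) *\<^sub>R (P + v) + s *\<^sub>R (P + u + v) \<in> ?C"
      using z mem by (auto intro!: convexD[OF convex_convex_hull])
    hence "(1 - t) *\<^sub>R ((1 - s) *\<^sub>R P + s *\<^sub>R (P + u)) + t *\<^sub>R ((1 - s) *\<^sub>R (P + v) + s *\<^sub>R (P + u + v)) \<in> ?C"
      using z mem by (intro convexD[OF convex_convex_hull]) simp_all
    also have "(1 - t) *\<^sub>R ((1 - s) *\<^sub>R P + s *\<^sub>R (P + u)) + t *\<^sub>R ((1 - s) *\<^sub>R (P + v) + s *\<^sub>R (P + u + v)) = z"
      unfolding z by (simp add: algebra_simps)
    finally show "z \<in> rhombus P u v" unfolding rhombus_def .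
  qed
qed

text \<open>The rhombi without vertical sides, and the horizontal rhombi whose non-vertical sides go
  up and down to the right, respectively.\<close>

definition vtile :: "int \<Rightarrow> int \<Rightarrow> complex set" where
  "vtile i j = {z. of_int j \<le> cy z \<and> cy z \<le> of_int j + 1 \<and>
     of_int (i + j) \<le> cx z + cy z \<and> cx z + cy z \<le> of_int (i + j) + 1}"

definition utile :: "int \<Rightarrow> int \<Rightarrow> complex set" where
  "utile i j = {z. of_int i \<le> cx z \<and> cx z \<le> of_int i + 1 \<and> of_int j \<le> cy z \<and> cy z \<le> of_int j + 1}"

definition dtile :: "int \<Rightarrow> int \<Rightarrow> complex set" where
  "dtile i j = {z. of_int i \<le> cx z \<and> cx z \<le> of_int i + 1 \<and>
     of_int (i + j) \<le> cx z + cy z \<and> cx z + cy z \<le> of_int (i + j) + 1}"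

lemma mem_rhombus_iff:
  "z \<in> rhombus P u v \<longleftrightarrow> (\<exists>s\<in>{0..1}. \<exists>t\<in>{0..1}. cx z = cx P + s * cx u + t * cx v \<and>
      cy z = cy P + s * cy u + t * cy v)"
  unfolding rhombus_eq mem_Collect_eq complex_eq_iff_cx_cy cx_simps cy_simps by blast

text \<open>\<open>vtile\<close> is labelled by the lower end of its vertical diagonal instead of
  its left corner, hence the shift in the second equation. With this choice the unit triangle to the
  right of the segment above the label belongs to the tile for all three kinds.\<close>

lemma rhombus_tiles:
  fixes i j :: int and P :: complex
  assumes P_def: "P = pt (of_int i) (of_int j)"
  shows "rhombus P (pt 1 0) (pt 0 1) = utile i j" (is ?A)
    and "rhombus P (pt 1 0) (pt 1 (-1)) = vtile (i + 1) (j - 1)" (is ?B)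
    and "rhombus P (pt 0 1) (pt 1 (-1)) = dtile i j" (is ?C)
proof -
  show ?A
  proof (rule Set.set_eqI, rule iffI)
    fix z assume "z \<in> rhombus P (pt 1 0) (pt 0 1)" thus "z \<in> utile i j" unfolding mem_rhombus_iff utile_def P_def by auto
  next
    fix z assume A: "z \<in> utile i j" show "z \<in> rhombus P (pt 1 0) (pt 0 1)" unfolding mem_rhombus_iff P_def
      by (rule bexI[where x = "cx z - of_int i"], rule bexI[where x = "cy z - of_int j"]) (use A in \<open>auto simp: utile_def\<close>)
  qed
  show ?B
  proof (rule Set.set_eqI, rule iffI)
    fix z assume "z \<in> rhombus P (pt 1 0) (pt 1 (-1))" thus "z \<in> vtile (i + 1) (j - 1)" unfolding mem_rhombus_iff vtile_def P_def by auto
  next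
    fix z assume A: "z \<in> vtile (i + 1) (j - 1)" show "z \<in> rhombus P (pt 1 0) (pt 1 (-1))" unfolding mem_rhombus_iff P_def
      by (rule bexI[where x = "cx z + cy z - of_int i - of_int j"], rule bexI[where x = "of_int j - cy z"]) (use A in \<open>auto simp: vtile_def\<close>)
  qed
  show ?C
  proof (rule Set.set_eqI, rule iffI)
    fix z assume "z \<in> rhombus P (pt 0 1) (pt 1 (-1))" thus "z \<in> dtile i j" unfolding mem_rhombus_iff dtile_def P_def by auto
  next
    fix z assume A: "z \<in> dtile i j" show "z \<in> rhombus P (pt 0 1) (pt 1 (-1))" unfolding mem_rhombus_iff P_def
      by (rule bexI[where x = "cx z + cy z - of_int i - of_int j"], rule bexI[where x = "cx z - of_int i"]) (use A in \<open>auto simp: dtile_def\<close>)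
  qed
qed

definition tiles :: "complex set set" where
  "tiles = {vtile i j | i j. True} \<union> {utile i j | i j. True} \<union> {dtile i j | i j. True}"

definition units :: "complex set" where "units = {pt 1 0, pt 0 1, pt 1 (-1)}"

lemma lattice_rhombusE:
  assumes "lattice_rhombus P u v"
  obtains i j where "P = pt (of_int i) (of_int j)" "u \<in> units \<or> - u \<in> units" "v \<in> units \<or> - v \<in> units"
    "v \<noteq> u" "v \<noteq> - u"
proof -
  have lat: "P \<in> tri_lattice" "P + u \<in> tri_lattice" "P + v \<in> tri_lattice"
    and n: "norm u = 1" "norm v = 1" "v \<noteq> u" "v \<noteq> - u"
    using assms by (auto simp: lattice_rhombus_def)
  obtain i j where P: "P = pt (of_int i) (of_int j)" using lat(1) unfolding tri_lattice_pt by blast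
  have *: "w \<in> units \<or> - w \<in> units" if "P + w \<in> tri_lattice" "norm w = 1" for w
  proof -
    have "\<exists>i' j'. P + w = pt (of_int i') (of_int j')" using that(1) unfolding tri_lattice_pt by blast
    then obtain i' j' where "P + w = pt (of_int i') (of_int j')" by blast
    hence w: "w = pt (of_int (i' - i)) (of_int (j' - j))"
      unfolding P by (simp add: complex_eq_iff_cx_cy)
    define p q where "p = i' - i" and "q = j' - j"
    have w': "w = pt (of_int p) (of_int q)" using w by (simp add: p_def q_def)
    from lattice_unit_vectors[of p q] that(2) show ?thesis
      unfolding w' units_def pt_minus pt_eq_iff insert_iff by auto
  qed
  show ?thesis using that[OF P *[OF lat(2) n(1)] *[OF lat(3) n(2)] n(3,4)] .
qed

lemma pt_lattice_diff:
  assumes "w \<in> units"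
  obtains i' j' where "pt (of_int i) (of_int j) - w = pt (of_int i') (of_int j')"
proof -
  have "pt (of_int i) (of_int j) - pt 1 0 = pt (of_int (i - 1)) (of_int j)"
    "pt (of_int i) (of_int j) - pt 0 1 = pt (of_int i) (of_int (j - 1))"
    "pt (of_int i) (of_int j) - pt 1 (-1) = pt (of_int (i - 1)) (of_int (j + 1))"
    by (simp_all add: pt_diff)
  thus ?thesis using assms that unfolding units_def by blast
qed

lemma rhombus_units_in_tiles:
  assumes "u \<in> units" "v \<in> units" "u \<noteq> v"
  shows "rhombus (pt (of_int i) (of_int j)) u v \<in> tiles"
proof -
  have "{utile i j, vtile (i + 1) (j - 1), dtile i j} \<subseteq> tiles" by (auto simp: tiles_def)
  thus ?thesis using assms rhombus_tiles[OF refl, of i j]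
    unfolding units_def
    by (auto simp: rhombus_swap[of _ "pt 0 1" "pt 1 0"] rhombus_swap[of _ "pt 1 (- 1)" "pt 0 1"]
       rhombus_swap[of _ "pt 1 (- 1)" "pt 1 0"])
qed

text \<open>Each side is a member of \<open>units\<close> up to sign. Moving the base corner along a
  side of the wrong sign reverses it without changing the rhombus, so only pairs from
  \<open>units\<close> remain.\<close>

lemma lattice_rhombus_in_tiles:
  assumes "lattice_rhombus P u v" shows "rhombus P u v \<in> tiles"
proof -
  obtain i j where P: "P = pt (of_int i) (of_int j)" and u: "u \<in> units \<or> - u \<in> units"
    and v: "v \<in> units \<or> - v \<in> units" and n: "v \<noteq> u" "v \<noteq> - u"
    using lattice_rhombusE[OF assms] by metis
  have neg: "- u = v \<Longrightarrow> v = - u" by auto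
  have *: "rhombus (pt (of_int i) (of_int j)) u v \<in> tiles"
    if v: "v \<in> units" and u: "u \<in> units \<or> - u \<in> units" and n: "v \<noteq> u" "v \<noteq> - u" for i j u v
  proof (cases "u \<in> units")
    case True thus ?thesis using rhombus_units_in_tiles v n by auto
  next
    case False
    hence eig_low: "- u \<in> units" using u by auto
    obtain i' j' where ij: "pt (of_int i) (of_int j) + u = pt (of_int i') (of_int j')"
      using pt_lattice_diff[OF eig_low, of i j] by auto
    show ?thesis unfolding rhombus_neg[of "pt (of_int i) (of_int j)" u v] ij
      by (rule rhombus_units_in_tiles) (use eig_low v n in auto)
  qed
  show ?thesis
  proof (cases "v \<in> units")
    case True thus ?thesis using * u n P by auto
  next
    case False
    hence mv: "- v \<in> units" using v by auto
    obtain i' j' where ij: "pt (of_int i) (of_int j) + v = pt (of_int i') (of_int j')"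
      using pt_lattice_diff[OF mv, of i j] by auto
    show ?thesis unfolding P rhombus_swap[of _ u v] rhombus_neg[of "pt (of_int i) (of_int j)" v u] ij
      unfolding rhombus_swap[of _ "- v" u]
      by (rule *) (use mv u n in auto)
  qed
qed

lemma lattice_rhombus_pt:
  assumes "u \<in> units" "v \<in> units" "u \<noteq> v"
  shows "lattice_rhombus (pt (of_int i) (of_int j)) u v"
proof -
  have L: "pt (of_int p) (of_int q) \<in> tri_lattice" for p q by (auto simp: tri_lattice_pt)
  have *: "pt (of_int i + of_int p) (of_int j + of_int q) \<in> tri_lattice" for p q
    using L[of "i + p" "j + q"] by simp
  have A: "pt (of_int i) (of_int j) \<in> tri_lattice" by (rule L)
  have **: "norm (pt 1 0) = 1" "norm (pt 0 1) = 1" "norm (pt 1 (-1)) = 1"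
    using norm_pt[of 1 0] norm_pt[of 0 1] norm_pt[of 1 "-1"] norm_ge_zero[of "pt 1 0"] norm_ge_zero[of "pt 0 1"]
      norm_ge_zero[of "pt 1 (-1)"]
    by (simp_all add: power2_eq_1_iff del: norm_ge_zero)
  show ?thesis using assms *[of 0 0] *[of 1 0] *[of 0 1] *[of 1 1] *[of 1 "-1"] *[of 2 "-1"] A
    unfolding lattice_rhombus_def units_def
    by (auto simp: ** pt_add pt_minus add.commute)
qed

lemma lattice_rhombi: "{rhombus P u v | P u v. lattice_rhombus P u v} = tiles"
proof
  show "{rhombus P u v | P u v. lattice_rhombus P u v} \<subseteq> tiles"
    using lattice_rhombus_in_tiles by blast
  have u: "pt 1 0 \<in> units" "pt 0 1 \<in> units" "pt 1 (-1) \<in> units" by (auto simp: units_def)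
  have *: "\<exists>P u v. t = rhombus P u v \<and> lattice_rhombus P u v"
    if "rhombus (pt (of_int i) (of_int j)) u v = t" "u \<in> units" "v \<in> units" "u \<noteq> v" for i j u v t
    using that lattice_rhombus_pt[OF that(2-4), of i j] by blast
  have "\<exists>P u v. utile i j = rhombus P u v \<and> lattice_rhombus P u v" for i j
    by (rule *[OF rhombus_tiles(1)[OF refl] u(1,2)]) simp
  moreover have "\<exists>P u v. vtile i j = rhombus P u v \<and> lattice_rhombus P u v" for i j
    using *[OF rhombus_tiles(2)[OF refl] u(1,3), of "i - 1" "j + 1"] by simp
  moreover have "\<exists>P u v. dtile i j = rhombus P u v \<and> lattice_rhombus P u v" for i j
    by (rule *[OF rhombus_tiles(3)[OF refl] u(2,3)]) simp
  ultimately show "tiles \<subseteq> {rhombus P u v | P u v. lattice_rhombus P u v}"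
    unfolding tiles_def by blast
qed

text \<open>The inequalities are convex and hold at the vertices. Conversely the vertical line
  through a point leaves the region at second coordinates \<open>max (-b) (-x)\<close> and
  \<open>min c (a + c - x)\<close>; each end lies on a side, and the point lies between the
  ends.\<close>

lemma hexagon_eq:
  fixes a b c :: real
  assumes "0 < a" "0 < b" "0 < c"
  shows "hexagon a b c = {z. 0 \<le> cx z \<and> cx z \<le> a + b \<and> - b \<le> cy z \<and> cy z \<le> c \<and>
           0 \<le> cx z + cy z \<and> cx z + cy z \<le> a + c}" (is "_ = ?H")
proof -
  have verts: "set (hex_vertices a b c) = {pt 0 0, pt b (-b), pt (a + b) (-b), pt (a + b) (c - b), pt a c, pt 0 c}"
  proof -
    have "hex_vertices a b c = [pt 0 0, pt b (-b), pt (a + b) (-b), pt (a + b) (c - b), pt a c, pt 0 c]"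
      unfolding hex_vertices_def list.inject complex_eq_iff_cx_cy by simp
    thus ?thesis by simp
  qed
  let ?C = "convex hull {pt 0 0, pt b (-b), pt (a + b) (-b), pt (a + b) (c - b), pt a c, pt 0 c}"
  have "convex ?H"
    unfolding convex_alt
  proof (intro ballI allI impI)
    fix x y and w :: real assume x: "x \<in> ?H" and y: "y \<in> ?H" and w: "0 \<le> w \<and> w \<le> 1"
    have lo: "l \<le> (1 - w) * p + w * q" if "l \<le> p" "l \<le> q" for l p q
      using convex_bound_le[of "- p" "- l" "- q" "1 - w" w] that w by auto
    have hi: "(1 - w) * p + w * q \<le> l" if "p \<le> l" "q \<le> l" for l p q
      using convex_bound_le[of "p" "l" "q" "1 - w" w] that w by auto
    have eq: "cx ((1 - w) *\<^sub>R x + w *\<^sub>R y) + cy ((1 - w) *\<^sub>R x + w *\<^sub>R y) =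
      (1 - w) * (cx x + cy x) + w * (cx y + cy y)" by (simp add: algebra_simps)
    show "(1 - w) *\<^sub>R x + w *\<^sub>R y \<in> ?H"
      unfolding mem_Collect_eq eq unfolding cx_simps cy_simps
      using x y by (intro conjI lo hi) auto
  qed
  hence sub: "?C \<subseteq> ?H" using assms by (intro hull_minimal) auto
  have C: "convex ?C" by (rule convex_convex_hull)
  have mem: "pt 0 0 \<in> ?C" "pt b (-b) \<in> ?C" "pt (a + b) (-b) \<in> ?C" "pt (a + b) (c - b) \<in> ?C" "pt a c \<in> ?C" "pt 0 c \<in> ?C"
    by (auto simp: hull_inc)
  have comb: "z \<in> ?C" if "w1 \<in> ?C" "w2 \<in> ?C" "0 \<le> s" "0 \<le> t" "s + t > 0"
     "(s + t) * cx z = s * cx w1 + t * cx w2" "(s + t) * cy z = s * cy w1 + t * cy w2" for w1 w2 s t z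
  proof -
    have "z = (s / (s + t)) *\<^sub>R w1 + (t / (s + t)) *\<^sub>R w2"
    proof -
      have "cx z = (s * cx w1 + t * cx w2) / (s + t)" "cy z = (s * cy w1 + t * cy w2) / (s + t)"
        unfolding that(6,7)[symmetric] using that(5) by simp_all
      thus ?thesis by (simp add: complex_eq_iff_cx_cy add_divide_distrib)
    qed
    also have "\<dots> \<in> ?C" using that by (intro convexD[OF C]) (auto simp: add_divide_distrib[symmetric])
    finally show ?thesis .
  qed
  have "z \<in> ?C" if z: "z \<in> ?H" for z
  proof -
    define x where "x = cx z"
    have x: "0 \<le> x" "x \<le> a + b" using z by (auto simp: x_def)
    have lo: "pt x (max (-b) (-x)) \<in> ?C"
    proof (cases "x \<le> b")
      case True
      show ?thesis by (rule comb[OF mem(1,2), of "b - x" x]) (use True assms x in \<open>auto simp: algebra_simps max_def\<close>)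
    next
      case False
      show ?thesis by (rule comb[OF mem(2,3), of "a + b - x" "x - b"]) (use False assms x in \<open>auto simp: algebra_simps max_def\<close>)
    qed
    have hi: "pt x (min c (a + c - x)) \<in> ?C"
    proof (cases "x \<le> a")
      case True
      show ?thesis by (rule comb[OF mem(6,5), of "a - x" x]) (use True assms x in \<open>auto simp: algebra_simps min_def\<close>)
    next
      case False
      show ?thesis by (rule comb[OF mem(5,4), of "a + b - x" "x - a"]) (use False assms x in \<open>auto simp: algebra_simps min_def\<close>)
    qed
    have y: "max (-b) (-x) \<le> cy z" "cy z \<le> min c (a + c - x)" using z by (auto simp: x_def)
    show ?thesis
    proof (cases "max (-b) (-x) = min c (a + c - x)")
      case True
      hence "z = pt x (max (-b) (-x))" using y by (auto simp: complex_eq_iff_cx_cy x_def)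
      thus ?thesis using lo by simp
    next
      case False
      show ?thesis
        by (rule comb[OF lo hi, of "min c (a + c - x) - cy z" "cy z - max (-b) (-x)"])
           (use y False in \<open>auto simp: x_def algebra_simps\<close>)
    qed
  qed
  with sub have "?C = ?H" by blast
  thus ?thesis unfolding hexagon_def verts by simp
qed

section \<open>Interiors and overlaps of the tiles\<close>

definition vX :: complex where "vX = Complex (2 / sqrt 3) 0"
definition vY :: complex where "vY = Complex (- 1 / sqrt 3) 1"
definition vZ :: complex where "vZ = Complex (1 / sqrt 3) 1"

text \<open>Written as inner products with fixed vectors, the three coordinates make every tile an
  intersection of two slabs, whose interior is given by the strict inequalities.\<close>

lemma inner_vX: "inner vX z = cx z" and inner_vY: "inner vY z = cy z"
  and inner_vZ: "inner vZ z = cx z + cy z"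
  by (auto simp: vX_def vY_def vZ_def inner_complex_def cx_def cy_def field_simps)

lemma v_nonzero: "vX \<noteq> 0" "vY \<noteq> 0" "vZ \<noteq> 0"
  by (auto simp: vX_def vY_def vZ_def complex_eq_iff)

lemma interior_slab:
  fixes v :: "'a :: euclidean_space"
  assumes "v \<noteq> 0"
  shows "interior {z. l \<le> inner v z \<and> inner v z \<le> u} = {z. l < inner v z \<and> inner v z < u}"
proof -
  have "{z. l \<le> inner v z \<and> inner v z \<le> u} = {z. inner v z \<ge> l} \<inter> {z. inner v z \<le> u}" by auto
  thus ?thesis using assms interior_halfspace_le[of v u] interior_halfspace_ge[of v l]
    by (auto simp: interior_Int)
qed

lemmas interior_slabs = interior_slab[OF v_nonzero(1), unfolded inner_vX]
  interior_slab[OF v_nonzero(2), unfolded inner_vY] interior_slab[OF v_nonzero(3), unfolded inner_vZ]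

lemma slab_Int: "{z. p z \<and> q z \<and> r z \<and> s z} = {z. p z \<and> q z} \<inter> {z. r z \<and> s z}" by auto

lemma interior_vtile: "interior (vtile i j) = {z. of_int j < cy z \<and> cy z < of_int j + 1 \<and>
     of_int (i + j) < cx z + cy z \<and> cx z + cy z < of_int (i + j) + 1}"
  and interior_utile: "interior (utile i j) = {z. of_int i < cx z \<and> cx z < of_int i + 1 \<and>
     of_int j < cy z \<and> cy z < of_int j + 1}"
  and interior_dtile: "interior (dtile i j) = {z. of_int i < cx z \<and> cx z < of_int i + 1 \<and>
     of_int (i + j) < cx z + cy z \<and> cx z + cy z < of_int (i + j) + 1}"
  unfolding vtile_def utile_def dtile_def slab_Int interior_Int interior_slabs by blast+

text \<open>The centers of the unit triangles on the right and on the left of the vertical unit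
  segment above the lattice point (i, j).\<close>

definition cR :: "int \<Rightarrow> int \<Rightarrow> complex" where "cR i j = pt (of_int i + 1/3) (of_int j + 1/3)"
definition cL :: "int \<Rightarrow> int \<Rightarrow> complex" where "cL i j = pt (of_int i - 1/3) (of_int j + 2/3)"

lemma of_int_third:
  "(of_int a :: real) \<le> of_int b + 1/3 \<longleftrightarrow> a \<le> b"
  "(of_int b :: real) + 1/3 \<le> of_int a + 1 \<longleftrightarrow> b \<le> a"
  "(of_int k :: real) \<le> of_int a + 1/3 + (of_int b + 1/3) \<longleftrightarrow> k \<le> a + b"
  "(of_int a :: real) + 1/3 + (of_int b + 1/3) \<le> of_int k + 1 \<longleftrightarrow> a + b \<le> k"
  "(of_int a :: real) \<le> of_int b + 2/3 \<longleftrightarrow> a \<le> b"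
  "(of_int b :: real) + 2/3 \<le> of_int a + 1 \<longleftrightarrow> b \<le> a"
  "(of_int k :: real) \<le> of_int a - 1/3 + (of_int b + 2/3) \<longleftrightarrow> k \<le> a + b"
  "(of_int a :: real) - 1/3 + (of_int b + 2/3) \<le> of_int k + 1 \<longleftrightarrow> a + b \<le> k"
  "(of_int a :: real) \<le> of_int b - 1/3 \<longleftrightarrow> a < b"
  "(of_int b :: real) - 1/3 \<le> of_int a + 1 \<longleftrightarrow> b \<le> a + 1"
  by linarith+

lemma cR_mem_tiles:
  "cR i' j' \<in> vtile i j \<longleftrightarrow> i' = i \<and> j' = j"
  "cR i' j' \<in> utile i j \<longleftrightarrow> i' = i \<and> j' = j"
  "cR i' j' \<in> dtile i j \<longleftrightarrow> i' = i \<and> j' = j"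
  unfolding cR_def vtile_def utile_def dtile_def mem_Collect_eq cx_pt cy_pt of_int_third
  by arith+

lemma cL_mem_tiles:
  "cL i' j' \<in> vtile i j \<longleftrightarrow> i' = i \<and> j' = j"
  "cL i' j' \<in> utile i j \<longleftrightarrow> i' = i + 1 \<and> j' = j"
  "cL i' j' \<in> dtile i j \<longleftrightarrow> i' = i + 1 \<and> j' = j - 1"
  unfolding cL_def vtile_def utile_def dtile_def mem_Collect_eq cx_pt cy_pt of_int_third
  by arith+

text \<open>The coordinates of a center and their sum are not integers, so a center is never on the
  boundary of a tile. Disjointness of interiors can therefore be tested at centers.\<close>

lemma interior_center_tiles:
  assumes "\<rho> \<in> tiles"
  shows "cR i j \<in> \<rho> \<Longrightarrow> cR i j \<in> interior \<rho>" "cL i j \<in> \<rho> \<Longrightarrow> cL i j \<in> interior \<rho>"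
  using assms unfolding tiles_def
  by (auto simp: cR_mem_tiles cL_mem_tiles interior_vtile interior_utile interior_dtile)
     (auto simp: cR_def cL_def)

text \<open>Two parallel open unit slabs with integer bounds meet only if they coincide. Any two
  kinds of tile have a slab direction in common; the other inequalities then leave at most two
  relative positions, in each of which the tiles share a unit triangle.\<close>

lemma tiles_common_center:
  assumes "\<rho> \<in> tiles" "\<rho>' \<in> tiles" "interior \<rho> \<inter> interior \<rho>' \<noteq> {}"
  shows "\<exists>i j. cR i j \<in> \<rho> \<and> cR i j \<in> \<rho>' \<or> cL i j \<in> \<rho> \<and> cL i j \<in> \<rho>'"
proof -
  obtain z where z: "z \<in> interior \<rho>" "z \<in> interior \<rho>'" using assms(3) by blast
  have *: "i < j + 1" if "of_int i < (x::real)" "x < of_int j + 1" for i j x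
    using that by linarith
  have VU: ?thesis if "z \<in> interior (vtile i j)" "z \<in> interior (utile i' j')"
     "{vtile i j, utile i' j'} = {\<rho>, \<rho>'}" for i j i' j'
  proof -
    note zz = that(1,2)[unfolded interior_vtile interior_utile mem_Collect_eq]
    have "j < j' + 1" by (rule *[of _ "cy z"]) (use zz in auto)
    moreover have "j' < j + 1" by (rule *[of _ "cy z"]) (use zz in auto)
    moreover have "i + j < (i' + j' + 1) + 1" by (rule *[of _ "cx z + cy z"]) (use zz in auto)
    moreover have "i' + j' < i + j + 1" by (rule *[of _ "cx z + cy z"]) (use zz in auto)
    ultimately have "j < j' + 1" "j' < j + 1" "i + j < i' + j' + 1 + 1" "i' + j' < i + j + 1" by auto
    hence "j' = j" "i' = i \<or> i' + 1 = i" by arith+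
    hence "\<exists>a b. cR a b \<in> vtile i j \<and> cR a b \<in> utile i' j' \<or> cL a b \<in> vtile i j \<and> cL a b \<in> utile i' j'"
      unfolding cR_mem_tiles cL_mem_tiles by presburger
    thus ?thesis using that(3) by (auto simp: doubleton_eq_iff)
  qed
  have VD: ?thesis if "z \<in> interior (vtile i j)" "z \<in> interior (dtile i' j')"
     "{vtile i j, dtile i' j'} = {\<rho>, \<rho>'}" for i j i' j'
  proof -
    note zz = that(1,2)[unfolded interior_vtile interior_dtile mem_Collect_eq]
    have "i + j < i' + j' + 1" by (rule *[of _ "cx z + cy z"]) (use zz in auto)
    moreover have "i' + j' < i + j + 1" by (rule *[of _ "cx z + cy z"]) (use zz in auto)
    moreover have "i' < i + 1" by (rule *[of _ "cx z"]) (use zz in auto)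
    moreover have "i - 1 < i' + 1" by (rule *[of _ "cx z"]) (use zz in auto)
    ultimately have "i + j < i' + j' + 1" "i' + j' < i + j + 1" "i' < i + 1" "i - 1 < i' + 1" by auto
    hence "i' + j' = i + j" "i' = i \<or> i' + 1 = i" by arith+
    hence "\<exists>a b. cR a b \<in> vtile i j \<and> cR a b \<in> dtile i' j' \<or> cL a b \<in> vtile i j \<and> cL a b \<in> dtile i' j'"
      unfolding cR_mem_tiles cL_mem_tiles by presburger
    thus ?thesis using that(3) by (auto simp: doubleton_eq_iff)
  qed
  have UD: ?thesis if "z \<in> interior (utile i j)" "z \<in> interior (dtile i' j')"
     "{utile i j, dtile i' j'} = {\<rho>, \<rho>'}" for i j i' j'
  proof -
    note zz = that(1,2)[unfolded interior_utile interior_dtile mem_Collect_eq]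
    have "i < i' + 1" by (rule *[of _ "cx z"]) (use zz in auto)
    moreover have "i' < i + 1" by (rule *[of _ "cx z"]) (use zz in auto)
    moreover have "i' + j' < i + j + 1 + 1" by (rule *[of _ "cx z + cy z"]) (use zz in auto)
    moreover have "i + j < i' + j' + 1" by (rule *[of _ "cx z + cy z"]) (use zz in auto)
    ultimately have "i < i' + 1" "i' < i + 1" "i' + j' < i + j + 1 + 1" "i + j < i' + j' + 1" by auto
    hence "i' = i" "j' = j \<or> j' = j + 1" by arith+
    hence "\<exists>a b. cR a b \<in> utile i j \<and> cR a b \<in> dtile i' j' \<or> cL a b \<in> utile i j \<and> cL a b \<in> dtile i' j'"
      unfolding cR_mem_tiles cL_mem_tiles by presburger
    thus ?thesis using that(3) by (auto simp: doubleton_eq_iff)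
  qed
  have VV: ?thesis if "z \<in> interior (vtile i j)" "z \<in> interior (vtile i' j')"
     "{vtile i j, vtile i' j'} = {\<rho>, \<rho>'}" for i j i' j'
  proof -
    have "j < j' + 1" "j' < j + 1" "i + j < i' + j' + 1" "i' + j' < i + j + 1"
      using that(1,2) unfolding interior_vtile mem_Collect_eq
      by (intro *[of _ "cy z"] *[of _ "cx z + cy z"]; simp)+
    hence "i' = i" "j' = j" by arith+
    thus ?thesis using that(3) cR_mem_tiles(1)[of i j] by (auto simp: doubleton_eq_iff)
  qed
  have UU: ?thesis if "z \<in> interior (utile i j)" "z \<in> interior (utile i' j')"
     "{utile i j, utile i' j'} = {\<rho>, \<rho>'}" for i j i' j'
  proof -
    have "j < j' + 1" "j' < j + 1" "i < i' + 1" "i' < i + 1"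
      using that(1,2) unfolding interior_utile mem_Collect_eq
      by (intro *[of _ "cy z"] *[of _ "cx z"]; simp)+
    hence "i' = i" "j' = j" by arith+
    thus ?thesis using that(3) cR_mem_tiles(2)[of i j] by (auto simp: doubleton_eq_iff)
  qed
  have DD: ?thesis if "z \<in> interior (dtile i j)" "z \<in> interior (dtile i' j')"
     "{dtile i j, dtile i' j'} = {\<rho>, \<rho>'}" for i j i' j'
  proof -
    have "i < i' + 1" "i' < i + 1" "i + j < i' + j' + 1" "i' + j' < i + j + 1"
      using that(1,2) unfolding interior_dtile mem_Collect_eq
      by (intro *[of _ "cx z"] *[of _ "cx z + cy z"]; simp)+
    hence "i' = i" "j' = j" by arith+
    thus ?thesis using that(3) cR_mem_tiles(3)[of i j] by (auto simp: doubleton_eq_iff)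
  qed
  obtain i j where r: "\<rho> = vtile i j \<or> \<rho> = utile i j \<or> \<rho> = dtile i j"
    using assms(1) unfolding tiles_def by blast
  obtain i' j' where r': "\<rho>' = vtile i' j' \<or> \<rho>' = utile i' j' \<or> \<rho>' = dtile i' j'"
    using assms(2) unfolding tiles_def by blast
  from r show ?thesis
  proof (elim disjE)
    assume 1: "\<rho> = vtile i j"
    from r' show ?thesis
    proof (elim disjE)
      assume 2: "\<rho>' = vtile i' j'"
      show ?thesis by (rule VV[of i j i' j']) (use z 1 2 in \<open>auto\<close>)
    next
      assume 2: "\<rho>' = utile i' j'"
      show ?thesis by (rule VU[of i j i' j']) (use z 1 2 in \<open>auto\<close>)
    next
      assume 2: "\<rho>' = dtile i' j'"
      show ?thesis by (rule VD[of i j i' j']) (use z 1 2 in \<open>auto\<close>)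
    qed
  next
    assume 1: "\<rho> = utile i j"
    from r' show ?thesis
    proof (elim disjE)
      assume 2: "\<rho>' = vtile i' j'"
      show ?thesis by (rule VU[of i' j' i j]) (use z 1 2 in \<open>auto\<close>)
    next
      assume 2: "\<rho>' = utile i' j'"
      show ?thesis by (rule UU[of i j i' j']) (use z 1 2 in \<open>auto\<close>)
    next
      assume 2: "\<rho>' = dtile i' j'"
      show ?thesis by (rule UD[of i j i' j']) (use z 1 2 in \<open>auto\<close>)
    qed
  next
    assume 1: "\<rho> = dtile i j"
    from r' show ?thesis
    proof (elim disjE)
      assume 2: "\<rho>' = vtile i' j'"
      show ?thesis by (rule VD[of i' j' i j]) (use z 1 2 in \<open>auto\<close>)
    next
      assume 2: "\<rho>' = utile i' j'"
      show ?thesis by (rule UD[of i' j' i j]) (use z 1 2 in \<open>auto\<close>)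
    next
      assume 2: "\<rho>' = dtile i' j'"
      show ?thesis by (rule DD[of i j i' j']) (use z 1 2 in \<open>auto\<close>)
    qed
  qed
qed

lemma tile_of_cR:
  assumes "\<rho> \<in> tiles" "cR i j \<in> \<rho>"
  shows "\<rho> = vtile i j \<or> \<rho> = utile i j \<or> \<rho> = dtile i j"
  using assms unfolding tiles_def Un_iff mem_Collect_eq
  by (elim disjE exE conjE) (simp_all add: cR_mem_tiles)

lemma tile_of_cL:
  assumes "\<rho> \<in> tiles" "cL i j \<in> \<rho>"
  shows "\<rho> = vtile i j \<or> \<rho> = utile (i - 1) j \<or> \<rho> = dtile (i - 1) (j + 1)"
  using assms unfolding tiles_def Un_iff mem_Collect_eq
  by (elim disjE exE conjE) (simp_all add: cL_mem_tiles)

section \<open>Tilings as perfect matchings\<close>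

text \<open>The triangles to the right and to the left of the vertical segment above (i, j).
  Labelling by the vertical side makes \<open>vtile i j\<close> the union of the two triangles with
  its own label.\<close>

definition triR :: "int \<Rightarrow> int \<Rightarrow> complex set" where
  "triR i j = {z. of_int i \<le> cx z \<and> of_int j \<le> cy z \<and> cx z + cy z \<le> of_int (i + j) + 1}"

definition triL :: "int \<Rightarrow> int \<Rightarrow> complex set" where
  "triL i j = {z. cx z \<le> of_int i \<and> cy z \<le> of_int j + 1 \<and> of_int (i + j) \<le> cx z + cy z}"

lemma triR_subset: "triR i j \<subseteq> vtile i j" "triR i j \<subseteq> utile i j" "triR i j \<subseteq> dtile i j"
  unfolding triR_def vtile_def utile_def dtile_def by auto

lemma triL_subset: "triL i j \<subseteq> vtile i j" "triL i j \<subseteq> utile (i - 1) j" "triL i j \<subseteq> dtile (i - 1) (j + 1)"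
  unfolding triL_def vtile_def utile_def dtile_def by auto

locale hex =
  fixes a b c :: nat
  assumes pos: "0 < a" "0 < b" "0 < c"
begin

abbreviation "H \<equiv> hexagon (real a) (real b) (real c)"

lemma H_eq: "H = {z. 0 \<le> cx z \<and> cx z \<le> real a + real b \<and> - real b \<le> cy z \<and> cy z \<le> real c \<and>
           0 \<le> cx z + cy z \<and> cx z + cy z \<le> real a + real c}"
  using hexagon_eq[of a b c] pos by auto

text \<open>Both ends of the vertical unit segment above (i, j) lie in the hexagon. The two
  triangles beside it are then inside as well, except to the right of the right side and to the left
  of the left side, which \<open>inR\<close> and \<open>inL\<close> exclude.\<close>

definition seg :: "int \<Rightarrow> int \<Rightarrow> bool" where
  "seg i j \<longleftrightarrow> 0 \<le> i \<and> i \<le> int a + int b \<and> - int b \<le> j \<and> j < int c \<and> 0 \<le> i + j \<and> i + j < int a + int c"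

definition inR :: "int \<Rightarrow> int \<Rightarrow> bool" where "inR i j \<longleftrightarrow> seg i j \<and> i < int a + int b"
definition inL :: "int \<Rightarrow> int \<Rightarrow> bool" where "inL i j \<longleftrightarrow> seg i j \<and> 0 < i"

lemma cR_mem_H: "cR i j \<in> H \<longleftrightarrow> inR i j"
  unfolding H_eq cR_def mem_Collect_eq cx_pt cy_pt inR_def seg_def by (intro iffI conjI; linarith)

lemma cL_mem_H: "cL i j \<in> H \<longleftrightarrow> inL i j"
  unfolding H_eq cL_def mem_Collect_eq cx_pt cy_pt inL_def seg_def by (intro iffI conjI; linarith)

text \<open>The sides of the hexagon are lattice lines, so a tile is inside as soon as the centers
  of its two triangles are.\<close>

lemma vtile_subset_H: "vtile i j \<subseteq> H \<longleftrightarrow> inR i j \<and> inL i j"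
proof
  assume "vtile i j \<subseteq> H"
  thus "inR i j \<and> inL i j" using cR_mem_tiles(1)[of i j i j] cL_mem_tiles(1)[of i j i j] cR_mem_H cL_mem_H by blast
next
  assume A: "inR i j \<and> inL i j"
  show "vtile i j \<subseteq> H"
    using A unfolding H_eq vtile_def inR_def inL_def seg_def by (intro subsetI, unfold mem_Collect_eq, intro conjI; linarith)
qed

lemma utile_subset_H: "utile i j \<subseteq> H \<longleftrightarrow> inR i j \<and> inL (i + 1) j"
proof
  assume "utile i j \<subseteq> H"
  thus "inR i j \<and> inL (i + 1) j" using cR_mem_tiles(2)[of i j i j] cL_mem_tiles(2)[of "i + 1" j i j] cR_mem_H cL_mem_H by blast
next
  assume A: "inR i j \<and> inL (i + 1) j"
  show "utile i j \<subseteq> H"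
    using A unfolding H_eq utile_def inR_def inL_def seg_def by (intro subsetI, unfold mem_Collect_eq, intro conjI; linarith)
qed

lemma dtile_subset_H: "dtile i j \<subseteq> H \<longleftrightarrow> inR i j \<and> inL (i + 1) (j - 1)"
proof
  assume "dtile i j \<subseteq> H"
  thus "inR i j \<and> inL (i + 1) (j - 1)" using cR_mem_tiles(3)[of i j i j] cL_mem_tiles(3)[of "i + 1" "j - 1" i j] cR_mem_H cL_mem_H by blast
next
  assume A: "inR i j \<and> inL (i + 1) (j - 1)"
  show "dtile i j \<subseteq> H"
    using A unfolding H_eq dtile_def inR_def inL_def seg_def by (intro subsetI, unfold mem_Collect_eq, intro conjI; linarith)
qed

lemma unit_interval:
  assumes "real_of_int p \<le> x" "x \<le> real_of_int q" "p < q"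
  obtains i where "p \<le> i" "i < q" "real_of_int i \<le> x" "x \<le> real_of_int i + 1"
proof (cases "x = real_of_int q")
  case True
  thus ?thesis using that[of "q - 1"] assms by auto
next
  case False
  thus ?thesis using that[of "\<lfloor>x\<rfloor>"] assms by (auto simp: le_floor_iff floor_less_iff)
qed

text \<open>The values of \<open>cx\<close>, \<open>cy\<close> and \<open>cx + cy\<close> lie in
  unit intervals starting at \<open>i\<close>, \<open>j\<close> and \<open>k\<close>. For
  \<open>k = i + j\<close> and \<open>k = i + j + 1\<close> these bounds give a right and a left
  triangle; the two extreme values of \<open>k\<close> occur only at lattice points, where one of
  the six surrounding triangles is inside the hexagon.\<close>

lemma H_covered:
  assumes "z \<in> H"
  shows "\<exists>i j. inR i j \<and> z \<in> triR i j \<or> inL i j \<and> z \<in> triL i j"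
proof -
  let ?n = "int a + int b"
  have z: "of_int 0 \<le> cx z" "cx z \<le> of_int ?n" "of_int (- int b) \<le> cy z" "cy z \<le> of_int (int c)"
    "of_int 0 \<le> cx z + cy z" "cx z + cy z \<le> of_int (int a + int c)"
    using assms unfolding H_eq by auto
  have p: "0 < ?n" "- int b < int c" "0 < int a + int c" using pos by auto
  obtain i where i: "0 \<le> i" "i < ?n" "of_int i \<le> cx z" "cx z \<le> of_int i + 1"
    by (rule unit_interval[OF z(1,2) p(1)])
  obtain j where j: "- int b \<le> j" "j < int c" "of_int j \<le> cy z" "cy z \<le> of_int j + 1"
    by (rule unit_interval[OF z(3,4) p(2)])
  obtain k where k: "0 \<le> k" "k < int a + int c" "of_int k \<le> cx z + cy z" "cx z + cy z \<le> of_int k + 1"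
    by (rule unit_interval[OF z(5,6) p(3)])
  have lat: ?thesis if "cx z = of_int p" "cy z = of_int q" for p q
  proof -
    have pq: "0 \<le> p" "p \<le> ?n" "- int b \<le> q" "q \<le> int c" "0 \<le> p + q" "p + q \<le> int a + int c"
      using z unfolding that by linarith+
    have "inR p q \<or> inR (p - 1) q \<or> inR p (q - 1) \<or> inL p q \<or> inL p (q - 1) \<or> inL (p + 1) (q - 1)"
    proof (rule ccontr)
      assume N: "\<not> (inR p q \<or> inR (p - 1) q \<or> inR p (q - 1) \<or> inL p q \<or> inL p (q - 1) \<or> inL (p + 1) (q - 1))"
      have 1: "\<not> (p < ?n \<and> q < int c \<and> p + q < int a + int c)"
      proof
        assume A: "(p < ?n \<and> q < int c \<and> p + q < int a + int c)"
        have "inR p q" using A pq unfolding inR_def inL_def seg_def by (intro conjI; linarith)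
        thus False using N by blast
      qed
      have 2: "\<not> (0 < p \<and> - int b < q \<and> 0 < p + q)"
      proof
        assume A: "(0 < p \<and> - int b < q \<and> 0 < p + q)"
        have "inL p (q - 1)" using A pq unfolding inR_def inL_def seg_def by (intro conjI; linarith)
        thus False using N by blast
      qed
      have 3: "\<not> (0 < p \<and> q < int c \<and> p + q < int a + int c)"
      proof
        assume A: "(0 < p \<and> q < int c \<and> p + q < int a + int c)"
        have "inL p q" using A pq unfolding inR_def inL_def seg_def by (intro conjI; linarith)
        thus False using N by blast
      qed
      have 4: "\<not> (p < ?n \<and> - int b < q \<and> 0 < p + q)"
      proof
        assume A: "(p < ?n \<and> - int b < q \<and> 0 < p + q)"
        have "inR p (q - 1)" using A pq unfolding inR_def inL_def seg_def by (intro conjI; linarith)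
        thus False using N by blast
      qed
      have 5: "\<not> (0 < p \<and> q < int c \<and> 0 < p + q)"
      proof
        assume A: "(0 < p \<and> q < int c \<and> 0 < p + q)"
        have "inR (p - 1) q" using A pq unfolding inR_def inL_def seg_def by (intro conjI; linarith)
        thus False using N by blast
      qed
      have 6: "\<not> (p < ?n \<and> - int b < q \<and> p + q < int a + int c)"
      proof
        assume A: "(p < ?n \<and> - int b < q \<and> p + q < int a + int c)"
        have "inL (p + 1) (q - 1)" using A pq unfolding inR_def inL_def seg_def by (intro conjI; linarith)
        thus False using N by blast
      qed
      show False
      proof (cases "p = 0")
        case True
        thus False using 6 pq pos by auto
      next
        case False
        hence "\<not> (0 < p + q)" using 2 5 pq pos by auto
        thus False using 3 False pq pos by auto
      qed
    qed
    moreover have "z \<in> triR p q" "z \<in> triR (p - 1) q" "z \<in> triR p (q - 1)"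
      "z \<in> triL p q" "z \<in> triL p (q - 1)" "z \<in> triL (p + 1) (q - 1)"
      unfolding triR_def triL_def mem_Collect_eq that by auto
    ultimately show ?thesis by blast
  qed
  have "i + j \<le> k + 1" "k \<le> i + j + 2" using i j k by linarith+
  then consider "k = i + j" | "k = i + j + 1" | "k = i + j - 1" | "k = i + j + 2" by linarith
  thus ?thesis
  proof cases
    case 1
    have "inR i j" "z \<in> triR i j" using i j k 1 unfolding inR_def seg_def triR_def by auto
    thus ?thesis by blast
  next
    case 2
    have "inL (i + 1) j" "z \<in> triL (i + 1) j" using i j k 2 unfolding inL_def seg_def triL_def by auto
    thus ?thesis by blast
  next
    case 3
    have "cx z = of_int i" "cy z = of_int j" using i j k unfolding 3 by auto
    thus ?thesis by (rule lat)
  next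
    case 4
    have "cx z = of_int (i + 1)" "cy z = of_int (j + 1)" using i j k unfolding 4 by auto
    thus ?thesis by (rule lat)
  qed
qed

definition exactly_one :: "bool \<Rightarrow> bool \<Rightarrow> bool \<Rightarrow> bool" where
  "exactly_one p q r \<longleftrightarrow> (p \<and> \<not> q \<and> \<not> r) \<or> (\<not> p \<and> q \<and> \<not> r) \<or> (\<not> p \<and> \<not> q \<and> r)"

text \<open>A tiling is a perfect matching of the unit triangles; a triangle lies in a union of
  tiles exactly if its center does.\<close>

lemma tilings_iff:
  "T \<in> tilings (real a) (real b) (real c) \<longleftrightarrow> T \<subseteq> tiles \<and>
     (\<forall>i j. vtile i j \<in> T \<longrightarrow> inR i j \<and> inL i j) \<and>
     (\<forall>i j. utile i j \<in> T \<longrightarrow> inR i j \<and> inL (i + 1) j) \<and>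
     (\<forall>i j. dtile i j \<in> T \<longrightarrow> inR i j \<and> inL (i + 1) (j - 1)) \<and>
     (\<forall>i j. inR i j \<longrightarrow> exactly_one (vtile i j \<in> T) (utile i j \<in> T) (dtile i j \<in> T)) \<and>
     (\<forall>i j. inL i j \<longrightarrow> exactly_one (vtile i j \<in> T) (utile (i - 1) j \<in> T) (dtile (i - 1) (j + 1) \<in> T))"
    (is "?A \<longleftrightarrow> ?B")
proof
  assume ?A
  hence T: "T \<subseteq> tiles" "pairwise (\<lambda>R R'. interior R \<inter> interior R' = {}) T" "\<Union> T = H"
    unfolding tilings_def lattice_rhombi by auto
  have sub: "\<rho> \<subseteq> H" if "\<rho> \<in> T" for \<rho> using that T(3) by blast
  have mem: "\<exists>\<rho>\<in>T. z \<in> \<rho>" if "z \<in> H" for z using that T(3) by blast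
  have eqR: "\<rho> = \<rho>'" if "\<rho> \<in> T" "\<rho>' \<in> T" "cR i j \<in> \<rho>" "cR i j \<in> \<rho>'" for \<rho> \<rho>' i j
  proof (rule ccontr)
    assume "\<rho> \<noteq> \<rho>'"
    hence "interior \<rho> \<inter> interior \<rho>' = {}" using pairwiseD[OF T(2) that(1,2)] by blast
    moreover have "cR i j \<in> interior \<rho>" "cR i j \<in> interior \<rho>'"
      using that T(1) interior_center_tiles(1)[of _ i j] by blast+
    ultimately show False by blast
  qed
  have eqL: "\<rho> = \<rho>'" if "\<rho> \<in> T" "\<rho>' \<in> T" "cL i j \<in> \<rho>" "cL i j \<in> \<rho>'" for \<rho> \<rho>' i j
  proof (rule ccontr)
    assume "\<rho> \<noteq> \<rho>'"
    hence "interior \<rho> \<inter> interior \<rho>' = {}" using pairwiseD[OF T(2) that(1,2)] by blast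
    moreover have "cL i j \<in> interior \<rho>" "cL i j \<in> interior \<rho>'"
      using that T(1) interior_center_tiles(2)[of _ i j] by blast+
    ultimately show False by blast
  qed
  have R: "exactly_one (vtile i j \<in> T) (utile i j \<in> T) (dtile i j \<in> T)" if "inR i j" for i j
  proof -
    have "cR i j \<in> H" using that by (simp only: cR_mem_H)
    from mem[OF this] obtain \<rho> where \<rho>: "\<rho> \<in> T" "cR i j \<in> \<rho>" by (elim bexE)
    hence "\<rho> \<in> tiles" using T(1) by (elim subsetD[rotated])
    hence "\<rho> = vtile i j \<or> \<rho> = utile i j \<or> \<rho> = dtile i j"
      using \<rho>(2) by (rule tile_of_cR)
    moreover have "vtile i j \<noteq> utile i j" "vtile i j \<noteq> dtile i j" "utile i j \<noteq> dtile i j"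
      using cL_mem_tiles[of i j i j] cL_mem_tiles[of "i + 1" j i j] by auto
    moreover have "cR i j \<in> vtile i j" "cR i j \<in> utile i j" "cR i j \<in> dtile i j" by (auto simp: cR_mem_tiles)
    ultimately show ?thesis using \<rho>(1) eqR[of "vtile i j" "utile i j" i j] eqR[of "vtile i j" "dtile i j" i j]
        eqR[of "utile i j" "dtile i j" i j] unfolding exactly_one_def by blast
  qed
  have L: "exactly_one (vtile i j \<in> T) (utile (i - 1) j \<in> T) (dtile (i - 1) (j + 1) \<in> T)" if "inL i j" for i j
  proof -
    have "cL i j \<in> H" using that by (simp only: cL_mem_H)
    from mem[OF this] obtain \<rho> where \<rho>: "\<rho> \<in> T" "cL i j \<in> \<rho>" by (elim bexE)
    hence "\<rho> \<in> tiles" using T(1) by (elim subsetD[rotated])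
    hence "\<rho> = vtile i j \<or> \<rho> = utile (i - 1) j \<or> \<rho> = dtile (i - 1) (j + 1)"
      using \<rho>(2) by (rule tile_of_cL)
    moreover have "vtile i j \<noteq> utile (i - 1) j" "vtile i j \<noteq> dtile (i - 1) (j + 1)" "utile (i - 1) j \<noteq> dtile (i - 1) (j + 1)"
      using cR_mem_tiles(1)[of i j i j] cR_mem_tiles(2)[of i j "i - 1" j] cR_mem_tiles(3)[of i j "i - 1" "j + 1"]
       cR_mem_tiles(2)[of "i - 1" j "i - 1" j] cR_mem_tiles(3)[of "i - 1" j "i - 1" "j + 1"] by auto
    moreover have "cL i j \<in> vtile i j" "cL i j \<in> utile (i - 1) j" "cL i j \<in> dtile (i - 1) (j + 1)" by (auto simp: cL_mem_tiles)
    ultimately show ?thesis using \<rho>(1) eqL[of "vtile i j" "utile (i - 1) j" i j] eqL[of "vtile i j" "dtile (i - 1) (j + 1)" i j]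
        eqL[of "utile (i - 1) j" "dtile (i - 1) (j + 1)" i j] unfolding exactly_one_def by blast
  qed
  show ?B
    by (intro conjI allI impI T(1) R L;
        (drule sub, simp only: vtile_subset_H utile_subset_H dtile_subset_H)?)
next
  assume ?B
  hence B: "T \<subseteq> tiles"
    and BV: "\<And>i j. vtile i j \<in> T \<Longrightarrow> inR i j \<and> inL i j"
    and BU: "\<And>i j. utile i j \<in> T \<Longrightarrow> inR i j \<and> inL (i + 1) j"
    and BD: "\<And>i j. dtile i j \<in> T \<Longrightarrow> inR i j \<and> inL (i + 1) (j - 1)"
    and BR: "\<And>i j. inR i j \<Longrightarrow> exactly_one (vtile i j \<in> T) (utile i j \<in> T) (dtile i j \<in> T)"
    and BL: "\<And>i j. inL i j \<Longrightarrow> exactly_one (vtile i j \<in> T) (utile (i - 1) j \<in> T) (dtile (i - 1) (j + 1) \<in> T)"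
    by simp_all
  have eqR: "\<rho> = \<rho>'" if "\<rho> \<in> T" "\<rho>' \<in> T" "cR i j \<in> \<rho>" "cR i j \<in> \<rho>'" for \<rho> \<rho>' i j
  proof -
    have "\<rho> \<in> tiles" "\<rho>' \<in> tiles" using B that(1,2) by auto
    hence 1: "\<rho> = vtile i j \<or> \<rho> = utile i j \<or> \<rho> = dtile i j" and 2: "\<rho>' = vtile i j \<or> \<rho>' = utile i j \<or> \<rho>' = dtile i j"
      using that(3,4) tile_of_cR by simp_all
    have "inR i j" using 1 that(1) BV[of i j] BU[of i j] BD[of i j] by auto
    from BR[OF this] show ?thesis using 1 2 that(1,2) unfolding exactly_one_def by (elim disjE) simp_all
  qed
  have eqL: "\<rho> = \<rho>'" if "\<rho> \<in> T" "\<rho>' \<in> T" "cL i j \<in> \<rho>" "cL i j \<in> \<rho>'" for \<rho> \<rho>' i j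
  proof -
    have "\<rho> \<in> tiles" "\<rho>' \<in> tiles" using B that(1,2) by auto
    hence 1: "\<rho> = vtile i j \<or> \<rho> = utile (i - 1) j \<or> \<rho> = dtile (i - 1) (j + 1)"
      and 2: "\<rho>' = vtile i j \<or> \<rho>' = utile (i - 1) j \<or> \<rho>' = dtile (i - 1) (j + 1)"
      using that(3,4) tile_of_cL by simp_all
    have "inL i j" using 1 that(1) BV[of i j] BU[of "i - 1" j] BD[of "i - 1" "j + 1"] by auto
    from BL[OF this] show ?thesis using 1 2 that(1,2) unfolding exactly_one_def by (elim disjE) simp_all
  qed
  have "pairwise (\<lambda>R R'. interior R \<inter> interior R' = {}) T"
  proof (rule pairwiseI, rule ccontr)
    fix \<rho> \<rho>' assume \<rho>: "\<rho> \<in> T" "\<rho>' \<in> T" "\<rho> \<noteq> \<rho>'" "interior \<rho> \<inter> interior \<rho>' \<noteq> {}"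
    obtain i j where "cR i j \<in> \<rho> \<and> cR i j \<in> \<rho>' \<or> cL i j \<in> \<rho> \<and> cL i j \<in> \<rho>'"
      using tiles_common_center[OF subsetD[OF B \<rho>(1)] subsetD[OF B \<rho>(2)] \<rho>(4)] by (elim exE)
    thus False using eqR[OF \<rho>(1,2), of i j] eqL[OF \<rho>(1,2), of i j] \<rho>(3) by blast
  qed
  moreover have "\<Union> T \<subseteq> H"
  proof (rule Union_least)
    fix \<rho> assume \<rho>: "\<rho> \<in> T"
    have "\<rho> \<in> tiles" using subsetD[OF B \<rho>] .
    thus "\<rho> \<subseteq> H" unfolding tiles_def Un_iff mem_Collect_eq
      using \<rho> by (elim disjE exE conjE)
        (simp_all add: vtile_subset_H utile_subset_H dtile_subset_H BV BU BD)
  qed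
  moreover have "H \<subseteq> \<Union> T"
  proof
    fix z assume z: "z \<in> H"
    from H_covered[OF z] obtain i j where "inR i j \<and> z \<in> triR i j \<or> inL i j \<and> z \<in> triL i j" by (elim exE)
    thus "z \<in> \<Union> T"
    proof
      assume *: "inR i j \<and> z \<in> triR i j"
      hence "exactly_one (vtile i j \<in> T) (utile i j \<in> T) (dtile i j \<in> T)" using BR by simp
      thus ?thesis using * triR_subset[of i j] unfolding exactly_one_def by blast
    next
      assume *: "inL i j \<and> z \<in> triL i j"
      hence "exactly_one (vtile i j \<in> T) (utile (i - 1) j \<in> T) (dtile (i - 1) (j + 1) \<in> T)" using BL by simp
      thus ?thesis using * triL_subset[of i j] unfolding exactly_one_def by blast
    qed
  qed
  ultimately show ?A using B unfolding tilings_def lattice_rhombi mem_Collect_eq by (intro conjI equalityI)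
qed

end

text \<open>Among the four non-vertical unit vectors only two pairs differ by the upward unit
  vector. They point away from the right corner and away from the left corner of the same
  rhombus.\<close>

lemma vertical_rhombus:
  assumes "u \<in> units \<or> - u \<in> units" "v \<in> units \<or> - v \<in> units" "Re u \<noteq> 0" "Re v \<noteq> 0"
    and "P + u = pt (of_int i) (of_int j)" "P + v = pt (of_int i) (of_int j + 1)"
  shows "rhombus P u v = vtile i j"
proof -
  have r: "rhombus (pt (of_int i - 1) (of_int j + 1)) (pt 1 0) (pt 1 (-1)) = vtile i j"
    using rhombus_tiles(2)[OF refl, of "i - 1" "j + 1"] by simp
  have u: "w = pt 1 0 \<or> w = pt (-1) 0 \<or> w = pt 1 (-1) \<or> w = pt (-1) 1"
    if "w \<in> units \<or> - w \<in> units" "Re w \<noteq> 0" for w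
  proof -
    have "w = pt 0 1 \<or> w = pt 1 0 \<or> w = pt 1 (-1) \<or> - w = pt 0 1 \<or> - w = pt 1 0 \<or> - w = pt 1 (-1)"
      using that(1) unfolding units_def by blast
    moreover have "- w = pt x y \<Longrightarrow> w = pt (-x) (-y)" for x y by (metis minus_minus pt_minus)
    moreover have "w \<noteq> pt 0 1" "w \<noteq> pt 0 (-1)" using that(2) by (auto simp: Re_pt)
    ultimately show ?thesis by fastforce
  qed
  have P: "P = pt (of_int i) (of_int j) - u" and v: "v = u + pt 0 1"
    using assms(5,6) by (auto simp: complex_eq_iff_cx_cy algebra_simps)
  consider "u = pt (-1) 0" | "u = pt 1 (-1)"
    using u[OF assms(1,3)] u[OF assms(2,4)] unfolding v by (auto simp: pt_add)
  thus ?thesis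
  proof cases
    case 1
    have "rhombus P u v = rhombus (pt (of_int i) (of_int j)) (pt 1 0) (pt (-1) 1)"
      unfolding rhombus_neg[of P u v] unfolding P v 1 by (simp add: pt_add pt_minus pt_diff)
    also have "\<dots> = rhombus (pt (of_int i) (of_int j)) (pt (-1) 1) (pt 1 0)" by (rule rhombus_swap)
    also have "\<dots> = rhombus (pt (of_int i - 1) (of_int j + 1)) (pt 1 (-1)) (pt 1 0)"
      by (subst rhombus_neg) (simp add: pt_add pt_minus)
    also have "\<dots> = vtile i j" by (subst rhombus_swap) (rule r)
    finally show ?thesis .
  next
    case 2
    have "rhombus P u v = rhombus (pt (of_int i - 1) (of_int j + 1)) (pt 1 (-1)) (pt 1 0)"
      unfolding P v 2 by (simp add: pt_add pt_diff)
    also have "\<dots> = vtile i j" by (subst rhombus_swap) (rule r)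
    finally show ?thesis .
  qed
qed

text \<open>A segment determines its pair of end points, so the diagonal fixes \<open>P + u\<close>
  and \<open>P + v\<close> up to order.\<close>

lemma is_hole_iff: "is_hole T (pt (of_int i) (of_int j)) \<longleftrightarrow> vtile i j \<in> T"
proof
  assume "is_hole T (pt (of_int i) (of_int j))"
  then obtain P u v where *: "lattice_rhombus P u v" "rhombus P u v \<in> T" "Re u \<noteq> 0" "Re v \<noteq> 0"
    "closed_segment (P + u) (P + v) = closed_segment (pt (of_int i) (of_int j)) (pt (of_int i) (of_int j) + \<i>)"
    unfolding is_hole_def by blast
  have i: "pt (of_int i) (of_int j) + \<i> = pt (of_int i) (of_int j + 1)" by (simp add: complex_eq_iff_cx_cy)
  have uv: "u \<in> units \<or> - u \<in> units" "v \<in> units \<or> - v \<in> units" using lattice_rhombusE[OF *(1)] by metis+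
  have "{P + u, P + v} = {pt (of_int i) (of_int j), pt (of_int i) (of_int j + 1)}"
    using *(5) unfolding i closed_segment_eq .
  then consider "P + u = pt (of_int i) (of_int j)" "P + v = pt (of_int i) (of_int j + 1)"
    | "P + v = pt (of_int i) (of_int j)" "P + u = pt (of_int i) (of_int j + 1)"
    unfolding doubleton_eq_iff by blast
  thus "vtile i j \<in> T"
  proof cases
    case 1
    from vertical_rhombus[OF uv *(3,4) 1] *(2) show ?thesis by simp
  next
    case 2
    from vertical_rhombus[OF uv(2,1) *(4,3) 2] *(2) show ?thesis by (simp add: rhombus_swap[of P u v])
  qed
next
  assume T: "vtile i j \<in> T"
  let ?P = "pt (of_int (i - 1)) (of_int (j + 1))"
  have u: "pt 1 (-1) \<in> units" "pt 1 0 \<in> units" "pt 1 (-1) \<noteq> pt 1 0" by (auto simp: units_def)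
  have "lattice_rhombus ?P (pt 1 (-1)) (pt 1 0)" by (rule lattice_rhombus_pt[OF u])
  moreover have "rhombus ?P (pt 1 (-1)) (pt 1 0) = vtile i j"
    using rhombus_tiles(2)[OF refl, of "i - 1" "j + 1"] by (simp add: rhombus_swap[of _ "pt 1 (-1)"])
  moreover have "?P + pt 1 (-1) = pt (of_int i) (of_int j)" "?P + pt 1 0 = pt (of_int i) (of_int j) + \<i>"
    by (simp_all add: complex_eq_iff_cx_cy)
  ultimately show "is_hole T (pt (of_int i) (of_int j))"
    unfolding is_hole_def using T
    by (intro exI[of _ ?P] exI[of _ "pt 1 (-1)"] exI[of _ "pt 1 0"]) (simp add: Re_pt)
qed

section \<open>Columns of the hexagon and their sites\<close>

context hex
begin

text \<open>The second coordinates of the lowest and of the highest lattice point of column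
  \<open>m\<close>. No segment of the hexagon starts upwards at the highest one, so the sites are
  \<open>lo m..<hi m\<close>.\<close>

definition lo :: "nat \<Rightarrow> int" where "lo m = - int (min m b)"
definition hi :: "nat \<Rightarrow> int" where "hi m = min (int c) (int a + int c - int m)"
definition N :: "nat \<Rightarrow> nat" where "N m = nat (hi m - lo m)"

lemma lo_less_hi: "m \<le> a + b \<Longrightarrow> lo m < hi m"
  unfolding lo_def hi_def using pos by auto

lemma seg_iff: "m \<le> a + b \<Longrightarrow> seg (int m) j \<longleftrightarrow> lo m \<le> j \<and> j < hi m"
  unfolding seg_def lo_def hi_def by auto

lemma column_eq:
  assumes "m \<le> a + b"
  shows "column (real a) (real b) (real c) (real m) = (\<lambda>j. pt (real m) (of_int j)) ` {lo m..hi m}"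
proof -
  have "pt (of_int i) (of_int j) \<in> H \<and> Re (pt (of_int i) (of_int j)) = real m * sqrt 3 / 2 \<longleftrightarrow>
      i = int m \<and> j \<in> {lo m..hi m}" for i j
  proof -
    have "Re (pt (of_int i) (of_int j)) = real m * sqrt 3 / 2 \<longleftrightarrow> i = int m"
    proof -
      have "Re (pt (of_int i) (of_int j)) = real m * sqrt 3 / 2 \<longleftrightarrow> real_of_int i = real_of_int (int m)"
        by (simp add: Re_pt)
      thus ?thesis by (simp only: of_int_eq_iff)
    qed
    moreover have "pt (of_int (int m)) (of_int j) \<in> H \<longleftrightarrow> j \<in> {lo m..hi m}"
      unfolding H_eq mem_Collect_eq cx_pt cy_pt atLeastAtMost_iff lo_def hi_def using assms by (intro iffI conjI; linarith)
    ultimately show ?thesis by auto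
  qed
  note * = this
  show ?thesis
  proof (intro equalityI subsetI)
    fix z assume "z \<in> column (real a) (real b) (real c) (real m)"
    then obtain i j where z: "z = pt (of_int i) (of_int j)" "z \<in> H" "Re z = real m * sqrt 3 / 2"
      unfolding column_def tri_lattice_pt by blast
    have "i = int m \<and> j \<in> {lo m..hi m}" using *[of i j] z by blast
    thus "z \<in> (\<lambda>j. pt (real m) (of_int j)) ` {lo m..hi m}" using z(1) by auto
  next
    fix z assume "z \<in> (\<lambda>j. pt (real m) (of_int j)) ` {lo m..hi m}"
    then obtain j where j: "z = pt (of_int (int m)) (of_int j)" "j \<in> {lo m..hi m}" by auto
    thus "z \<in> column (real a) (real b) (real c) (real m)"
      using *[of "int m" j] unfolding column_def tri_lattice_pt by blast
  qed
qed

lemma lowest_point_eq: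
  assumes "m \<le> a + b"
  shows "lowest_point (real a) (real b) (real c) (real m) = pt (real m) (of_int (lo m))"
proof -
  have "is_arg_min Im (\<lambda>x. x \<in> (\<lambda>j. pt (real m) (of_int j)) ` {lo m..hi m}) x \<longleftrightarrow> x = pt (real m) (of_int (lo m))" for x
  proof
    assume A: "is_arg_min Im (\<lambda>x. x \<in> (\<lambda>j. pt (real m) (of_int j)) ` {lo m..hi m}) x"
    then obtain j where j: "x = pt (real m) (of_int j)" "j \<in> {lo m..hi m}" unfolding is_arg_min_linorder by auto
    have "pt (real m) (of_int (lo m)) \<in> (\<lambda>j. pt (real m) (of_int j)) ` {lo m..hi m}" using lo_less_hi[OF assms] by simp
    hence "Im x \<le> Im (pt (real m) (of_int (lo m)))" using A unfolding is_arg_min_linorder by blast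
    thus "x = pt (real m) (of_int (lo m))" using j by (simp add: Im_pt)
  next
    assume "x = pt (real m) (of_int (lo m))"
    thus "is_arg_min Im (\<lambda>x. x \<in> (\<lambda>j. pt (real m) (of_int j)) ` {lo m..hi m}) x"
      unfolding is_arg_min_linorder using lo_less_hi[OF assms] by (auto simp: Im_pt)
  qed
  note * = this
  show ?thesis unfolding lowest_point_def column_eq[OF assms] arg_min_on_def arg_min_def
    by (rule some_equality; simp add: *)
qed

lemma highest_point_eq:
  assumes "m \<le> a + b"
  shows "arg_max_on Im (column (real a) (real b) (real c) (real m)) = pt (real m) (of_int (hi m))"
proof -
  have "is_arg_max Im (\<lambda>x. x \<in> (\<lambda>j. pt (real m) (of_int j)) ` {lo m..hi m}) x \<longleftrightarrow> x = pt (real m) (of_int (hi m))" for x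
  proof
    assume A: "is_arg_max Im (\<lambda>x. x \<in> (\<lambda>j. pt (real m) (of_int j)) ` {lo m..hi m}) x"
    then obtain j where j: "x = pt (real m) (of_int j)" "j \<in> {lo m..hi m}" unfolding is_arg_max_linorder by auto
    have "pt (real m) (of_int (hi m)) \<in> (\<lambda>j. pt (real m) (of_int j)) ` {lo m..hi m}" using lo_less_hi[OF assms] by simp
    hence "Im (pt (real m) (of_int (hi m))) \<le> Im x" using A unfolding is_arg_max_linorder by blast
    thus "x = pt (real m) (of_int (hi m))" using j by (simp add: Im_pt)
  next
    assume "x = pt (real m) (of_int (hi m))"
    thus "is_arg_max Im (\<lambda>x. x \<in> (\<lambda>j. pt (real m) (of_int j)) ` {lo m..hi m}) x"
      unfolding is_arg_max_linorder using lo_less_hi[OF assms] by (auto simp: Im_pt)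
  qed
  note * = this
  show ?thesis unfolding column_eq[OF assms] arg_max_on_def arg_max_def
    by (rule some_equality; simp add: *)
qed

lemma sites_eq:
  assumes "m \<le> a + b"
  shows "sites (real a) (real b) (real c) (real m) = (\<lambda>j. pt (real m) (of_int j)) ` {lo m..<hi m}"
  unfolding sites_def highest_point_eq[OF assms] unfolding column_eq[OF assms] by (auto simp: order_less_le)

lemma card_sites:
  assumes "m \<le> a + b"
  shows "card (sites (real a) (real b) (real c) (real m)) = N m"
  unfolding sites_eq[OF assms] N_def by (subst card_image) (auto intro: inj_onI)

lemma holes_eq:
  assumes "m \<le> a + b"
  shows "holes (real a) (real b) (real c) (real m) T = (\<lambda>j. of_int (j - lo m)) ` {j. lo m \<le> j \<and> j < hi m \<and> vtile (int m) j \<in> T}"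
proof -
  have "dist (pt (real m) (of_int (lo m))) (pt (real m) (of_int j)) = of_int (j - lo m)" if "lo m \<le> j" for j
  proof -
    have "(dist (pt (real m) (of_int (lo m))) (pt (real m) (of_int j)))\<^sup>2 = (of_int (j - lo m))\<^sup>2"
      unfolding dist_norm pt_diff norm_pt by (simp add: power2_commute)
    moreover have "(0::real) \<le> of_int (j - lo m)" using that by simp
    ultimately show ?thesis by (simp add: power2_eq_iff_nonneg)
  qed
  moreover have "is_hole T (pt (real m) (of_int j)) \<longleftrightarrow> vtile (int m) j \<in> T" for j
    using is_hole_iff[of T "int m" j] by simp
  ultimately show ?thesis
    unfolding holes_def sites_eq[OF assms] lowest_point_eq[OF assms] by (force simp: image_iff)
qed

end

section \<open>Tilings as nonintersecting paths\<close>

lemma tile_eq_iff [simp]: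
  "vtile i j = vtile i' j' \<longleftrightarrow> i = i' \<and> j = j'"
  "utile i j = utile i' j' \<longleftrightarrow> i = i' \<and> j = j'"
  "dtile i j = dtile i' j' \<longleftrightarrow> i = i' \<and> j = j'"
  using cR_mem_tiles by metis+

lemma tile_kinds_differ [simp]:
  "vtile i j \<noteq> utile i' j'" "vtile i j \<noteq> dtile i' j'" "utile i j \<noteq> dtile i' j'"
  "utile i' j' \<noteq> vtile i j" "dtile i' j' \<noteq> vtile i j" "dtile i' j' \<noteq> utile i j"
proof -
  have 1: "cR i j \<in> vtile i j" "cL i j \<in> vtile i j" "cR i j \<in> utile i j" "cL (i + 1) j \<in> utile i j"
    by (simp_all add: cR_mem_tiles cL_mem_tiles)
  show vu: "vtile i j \<noteq> utile i' j'"
  proof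
    assume *: "vtile i j = utile i' j'"
    show False using 1(1,2) unfolding * by (simp add: cR_mem_tiles cL_mem_tiles)
  qed
  show vd: "vtile i j \<noteq> dtile i' j'"
  proof
    assume *: "vtile i j = dtile i' j'"
    show False using 1(1,2) unfolding * by (simp add: cR_mem_tiles cL_mem_tiles)
  qed
  show ud: "utile i j \<noteq> dtile i' j'"
  proof
    assume *: "utile i j = dtile i' j'"
    show False using 1(3,4) unfolding * by (simp add: cR_mem_tiles cL_mem_tiles)
  qed
  show "utile i' j' \<noteq> vtile i j" "dtile i' j' \<noteq> vtile i j" "dtile i' j' \<noteq> utile i j"
    using vu vd ud by simp_all
qed

lemma strict_mono_on_int_diff:
  fixes q :: "nat \<Rightarrow> int"
  assumes "strict_mono_on {..<c} q" "k \<le> l" "l < c"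
  shows "int (l - k) \<le> q l - q k"
  using assms(2,3)
proof (induction l rule: dec_induct)
  case base thus ?case by simp
next
  case (step l)
  have "q l < q (Suc l)" using assms(1) step by (auto simp: strict_mono_on_def)
  thus ?case using step by (auto simp: Suc_diff_le)
qed

text \<open>The first value is at least \<open>z\<close>, the last at most \<open>z + c - 1\<close>,
  and each step gains at least 1, which leaves no slack.\<close>

lemma strict_mono_on_range_interval:
  fixes q :: "nat \<Rightarrow> int"
  assumes "strict_mono_on {..<c} q" "q ` {..<c} = {z..<z + int c}" "k < c"
  shows "q k = z + int k"
proof -
  have "q 0 \<in> {z..<z + int c}" "q (c - 1) \<in> {z..<z + int c}" using assms(2,3) by (metis imageI lessThan_iff diff_less gr_implies_not0 less_one neq0_conv)+
  moreover have "int k \<le> q k - q 0" using strict_mono_on_int_diff[OF assms(1), of 0 k] assms(3) by simp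
  moreover have "int (c - 1 - k) \<le> q (c - 1) - q k" using strict_mono_on_int_diff[OF assms(1), of k "c - 1"] assms(3) by simp
  ultimately show ?thesis using assms(3) by (auto simp: of_nat_diff)
qed

lemma strict_mono_on_cong:
  "(\<And>x. x \<in> A \<Longrightarrow> f x = g x) \<Longrightarrow> strict_mono_on A f \<longleftrightarrow> strict_mono_on A g"
  by (auto simp: strict_mono_on_def)

text \<open>Path k moves down from column i to column i + 1 exactly if k belongs to S i.\<close>

primrec path_pos :: "(nat \<Rightarrow> int) \<Rightarrow> (nat \<Rightarrow> nat set) \<Rightarrow> nat \<Rightarrow> nat \<Rightarrow> int" where
  "path_pos q S 0 k = q k"
| "path_pos q S (Suc i) k = path_pos q S i k - (if k \<in> S i then 1 else 0)"

lemma path_pos_cong: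
  assumes "q k = q' k" "\<And>i'. i' < i \<Longrightarrow> k \<in> S i' \<longleftrightarrow> k \<in> S' i'"
  shows "path_pos q S i k = path_pos q' S' i k"
  using assms by (induction i) auto

lemma path_pos_add: "path_pos q S (m + i) k = path_pos (path_pos q S m) (\<lambda>i. S (m + i)) i k"
  by (induction i) auto

lemma path_pos_bounds: "i \<le> i' \<Longrightarrow> path_pos q S i' k \<le> path_pos q S i k \<and> path_pos q S i k - int (i' - i) \<le> path_pos q S i' k"
  by (induction i' rule: dec_induct) (auto simp: Suc_diff_le)

text \<open>Strict monotonicity in the path index at every time is nonintersection. A family is
  recorded by the sets of paths that step down; requiring subsets of \<open>{..<c}\<close> makes the
  record unique, so that counting lists counts families.\<close>

definition families :: "nat \<Rightarrow> nat \<Rightarrow> (nat \<Rightarrow> int) \<Rightarrow> (nat \<Rightarrow> int) \<Rightarrow> nat set list set" where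
  "families c n q e = {Ss. length Ss = n \<and> set Ss \<subseteq> Pow {..<c} \<and>
      (\<forall>i\<le>n. strict_mono_on {..<c} (path_pos q ((!) Ss) i)) \<and> (\<forall>k<c. path_pos q ((!) Ss) n k = e k)}"

section \<open>The bijection between tilings and nonintersecting families\<close>

context hex
begin

text \<open>Path \<open>k\<close> starts at the \<open>k\<close>-th segment of the left side and
  crosses horizontal rhombi. Testing for a \<open>dtile\<close> is enough: otherwise the triangle to
  the right of a particle belongs to a \<open>utile\<close>, along which the second coordinate is
  constant.\<close>

primrec tile_pos :: "complex set set \<Rightarrow> nat \<Rightarrow> nat \<Rightarrow> int" where
  "tile_pos T 0 k = int k"
| "tile_pos T (Suc i) k = tile_pos T i k - (if dtile (int i) (tile_pos T i k) \<in> T then 1 else 0)"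

definition path_family :: "complex set set \<Rightarrow> nat set list" where
  "path_family T = map (\<lambda>i. {k. k < c \<and> dtile (int i) (tile_pos T i k) \<in> T}) [0..<a + b]"

text \<open>The inverse construction. Sites that no path visits receive vertical rhombi, which fit
  only strictly between the two vertical sides; this is the range of \<open>i\<close> in the first
  set.\<close>

definition families_tiling :: "nat set list \<Rightarrow> complex set set" where
  "families_tiling Ss =
     {vtile (int i) j | i j. 0 < i \<and> i < a + b \<and> seg (int i) j \<and> j \<notin> path_pos int ((!) Ss) i ` {..<c}} \<union>
     {utile (int i) (path_pos int ((!) Ss) i k) | i k. i < a + b \<and> k < c \<and> k \<notin> Ss ! i} \<union>
     {dtile (int i) (path_pos int ((!) Ss) i k) | i k. i < a + b \<and> k < c \<and> k \<in> Ss ! i}"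

abbreviation "endpos \<equiv> (\<lambda>k. int k - int b)"
abbreviation "Tilings \<equiv> tilings (real a) (real b) (real c)"

lemma tile_pos_qpos: "i \<le> a + b \<Longrightarrow> k < c \<Longrightarrow> path_pos int ((!) (path_family T)) i k = tile_pos T i k"
  by (induction i) (auto simp: path_family_def)

text \<open>Induction over the columns by the matching conditions at the triangles between two
  columns: each particle leaves through exactly one horizontal rhombus, and each particle of the
  next column is reached through exactly one.\<close>

lemma tiling_paths:
  assumes "T \<in> Tilings" "i \<le> a + b"
  shows "strict_mono_on {..<c} (tile_pos T i) \<and> (\<forall>j. seg (int i) j \<and> vtile (int i) j \<notin> T \<longleftrightarrow> j \<in> tile_pos T i ` {..<c})"
  using assms(2)
proof (induction i)
  note T = assms(1)[unfolded tilings_iff]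
  case 0
  have "vtile 0 j \<notin> T" for j using T unfolding inL_def by fastforce
  moreover have "seg 0 j \<longleftrightarrow> j \<in> tile_pos T 0 ` {..<c}" for j
  proof
    assume "seg 0 j" thus "j \<in> tile_pos T 0 ` {..<c}" unfolding seg_def by (intro image_eqI[of _ _ "nat j"]) auto
  qed (auto simp: seg_def)
  ultimately show ?case by (simp add: strict_mono_on_def)
next
  note T = assms(1)[unfolded tilings_iff]
  case (Suc i)
  hence i: "i < a + b" by simp
  have smono: "strict_mono_on {..<c} (tile_pos T i)" and img: "\<And>j. seg (int i) j \<and> vtile (int i) j \<notin> T \<longleftrightarrow> j \<in> tile_pos T i ` {..<c}"
    using Suc by auto
  have V: "\<And>i j. vtile i j \<in> T \<Longrightarrow> inR i j \<and> inL i j"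
    and U: "\<And>i j. utile i j \<in> T \<Longrightarrow> inR i j \<and> inL (i + 1) j"
    and D: "\<And>i j. dtile i j \<in> T \<Longrightarrow> inR i j \<and> inL (i + 1) (j - 1)"
    and R: "\<And>i j. inR i j \<Longrightarrow> exactly_one (vtile i j \<in> T) (utile i j \<in> T) (dtile i j \<in> T)"
    and L: "\<And>i j. inL i j \<Longrightarrow> exactly_one (vtile i j \<in> T) (utile (i - 1) j \<in> T) (dtile (i - 1) (j + 1) \<in> T)"
    using T by auto
  have Lsuc: "exactly_one (vtile (int i + 1) j \<in> T) (utile (int i) j \<in> T) (dtile (int i) (j + 1) \<in> T)" if "inL (int i + 1) j" for j
    using L[OF that] by simp
  have strict: "strict_mono_on {..<c} (tile_pos T (Suc i))"
  proof (rule strict_mono_onI)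
    fix k l assume kl: "k \<in> {..<c}" "l \<in> {..<c}" "k < l"
    have lt: "tile_pos T i k < tile_pos T i l" using smono kl by (auto simp: strict_mono_on_def)
    show "tile_pos T (Suc i) k < tile_pos T (Suc i) l"
    proof (rule ccontr)
      assume N: "\<not> tile_pos T (Suc i) k < tile_pos T (Suc i) l"
      \<comment> \<open>The order can fail only if the lower path stays at \<open>?p\<close> and the
        upper one comes down from \<open>?p + 1\<close>. A \<open>utile\<close> and a
        \<open>dtile\<close> would then both cover the triangle to the left of the segment above
        \<open>?p\<close> in the next column.\<close>
      let ?p = "tile_pos T i k"
      have **: "tile_pos T i l = ?p + 1" "dtile (int i) (tile_pos T i l) \<in> T" "dtile (int i) ?p \<notin> T"
        using N lt by (auto split: if_splits)
      hence *: "dtile (int i) (?p + 1) \<in> T" "dtile (int i) ?p \<notin> T" by simp_all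
      have "seg (int i) ?p \<and> vtile (int i) ?p \<notin> T" using img[of ?p] kl by blast
      moreover have "inR (int i) ?p" using calculation i unfolding inR_def by simp
      ultimately have "utile (int i) ?p \<in> T" using R[of "int i" ?p] *(2) unfolding exactly_one_def by simp
      thus False using Lsuc[of ?p] U[of "int i" ?p] *(1) unfolding exactly_one_def by simp
    qed
  qed
  have "seg (int i + 1) j \<and> vtile (int i + 1) j \<notin> T \<longleftrightarrow> j \<in> tile_pos T (Suc i) ` {..<c}" for j
  proof
    assume A: "seg (int i + 1) j \<and> vtile (int i + 1) j \<notin> T"
    hence "inL (int i + 1) j" unfolding inL_def by simp
    from Lsuc[OF this] A consider "utile (int i) j \<in> T" | "dtile (int i) (j + 1) \<in> T" unfolding exactly_one_def by auto
    thus "j \<in> tile_pos T (Suc i) ` {..<c}"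
    proof cases
      case 1
      have r: "inR (int i) j" using U[OF 1] by simp
      have "vtile (int i) j \<notin> T" "dtile (int i) j \<notin> T" using R[OF r] 1 unfolding exactly_one_def by auto
      moreover obtain k where "k < c" "j = tile_pos T i k" using img[of j] calculation r unfolding inR_def by auto
      ultimately show ?thesis by (intro image_eqI[of _ _ k]) auto
    next
      case 2
      have r: "inR (int i) (j + 1)" using D[OF 2] by simp
      have "vtile (int i) (j + 1) \<notin> T" using R[OF r] 2 unfolding exactly_one_def by auto
      then obtain k where "k < c" "j + 1 = tile_pos T i k" using img[of "j + 1"] r unfolding inR_def by auto
      thus ?thesis using 2 by (intro image_eqI[of _ _ k]) auto
    qed
  next
    assume "j \<in> tile_pos T (Suc i) ` {..<c}"
    then obtain k where k: "k < c" "j = tile_pos T (Suc i) k" by auto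
    let ?p = "tile_pos T i k"
    have p: "seg (int i) ?p" "vtile (int i) ?p \<notin> T" using img[of ?p] k(1) by blast+
    hence "inR (int i) ?p" using i unfolding inR_def by simp
    note one = R[OF this]
    show "seg (int i + 1) j \<and> vtile (int i + 1) j \<notin> T"
    proof (cases "dtile (int i) ?p \<in> T")
      case True
      hence j: "j = ?p - 1" using k by simp
      have "inL (int i + 1) j" using D[OF True] unfolding j by simp
      thus ?thesis using Lsuc[of j] True unfolding j exactly_one_def inL_def by auto
    next
      case False
      hence j: "j = ?p" using k by simp
      have u: "utile (int i) ?p \<in> T" using one False p unfolding exactly_one_def by auto
      have "inL (int i + 1) j" using U[OF u] unfolding j by simp
      thus ?thesis using Lsuc[of j] u unfolding j exactly_one_def inL_def by auto
    qed
  qed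
  moreover have "int (Suc i) = int i + 1" by simp
  ultimately show ?case using strict by (simp only: simp_thms)
qed

text \<open>The last column has no triangles on its right, hence no vertical rhombi, so the
  \<open>c\<close> paths fill the \<open>c\<close> segments of the right side in order. These begin
  at second coordinate \<open>- int b\<close>.\<close>

lemma path_family_mem:
  assumes "T \<in> Tilings"
  shows "path_family T \<in> families c (a + b) int endpos"
proof -
  have len: "length (path_family T) = a + b" by (simp add: path_family_def)
  have "set (path_family T) \<subseteq> Pow {..<c}" by (auto simp: path_family_def)
  moreover have "strict_mono_on {..<c} (path_pos int ((!) (path_family T)) i)" if "i \<le> a + b" for i
    using tiling_paths[OF assms that] strict_mono_on_cong[of "{..<c}" "path_pos int ((!) (path_family T)) i" "tile_pos T i"]
      tile_pos_qpos[OF that] by auto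
  moreover have "path_pos int ((!) (path_family T)) (a + b) k = endpos k" if "k < c" for k
  proof -
    have "vtile (int (a + b)) j \<notin> T" for j
      using assms unfolding tilings_iff inR_def by fastforce
    hence "j \<in> tile_pos T (a + b) ` {..<c} \<longleftrightarrow> seg (int (a + b)) j" for j
      using tiling_paths[OF assms, of "a + b"] by auto
    hence "tile_pos T (a + b) ` {..<c} = {- int b..<- int b + int c}"
      by (intro Set.set_eqI) (auto simp only: seg_def atLeastLessThan_iff of_nat_add)
    hence "tile_pos T (a + b) k = - int b + int k"
      using tiling_paths[OF assms, of "a + b"] that by (intro strict_mono_on_range_interval) auto
    thus ?thesis using tile_pos_qpos[of "a + b" k T] that by simp
  qed
  ultimately show ?thesis using len by (simp add: families_def)
qed

text \<open>A path loses at most 1 per step and never gains. Applied from its start and back from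
  its end, this gives precisely the inequalities of the hexagon.\<close>

lemma families_seg:
  assumes "Ss \<in> families c (a + b) int endpos" "i \<le> a + b" "k < c"
  shows "seg (int i) (path_pos int ((!) Ss) i k)"
proof -
  have "path_pos int ((!) Ss) (a + b) k = int k - int b" using assms by (simp add: families_def)
  thus ?thesis
    using path_pos_bounds[of 0 i int "(!) Ss" k] path_pos_bounds[of i "a + b" int "(!) Ss" k] assms(2,3)
    unfolding seg_def by (auto simp: of_nat_diff)
qed

lemma families_tiling_mem:
  shows "vtile i j \<in> families_tiling Ss \<longleftrightarrow> 0 < i \<and> i < int a + int b \<and> seg i j \<and> j \<notin> path_pos int ((!) Ss) (nat i) ` {..<c}"
    and "utile i j \<in> families_tiling Ss \<longleftrightarrow> 0 \<le> i \<and> i < int a + int b \<and> (\<exists>k<c. j = path_pos int ((!) Ss) (nat i) k \<and> k \<notin> Ss ! nat i)"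
    and "dtile i j \<in> families_tiling Ss \<longleftrightarrow> 0 \<le> i \<and> i < int a + int b \<and> (\<exists>k<c. j = path_pos int ((!) Ss) (nat i) k \<and> k \<in> Ss ! nat i)"
proof -
  have ex: "(\<exists>i'. P i' \<and> i = int i') \<longleftrightarrow> 0 \<le> i \<and> P (nat i)" for P by (metis int_nat_eq nat_int of_nat_0_le_iff)
  have less: "0 \<le> i \<Longrightarrow> nat i < a + b \<longleftrightarrow> i < int a + int b" by linarith
  have "vtile i j \<in> families_tiling Ss \<longleftrightarrow>
     (\<exists>i'. (0 < i' \<and> i' < a + b \<and> seg (int i') j \<and> j \<notin> path_pos int ((!) Ss) i' ` {..<c}) \<and> i = int i')"
    unfolding families_tiling_def by auto
  thus "vtile i j \<in> families_tiling Ss \<longleftrightarrow> 0 < i \<and> i < int a + int b \<and> seg i j \<and> j \<notin> path_pos int ((!) Ss) (nat i) ` {..<c}"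
    unfolding ex using less by auto
  have "utile i j \<in> families_tiling Ss \<longleftrightarrow>
     (\<exists>i'. (i' < a + b \<and> (\<exists>k<c. j = path_pos int ((!) Ss) i' k \<and> k \<notin> Ss ! i')) \<and> i = int i')"
    unfolding families_tiling_def by auto
  thus "utile i j \<in> families_tiling Ss \<longleftrightarrow> 0 \<le> i \<and> i < int a + int b \<and> (\<exists>k<c. j = path_pos int ((!) Ss) (nat i) k \<and> k \<notin> Ss ! nat i)"
    unfolding ex using less by auto
  have "dtile i j \<in> families_tiling Ss \<longleftrightarrow>
     (\<exists>i'. (i' < a + b \<and> (\<exists>k<c. j = path_pos int ((!) Ss) i' k \<and> k \<in> Ss ! i')) \<and> i = int i')"
    unfolding families_tiling_def by auto
  thus "dtile i j \<in> families_tiling Ss \<longleftrightarrow> 0 \<le> i \<and> i < int a + int b \<and> (\<exists>k<c. j = path_pos int ((!) Ss) (nat i) k \<and> k \<in> Ss ! nat i)"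
    unfolding ex using less by auto
qed

lemma families_end_columns:
  assumes "Ss \<in> families c (a + b) int endpos" "i = 0 \<or> i = a + b" "seg (int i) j"
  shows "j \<in> path_pos int ((!) Ss) i ` {..<c}"
  using assms(2)
proof
  assume "i = 0"
  thus ?thesis using assms(3) unfolding seg_def by (intro image_eqI[of _ _ "nat j"]) auto
next
  assume i: "i = a + b"
  have "path_pos int ((!) Ss) (a + b) k = int k - int b" if "k < c" for k using assms(1) that by (simp add: families_def)
  thus ?thesis using assms(3) i unfolding seg_def by (intro image_eqI[of _ _ "nat (j + int b)"]) auto
qed

text \<open>The tile on a right triangle is decided by the next step of the path at the site, the
  tile on a left triangle by the step through which the path arrived; an unvisited site has its
  vertical rhombus on both sides. Uniqueness comes from injectivity of the strictly increasing
  positions.\<close>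

lemma families_tiling_in_tilings:
  assumes F: "Ss \<in> families c (a + b) int endpos"
  shows "families_tiling Ss \<in> Tilings"
proof -
  let ?q = "path_pos int ((!) Ss)"
  have inj: "k = l" if "?q i k = ?q i l" "i \<le> a + b" "k < c" "l < c" for i k l
  proof -
    have "strict_mono_on {..<c} (?q i)" using F that(2) by (simp add: families_def)
    thus ?thesis using that strict_mono_on_imp_inj_on[of "{..<c}" "?q i"] by (auto dest: inj_onD)
  qed
  note mem = families_tiling_mem[of _ _ Ss]
  have seg: "seg (int i) (?q i k)" if "i \<le> a + b" "k < c" for i k using families_seg[OF F that] .
  have sucD: "?q (nat i + 1) k = (if k \<in> Ss ! nat i then ?q (nat i) k - 1 else ?q (nat i) k)" for i k by simp
  have ii: "int (nat i + 1) = i + 1" if "0 \<le> i" for i using that by simp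
  have segs: "seg i (?q (nat i) k)" "seg (i + 1) (?q (nat i + 1) k)" if "0 \<le> i" "i < int a + int b" "k < c" for i k
  proof -
    have "nat i + 1 \<le> a + b" using that by linarith
    from seg[OF this that(3)] show "seg (i + 1) (?q (nat i + 1) k)" unfolding ii[OF that(1)] .
    show "seg i (?q (nat i) k)" using seg[of "nat i" k] that by simp
  qed
  have R: "exactly_one (vtile i j \<in> families_tiling Ss) (utile i j \<in> families_tiling Ss) (dtile i j \<in> families_tiling Ss)" if r: "inR i j" for i j
  proof -
    have i: "0 \<le> i" "i < int a + int b" "seg i j" using r by (auto simp: inR_def seg_def)
    hence ni: "nat i \<le> a + b" by linarith
    show ?thesis
    proof (cases "j \<in> ?q (nat i) ` {..<c}")
      case True
      then obtain k where k: "k < c" "j = ?q (nat i) k" by auto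
      have "(\<exists>l<c. j = ?q (nat i) l \<and> P l) \<longleftrightarrow> P k" for P using inj[of "nat i" k] k ni by metis
      thus ?thesis using True i unfolding exactly_one_def mem by auto
    next
      case False
      have "i \<noteq> 0" using False families_end_columns[OF F, of 0 j] i by auto
      moreover have "\<not> (\<exists>k<c. j = ?q (nat i) k \<and> P k)" for P using False by auto
      ultimately show ?thesis using False i unfolding exactly_one_def mem by auto
    qed
  qed
  have L: "exactly_one (vtile i j \<in> families_tiling Ss) (utile (i - 1) j \<in> families_tiling Ss) (dtile (i - 1) (j + 1) \<in> families_tiling Ss)"
    if r: "inL i j" for i j
  proof -
    have i: "0 < i" "i \<le> int a + int b" "seg i j" using r by (auto simp: inL_def seg_def)
    hence ni: "nat i \<le> a + b" "nat i = nat (i - 1) + 1" by linarith+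
    show ?thesis
    proof (cases "j \<in> ?q (nat i) ` {..<c}")
      case True
      then obtain k where k: "k < c" "j = ?q (nat i) k" by auto
      have un: "l = k" if "l < c" "j = ?q (nat i) l" for l using inj[of "nat i" l k] k ni(1) that by metis
      have "(\<exists>l<c. j = ?q (nat (i - 1)) l \<and> l \<notin> Ss ! nat (i - 1)) \<longleftrightarrow> k \<notin> Ss ! nat (i - 1)"
        using un k unfolding ni(2) sucD by (metis (full_types))
      moreover have "(\<exists>l<c. j + 1 = ?q (nat (i - 1)) l \<and> l \<in> Ss ! nat (i - 1)) \<longleftrightarrow> k \<in> Ss ! nat (i - 1)"
        using un k unfolding ni(2) sucD by (metis (full_types) add_diff_cancel_right' diff_add_cancel)
      ultimately show ?thesis using True i unfolding exactly_one_def mem by auto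
    next
      case False
      have "i \<noteq> int a + int b"
      proof
        assume "i = int a + int b"
        hence "nat i = a + b" by linarith
        moreover have "int (nat i) = i" using i by simp
        ultimately show False using families_end_columns[OF F, of "nat i" j] False i by metis
      qed
      moreover have "\<not> (\<exists>l<c. j = ?q (nat (i - 1)) l \<and> l \<notin> Ss ! nat (i - 1))"
      proof
        assume "\<exists>l<c. j = ?q (nat (i - 1)) l \<and> l \<notin> Ss ! nat (i - 1)"
        then obtain l where "l < c" "j = ?q (nat (i - 1)) l" "l \<notin> Ss ! nat (i - 1)" by blast
        hence "j = ?q (nat i) l" unfolding ni(2) by simp
        thus False using False \<open>l < c\<close> by blast
      qed
      moreover have "\<not> (\<exists>l<c. j + 1 = ?q (nat (i - 1)) l \<and> l \<in> Ss ! nat (i - 1))"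
      proof
        assume "\<exists>l<c. j + 1 = ?q (nat (i - 1)) l \<and> l \<in> Ss ! nat (i - 1)"
        then obtain l where "l < c" "j + 1 = ?q (nat (i - 1)) l" "l \<in> Ss ! nat (i - 1)" by blast
        hence "j = ?q (nat i) l" unfolding ni(2) by simp
        thus False using False \<open>l < c\<close> by blast
      qed
      ultimately show ?thesis using False i unfolding exactly_one_def mem by auto
    qed
  qed
  have V: "inR i j \<and> inL i j" if "vtile i j \<in> families_tiling Ss" for i j
    using that unfolding mem inR_def inL_def by auto
  have U: "inR i j \<and> inL (i + 1) j" if u: "utile i j \<in> families_tiling Ss" for i j
  proof -
    obtain k where k: "0 \<le> i" "i < int a + int b" "k < c" "j = ?q (nat i) k" "k \<notin> Ss ! nat i" using u unfolding mem by blast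
    thus ?thesis using segs[OF k(1,2,3)] unfolding inR_def inL_def by simp
  qed
  have D: "inR i j \<and> inL (i + 1) (j - 1)" if u: "dtile i j \<in> families_tiling Ss" for i j
  proof -
    obtain k where k: "0 \<le> i" "i < int a + int b" "k < c" "j = ?q (nat i) k" "k \<in> Ss ! nat i" using u unfolding mem by blast
    thus ?thesis using segs[OF k(1,2,3)] unfolding inR_def inL_def by simp
  qed
  have sub: "families_tiling Ss \<subseteq> tiles" unfolding families_tiling_def tiles_def by blast
  show ?thesis unfolding tilings_iff
    by (intro conjI allI impI; (rule sub | erule R | erule L | erule V[THEN conjunct1] | erule V[THEN conjunct2] | erule U[THEN conjunct1] | erule U[THEN conjunct2] | erule D[THEN conjunct1] | erule D[THEN conjunct2]))
qed

lemma path_family_fam_tiling: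
  assumes F: "Ss \<in> families c (a + b) int endpos"
  shows "path_family (families_tiling Ss) = Ss"
proof -
  let ?q = "path_pos int ((!) Ss)"
  have sub: "Ss ! i \<subseteq> {..<c}" if "i < a + b" for i
  proof -
    have "Ss ! i \<in> set Ss" using F that by (simp add: families_def)
    thus ?thesis using F by (auto simp: families_def)
  qed
  have mem: "dtile (int i) (?q i k) \<in> families_tiling Ss \<longleftrightarrow> k \<in> Ss ! i" if "i < a + b" "k < c" for i k
  proof -
    have "strict_mono_on {..<c} (?q i)" using F that by (simp add: families_def)
    hence "inj_on (?q i) {..<c}" by (rule strict_mono_on_imp_inj_on)
    hence "(\<exists>l<c. ?q i k = ?q i l \<and> l \<in> Ss ! i) \<longleftrightarrow> k \<in> Ss ! i" using that by (auto dest: inj_onD)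
    thus ?thesis using that unfolding families_tiling_mem by simp
  qed
  have q: "tile_pos (families_tiling Ss) i k = ?q i k" if "i \<le> a + b" "k < c" for i k
    using that by (induction i) (auto simp: mem)
  show ?thesis
  proof (rule nth_equalityI)
    show "length (path_family (families_tiling Ss)) = length Ss" using F by (simp add: path_family_def families_def)
    fix i assume "i < length (path_family (families_tiling Ss))"
    hence i: "i < a + b" by (simp add: path_family_def)
    have "path_family (families_tiling Ss) ! i = {k. k < c \<and> dtile (int i) (tile_pos (families_tiling Ss) i k) \<in> families_tiling Ss}"
      using i by (simp add: path_family_def)
    also have "\<dots> = {k. k < c \<and> k \<in> Ss ! i}" using i q[of i] mem[OF i] by auto
    also have "\<dots> = Ss ! i" using sub[OF i] by auto
    finally show "path_family (families_tiling Ss) ! i = Ss ! i" .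
  qed
qed

lemma families_tiling_path_family:
  assumes T: "T \<in> Tilings"
  shows "families_tiling (path_family T) = T"
proof -
  note TT = T[unfolded tilings_iff]
  let ?q = "path_pos int ((!) (path_family T))"
  have img: "seg (int i) j \<and> vtile (int i) j \<notin> T \<longleftrightarrow> j \<in> ?q i ` {..<c}" if "i \<le> a + b" for i j
  proof -
    have "?q i ` {..<c} = tile_pos T i ` {..<c}" using tile_pos_qpos[OF that] by (auto intro!: image_cong)
    thus ?thesis using tiling_paths[OF T that] by simp
  qed
  have pf: "k \<in> path_family T ! i \<longleftrightarrow> dtile (int i) (?q i k) \<in> T" if "i < a + b" "k < c" for i k
    using that tile_pos_qpos[of i k T] by (simp add: path_family_def)
  have v: "vtile i j \<in> families_tiling (path_family T) \<longleftrightarrow> vtile i j \<in> T" for i j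
  proof
    assume "vtile i j \<in> families_tiling (path_family T)"
    hence *: "0 < i" "i < int a + int b" "seg i j" "j \<notin> ?q (nat i) ` {..<c}" unfolding families_tiling_mem by auto
    thus "vtile i j \<in> T" using img[of "nat i" j] by auto
  next
    assume A: "vtile i j \<in> T"
    hence *: "0 < i" "i < int a + int b" "seg i j" using TT by (auto simp: inR_def inL_def)
    thus "vtile i j \<in> families_tiling (path_family T)" using img[of "nat i" j] A unfolding families_tiling_mem by auto
  qed
  have one: "exactly_one (vtile i j \<in> T) (utile i j \<in> T) (dtile i j \<in> T)" if "inR i j" for i j using TT that by blast
  have ud: "(utile i j \<in> families_tiling (path_family T) \<longleftrightarrow> utile i j \<in> T) \<and> (dtile i j \<in> families_tiling (path_family T) \<longleftrightarrow> dtile i j \<in> T)" for i j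
  proof (cases "inR i j")
    case False
    have "utile i j \<notin> T" "dtile i j \<notin> T" using TT False by blast+
    moreover have "families_tiling (path_family T) \<in> Tilings" by (rule families_tiling_in_tilings[OF path_family_mem[OF T]])
    hence "utile i j \<notin> families_tiling (path_family T)" "dtile i j \<notin> families_tiling (path_family T)"
      unfolding tilings_iff using False by blast+
    ultimately show ?thesis by blast
  next
    case True
    have ft: "families_tiling (path_family T) \<in> Tilings" by (rule families_tiling_in_tilings[OF path_family_mem[OF T]])
    have one': "exactly_one (vtile i j \<in> families_tiling (path_family T)) (utile i j \<in> families_tiling (path_family T)) (dtile i j \<in> families_tiling (path_family T))"
      using ft True unfolding tilings_iff by blast
    have "dtile i j \<in> families_tiling (path_family T) \<longleftrightarrow> dtile i j \<in> T"
    proof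
      assume "dtile i j \<in> families_tiling (path_family T)"
      then obtain k where k: "0 \<le> i" "i < int a + int b" "k < c" "j = ?q (nat i) k" "k \<in> path_family T ! nat i"
        unfolding families_tiling_mem by blast
      have "nat i < a + b" using k by linarith
      from pf[OF this k(3)] k show "dtile i j \<in> T" by simp
    next
      assume A: "dtile i j \<in> T"
      have i: "0 \<le> i" "i < int a + int b" "seg i j" using True by (auto simp: inR_def seg_def)
      hence ni: "nat i < a + b" by linarith
      have "vtile i j \<notin> T" using one[OF True] A unfolding exactly_one_def by blast
      hence "j \<in> ?q (nat i) ` {..<c}" using img[of "nat i" j] i ni by simp
      then obtain k where "k < c" "j = ?q (nat i) k" by auto
      thus "dtile i j \<in> families_tiling (path_family T)" using pf[OF ni] A i unfolding families_tiling_mem by auto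
    qed
    thus ?thesis using one[OF True] one' v[of i j] unfolding exactly_one_def by blast
  qed
  have sub: "families_tiling (path_family T) \<subseteq> tiles" "T \<subseteq> tiles"
    using families_tiling_in_tilings[OF path_family_mem[OF T]] T unfolding tilings_iff by simp_all
  have "\<rho> \<in> families_tiling (path_family T) \<longleftrightarrow> \<rho> \<in> T" if "\<rho> \<in> tiles" for \<rho>
    using that v ud unfolding tiles_def by blast
  thus ?thesis using sub by blast
qed

theorem tilings_bij: "bij_betw path_family Tilings (families c (a + b) int endpos)"
  by (rule bij_betwI[where g = families_tiling])
     (auto simp: path_family_mem families_tiling_in_tilings path_family_fam_tiling families_tiling_path_family)

end

section \<open>Determinants\<close>

definition fdet :: "nat \<Rightarrow> (nat \<Rightarrow> nat \<Rightarrow> real) \<Rightarrow> real" where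
  "fdet n f = Determinant.det (mat n n (\<lambda>(i, j). f i j))"

lemma fdet_def': "fdet n f = (\<Sum>p | p permutes {..<n}. of_int (sign p) * (\<Prod>i<n. f i (p i)))"
proof -
  have "fdet n f = (\<Sum>p | p permutes {0..<n}. of_int (sign p) * (\<Prod>i = 0..<n. mat n n (\<lambda>(i, j). f i j) $$ (i, p i)))"
    unfolding fdet_def by (subst det_def'[of _ n]) auto
  also have "\<dots> = (\<Sum>p | p permutes {0..<n}. of_int (sign p) * (\<Prod>i = 0..<n. f i (p i)))"
    by (intro sum.cong prod.cong arg_cong2[where f = "(*)"] refl) (auto simp: permutes_in_image)
  finally show ?thesis by (simp only: atLeast0LessThan)
qed

lemma fdet_cong: "(\<And>i j. i < n \<Longrightarrow> j < n \<Longrightarrow> f i j = g i j) \<Longrightarrow> fdet n f = fdet n g"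
  unfolding fdet_def by (intro arg_cong[where f = Determinant.det] eq_matI) auto

lemma fdet_transpose: "fdet n (\<lambda>i j. f j i) = fdet n f"
proof -
  have "fdet n f = Determinant.det (transpose_mat (mat n n (\<lambda>(i, j). f i j)))"
    unfolding fdet_def by (rule det_transpose[symmetric]) auto
  also have "transpose_mat (mat n n (\<lambda>(i, j). f i j)) = mat n n (\<lambda>(i, j). f j i)" by (intro eq_matI) auto
  finally show ?thesis by (simp add: fdet_def)
qed

lemma fdet_mult: "fdet n (\<lambda>i j. \<Sum>k<n. A i k * B k j) = fdet n A * fdet n B"
proof -
  have "fdet n A * fdet n B = Determinant.det (mat n n (\<lambda>(i, j). A i j) * mat n n (\<lambda>(i, j). B i j))"
    unfolding fdet_def by (rule det_mult[symmetric]) auto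
  also have "mat n n (\<lambda>(i, j). A i j) * mat n n (\<lambda>(i, j). B i j) = mat n n (\<lambda>(i, j). \<Sum>k<n. A i k * B k j)"
    by (intro eq_matI) (auto simp: scalar_prod_def atLeast0LessThan)
  finally show ?thesis by (simp add: fdet_def)
qed

lemma fdet_scale_rows: "fdet n (\<lambda>i j. v i * f i j) = (\<Prod>i<n. v i) * fdet n f"
  unfolding fdet_def' by (simp add: prod.distrib sum_distrib_left mult_ac)

lemma fdet_scale_cols: "fdet n (\<lambda>i j. v j * f i j) = (\<Prod>i<n. v i) * fdet n f"
  using fdet_scale_rows[of n v "\<lambda>i j. f j i"] fdet_transpose[of n f] fdet_transpose[of n "\<lambda>i j. v j * f i j"] by simp

lemma fdet_zero_row: "k < n \<Longrightarrow> (\<And>j. j < n \<Longrightarrow> f k j = 0) \<Longrightarrow> fdet n f = 0"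
  unfolding fdet_def'
  by (intro sum.neutral) (auto intro!: bexI[of _ k] simp: permutes_in_image dest: permutes_in_image[of _ _ k])

lemma fdet_identical_rows:
  assumes "k < n" "l < n" "k \<noteq> l" "\<And>j. j < n \<Longrightarrow> f k j = f l j"
  shows "fdet n f = 0"
  unfolding fdet_def using assms by (intro det_identical_rows[of _ n k l]) (auto intro!: eq_vecI)

lemma fdet_identical_cols:
  assumes "k < n" "l < n" "k \<noteq> l" "\<And>i. i < n \<Longrightarrow> f i k = f i l"
  shows "fdet n f = 0"
  using fdet_identical_rows[of k n l "\<lambda>i j. f j i"] assms by (simp add: fdet_transpose[of n f])

lemma fdet_permute_rows:
  assumes "p permutes {..<n}"
  shows "fdet n (\<lambda>i j. f (p i) j) = of_int (sign p) * fdet n f"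
proof -
  have "fdet n (\<lambda>i j. f (p i) j) = Determinant.det (mat n n (\<lambda>(i, j). mat n n (\<lambda>(i, j). f i j) $$ (p i, j)))"
    unfolding fdet_def using permutes_in_image[OF assms]
    by (intro arg_cong[where f = Determinant.det] eq_matI) auto
  also have "\<dots> = of_int (sign p) * fdet n f"
    unfolding fdet_def using assms by (intro det_permute_rows) (auto simp: atLeast0LessThan)
  finally show ?thesis .
qed

lemma fdet_id: "fdet n (\<lambda>i j. if i = j then 1 else 0) = 1"
proof -
  have "mat n n (\<lambda>(i, j). if i = j then 1 else 0 :: real) = 1\<^sub>m n" by (intro eq_matI) auto
  thus ?thesis by (simp add: fdet_def)
qed

lemma fdet_add_rows:
  "fdet n (\<lambda>i j. f i j + g i j) = (\<Sum>S\<in>Pow {..<n}. fdet n (\<lambda>i j. if i \<in> S then g i j else f i j))"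
proof -
  have "(\<Prod>i<n. f i (p i) + g i (p i)) = (\<Sum>S\<in>Pow {..<n}. (\<Prod>i<n. if i \<in> S then g i (p i) else f i (p i)))" for p
  proof -
    have "(\<Prod>i<n. f i (p i) + g i (p i)) = (\<Prod>i<n. g i (p i) + f i (p i))" by (simp add: add.commute)
    also have "\<dots> = (\<Sum>S\<in>Pow {..<n}. (\<Prod>i\<in>S. g i (p i)) * (\<Prod>i\<in>{..<n} - S. f i (p i)))"
      by (rule prod_add) simp
    also have "\<dots> = (\<Sum>S\<in>Pow {..<n}. (\<Prod>i<n. if i \<in> S then g i (p i) else f i (p i)))"
    proof (rule sum.cong[OF refl])
      fix S assume "S \<in> Pow {..<n}"
      hence "{..<n} = S \<union> ({..<n} - S)" "finite S" by (auto intro: finite_subset)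
      have "(\<Prod>i<n. if i \<in> S then g i (p i) else f i (p i)) = (\<Prod>i\<in>{..<n} \<inter> S. g i (p i)) * (\<Prod>i\<in>{..<n} \<inter> - S. f i (p i))"
        by (rule prod.If_cases[of "{..<n}" "\<lambda>i. i \<in> S", simplified])
      moreover have "{..<n} \<inter> S = S" "{..<n} \<inter> - S = {..<n} - S" using \<open>S \<in> Pow {..<n}\<close> by auto
      ultimately show "(\<Prod>i\<in>S. g i (p i)) * (\<Prod>i\<in>{..<n} - S. f i (p i)) = (\<Prod>i<n. if i \<in> S then g i (p i) else f i (p i))" by simp
    qed
    finally show ?thesis .
  qed
  hence "fdet n (\<lambda>i j. f i j + g i j) = (\<Sum>p | p permutes {..<n}. \<Sum>S\<in>Pow {..<n}.
      of_int (sign p) * (\<Prod>i<n. if i \<in> S then g i (p i) else f i (p i)))"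
    unfolding fdet_def' by (simp add: sum_distrib_left)
  also have "\<dots> = (\<Sum>S\<in>Pow {..<n}. \<Sum>p | p permutes {..<n}.
      of_int (sign p) * (\<Prod>i<n. if i \<in> S then g i (p i) else f i (p i)))"
    by (rule sum.swap)
  finally show ?thesis unfolding fdet_def' .
qed

lemma fdet_sum_expand:
  assumes "finite Y"
  shows "fdet n (\<lambda>i j. \<Sum>y\<in>Y. F i y * walks j y) =
    (\<Sum>f\<in>{..<n} \<rightarrow>\<^sub>E Y. (\<Prod>i<n. F i (f i)) * fdet n (\<lambda>i j. walks j (f i)))"
proof -
  have "fdet n (\<lambda>i j. \<Sum>y\<in>Y. F i y * walks j y) = (\<Sum>p | p permutes {..<n}. \<Sum>f\<in>{..<n} \<rightarrow>\<^sub>E Y.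
      of_int (sign p) * (\<Prod>i<n. F i (f i) * walks (p i) (f i)))"
    unfolding fdet_def' by (subst prod_sum_PiE) (auto simp: assms sum_distrib_left)
  also have "\<dots> = (\<Sum>f\<in>{..<n} \<rightarrow>\<^sub>E Y. \<Sum>p | p permutes {..<n}.
      of_int (sign p) * (\<Prod>i<n. F i (f i) * walks (p i) (f i)))"
    by (rule sum.swap)
  also have "\<dots> = (\<Sum>f\<in>{..<n} \<rightarrow>\<^sub>E Y. (\<Prod>i<n. F i (f i)) * fdet n (\<lambda>i j. walks j (f i)))"
    unfolding fdet_def' by (simp add: prod.distrib sum_distrib_left mult_ac)
  finally show ?thesis .
qed

definition senum :: "nat set \<Rightarrow> nat \<Rightarrow> nat" where "senum P i = sorted_list_of_set P ! i"

lemma senum_bij: "finite P \<Longrightarrow> bij_betw (senum P) {..<card P} P"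
  unfolding senum_def using bij_betw_nth[of "sorted_list_of_set P" "{..<card P}" P] by simp

lemma senum_strict_mono: "finite P \<Longrightarrow> strict_mono_on {..<card P} (senum P)"
  unfolding senum_def strict_mono_on_def
  using strict_sorted_list_of_set[of P] by (auto simp: sorted_wrt_iff_nth_less)

text \<open>Expansion by rows gives a sum over maps into \<open>Y\<close>. Maps that are not
  injective produce two equal rows. An injective map with image \<open>P\<close> is a permutation
  followed by the increasing enumeration \<open>senum P\<close>, and the sum over the permutations
  rebuilds the determinant of \<open>F\<close>.\<close>

lemma cauchy_binet:
  assumes "finite Y"
  shows "fdet n (\<lambda>i j. \<Sum>y\<in>Y. h y * F i y * walks j y) =
    (\<Sum>P | P \<subseteq> Y \<and> card P = n. (\<Prod>y\<in>P. h y) * fdet n (\<lambda>i j. F i (senum P j)) * fdet n (\<lambda>i j. walks i (senum P j)))"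
proof -
  let ?I = "{f \<in> {..<n} \<rightarrow>\<^sub>E Y. inj_on f {..<n}}"
  let ?S = "{P. P \<subseteq> Y \<and> card P = n}"
  let ?t = "\<lambda>f. (\<Prod>i<n. h (f i) * F i (f i)) * fdet n (\<lambda>i j. walks j (f i))"
  have finS: "finite ?S" using assms by simp
  have finE: "finite ({..<n} \<rightarrow>\<^sub>E Y)" using assms by (intro finite_PiE) auto
  have "fdet n (\<lambda>i j. \<Sum>y\<in>Y. h y * F i y * walks j y) = (\<Sum>f\<in>{..<n} \<rightarrow>\<^sub>E Y. ?t f)"
    by (rule fdet_sum_expand[OF assms])
  also have "\<dots> = (\<Sum>f\<in>?I. ?t f)"
  proof (rule sum.mono_neutral_right[OF finE])
    show "\<forall>f\<in>({..<n} \<rightarrow>\<^sub>E Y) - ?I. ?t f = 0"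
    proof
      fix f assume "f \<in> ({..<n} \<rightarrow>\<^sub>E Y) - ?I"
      then obtain k l where "k < n" "l < n" "k \<noteq> l" "f k = f l" by (auto simp: inj_on_def)
      hence "fdet n (\<lambda>i j. walks j (f i)) = 0" by (intro fdet_identical_rows[of k n l]) auto
      thus "?t f = 0" by simp
    qed
  qed auto
  also have "\<dots> = (\<Sum>P\<in>?S. \<Sum>f | f \<in> ?I \<and> f ` {..<n} = P. ?t f)"
  proof (rule sum.group[symmetric])
    show "finite ?I" using finE by simp
    show "(\<lambda>f. f ` {..<n}) ` ?I \<subseteq> ?S"
    proof (rule image_subsetI)
      fix f assume "f \<in> ?I"
      hence "f ` {..<n} \<subseteq> Y" "inj_on f {..<n}" by (simp_all add: PiE_iff image_subset_iff)
      thus "f ` {..<n} \<in> ?S" by (simp add: card_image)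
    qed
  qed (rule finS)
  also have "\<dots> = (\<Sum>P\<in>?S. (\<Prod>y\<in>P. h y) * fdet n (\<lambda>i j. F i (senum P j)) * fdet n (\<lambda>i j. walks i (senum P j)))"
  proof (rule sum.cong[OF refl])
    fix P assume "P \<in> ?S"
    hence P: "P \<subseteq> Y" "card P = n" "finite P" using assms by (auto intro: finite_subset)
    have bij: "bij_betw (senum P) {..<n} P" using senum_bij[OF P(3)] P(2) by simp
    have "(\<Sum>f | f \<in> ?I \<and> f ` {..<n} = P. ?t f) = (\<Sum>\<tau> | \<tau> permutes {..<n}. ?t (restrict (senum P \<circ> \<tau>) {..<n}))"
    proof (rule sum.reindex_bij_betw[symmetric])
      show "bij_betw (\<lambda>\<tau>. restrict (senum P \<circ> \<tau>) {..<n}) {\<tau>. \<tau> permutes {..<n}} {f. f \<in> ?I \<and> f ` {..<n} = P}"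
      proof (rule bij_betwI[where g = "\<lambda>f i. if i < n then inv_into {..<n} (senum P) (f i) else i"])
        show "(\<lambda>\<tau>. restrict (senum P \<circ> \<tau>) {..<n}) \<in> {\<tau>. \<tau> permutes {..<n}} \<rightarrow> {f. f \<in> ?I \<and> f ` {..<n} = P}"
        proof (rule Pi_I)
          fix \<tau> assume "\<tau> \<in> {\<tau>. \<tau> permutes {..<n}}"
          hence t: "\<tau> permutes {..<n}" by simp
          have b: "bij_betw (senum P \<circ> \<tau>) {..<n} P" using permutes_imp_bij[OF t] bij by (rule bij_betw_trans)
          have "bij_betw (restrict (senum P \<circ> \<tau>) {..<n}) {..<n} P"
            by (subst bij_betw_cong[where g = "senum P \<circ> \<tau>"]) (auto simp: b)
          thus "restrict (senum P \<circ> \<tau>) {..<n} \<in> {f. f \<in> ?I \<and> f ` {..<n} = P}"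
            using P(1) by (auto simp: bij_betw_def)
        qed
        show "(\<lambda>f i. if i < n then inv_into {..<n} (senum P) (f i) else i) \<in> {f. f \<in> ?I \<and> f ` {..<n} = P} \<rightarrow> {\<tau>. \<tau> permutes {..<n}}"
        proof (rule Pi_I)
          fix f assume "f \<in> {f. f \<in> ?I \<and> f ` {..<n} = P}"
          hence "bij_betw f {..<n} P" by (auto simp: bij_betw_def)
          hence "bij_betw (inv_into {..<n} (senum P) \<circ> f) {..<n} {..<n}" using bij_betw_inv_into[OF bij] by (rule bij_betw_trans)
          hence b: "bij_betw (\<lambda>i. if i < n then inv_into {..<n} (senum P) (f i) else i) {..<n} {..<n}"
            by (subst bij_betw_cong[where g = "inv_into {..<n} (senum P) \<circ> f"]) auto
          show "(\<lambda>i. if i < n then inv_into {..<n} (senum P) (f i) else i) \<in> {\<tau>. \<tau> permutes {..<n}}"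
            by (intro CollectI bij_imp_permutes[OF b]) simp
        qed
        show "(\<lambda>i. if i < n then inv_into {..<n} (senum P) (restrict (senum P \<circ> \<tau>) {..<n} i) else i) = \<tau>"
          if "\<tau> \<in> {\<tau>. \<tau> permutes {..<n}}" for \<tau>
        proof
          fix i
          have t: "\<tau> permutes {..<n}" using that by simp
          show "(if i < n then inv_into {..<n} (senum P) (restrict (senum P \<circ> \<tau>) {..<n} i) else i) = \<tau> i"
            using permutes_in_image[OF t, of i] permutes_not_in[OF t, of i] bij_betw_inv_into_left[OF bij, of "\<tau> i"] by auto
        qed
        show "restrict (senum P \<circ> (\<lambda>i. if i < n then inv_into {..<n} (senum P) (f i) else i)) {..<n} = f"
          if "f \<in> {f. f \<in> ?I \<and> f ` {..<n} = P}" for f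
        proof
          fix i
          have "i < n \<Longrightarrow> f i \<in> P" "i \<ge> n \<Longrightarrow> f i = undefined" using that by (auto simp: PiE_def extensional_def)
          thus "restrict (senum P \<circ> (\<lambda>i. if i < n then inv_into {..<n} (senum P) (f i) else i)) {..<n} i = f i"
            using bij_betw_inv_into_right[OF bij, of "f i"] by auto
        qed
      qed
    qed
    also have "\<dots> = (\<Sum>\<tau> | \<tau> permutes {..<n}. (\<Prod>y\<in>P. h y) * fdet n (\<lambda>i j. walks i (senum P j)) *
        (of_int (sign \<tau>) * (\<Prod>i<n. F i (senum P (\<tau> i)))))"
    proof (rule sum.cong[OF refl])
      fix \<tau> assume "\<tau> \<in> {\<tau>. \<tau> permutes {..<n}}"
      hence t: "\<tau> permutes {..<n}" by simp
      let ?f = "restrict (senum P \<circ> \<tau>) {..<n}"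
      have "(\<Prod>i<n. h (?f i) * F i (?f i)) = (\<Prod>i<n. h (senum P (\<tau> i))) * (\<Prod>i<n. F i (senum P (\<tau> i)))"
        by (simp add: prod.distrib)
      also have "(\<Prod>i<n. h (senum P (\<tau> i))) = (\<Prod>y\<in>P. h y)"
        using prod.reindex_bij_betw[OF bij_betw_trans[OF permutes_imp_bij[OF t] bij], of h] by simp
      finally have 1: "(\<Prod>i<n. h (?f i) * F i (?f i)) = (\<Prod>y\<in>P. h y) * (\<Prod>i<n. F i (senum P (\<tau> i)))" .
      have "fdet n (\<lambda>i j. walks j (?f i)) = fdet n (\<lambda>i j. walks j (senum P (\<tau> i)))" by (rule fdet_cong) simp
      also have "\<dots> = of_int (sign \<tau>) * fdet n (\<lambda>i j. walks j (senum P i))"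
        by (rule fdet_permute_rows[OF t, of "\<lambda>i j. walks j (senum P i)"])
      also have "fdet n (\<lambda>i j. walks j (senum P i)) = fdet n (\<lambda>i j. walks i (senum P j))"
        by (rule fdet_transpose[of n "\<lambda>i j. walks i (senum P j)"])
      finally have 2: "fdet n (\<lambda>i j. walks j (?f i)) = of_int (sign \<tau>) * fdet n (\<lambda>i j. walks i (senum P j))" .
      show "?t ?f = (\<Prod>y\<in>P. h y) * fdet n (\<lambda>i j. walks i (senum P j)) *
        (of_int (sign \<tau>) * (\<Prod>i<n. F i (senum P (\<tau> i))))" unfolding 1 2 by (simp only: mult_ac)
    qed
    also have "\<dots> = (\<Prod>y\<in>P. h y) * fdet n (\<lambda>i j. F i (senum P j)) * fdet n (\<lambda>i j. walks i (senum P j))"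
      by (simp add: fdet_def'[of n "\<lambda>i j. F i (senum P j)"] sum_distrib_left[symmetric])
    finally show "(\<Sum>f | f \<in> ?I \<and> f ` {..<n} = P. ?t f) =
      (\<Prod>y\<in>P. h y) * fdet n (\<lambda>i j. F i (senum P j)) * fdet n (\<lambda>i j. walks i (senum P j))" .
  qed
  finally show ?thesis .
qed

text \<open>The block matrices \<open>X\<close> with rows (1, A), (-B, 1) and \<open>Z\<close> with
  rows (1, 0), (B, 1) have block triangular products in both orders, and the determinants of these
  products are the two sides.\<close>

lemma sylvester_det:
  "fdet n (\<lambda>i j. (if i = j then 1 else 0) + (\<Sum>k<m. A i k * B k j)) =
   fdet m (\<lambda>i j. (if i = j then 1 else 0) + (\<Sum>k<n. B i k * A k j))"
proof -
  define MA where "MA = mat n m (\<lambda>(i, j). A i j)"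
  define MB where "MB = mat m n (\<lambda>(i, j). B i j)"
  have c: "MA \<in> carrier_mat n m" "MB \<in> carrier_mat m n" by (auto simp: MA_def MB_def)
  define X where "X = four_block_mat (1\<^sub>m n) MA (- MB) (1\<^sub>m m)"
  define Z where "Z = four_block_mat (1\<^sub>m n) (0\<^sub>m n m) MB (1\<^sub>m m)"
  have XZ: "X \<in> carrier_mat (n + m) (n + m)" "Z \<in> carrier_mat (n + m) (n + m)"
    unfolding X_def Z_def by auto
  have dZ: "Determinant.det Z = 1"
    unfolding Z_def using c by (subst det_four_block_mat_upper_right_zero[of _ n _ m]) auto
  have "X * Z = four_block_mat (1\<^sub>m n + MA * MB) MA (0\<^sub>m m n) (1\<^sub>m m)"
    unfolding X_def Z_def using c
    by (subst mult_four_block_mat[of _ n n _ m _ m _ _ n _ m]) (auto simp: uminus_l_inv_mat)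
  hence 1: "Determinant.det (X * Z) = Determinant.det (1\<^sub>m n + MA * MB)"
    using c by (subst (asm) eq_commute, simp) (subst det_four_block_mat_lower_left_zero[of _ n _ m], auto)
  have "Z * X = four_block_mat (1\<^sub>m n) MA (0\<^sub>m m n) (1\<^sub>m m + MB * MA)"
    unfolding X_def Z_def using c
    by (subst mult_four_block_mat[of _ n n _ m _ m _ _ n _ m]) (auto simp: comm_add_mat[of _ m m])
  hence 2: "Determinant.det (Z * X) = Determinant.det (1\<^sub>m m + MB * MA)"
    using c by (simp, subst det_four_block_mat_lower_left_zero[of _ n _ m], auto)
  have "Determinant.det (X * Z) = Determinant.det (Z * X)"
    using XZ by (simp add: det_mult)
  hence "Determinant.det (1\<^sub>m n + MA * MB) = Determinant.det (1\<^sub>m m + MB * MA)" using 1 2 by simp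
  moreover have "1\<^sub>m n + MA * MB = mat n n (\<lambda>(i, j). (if i = j then 1 else 0) + (\<Sum>k<m. A i k * B k j))"
    by (intro eq_matI) (auto simp: MA_def MB_def scalar_prod_def atLeast0LessThan)
  moreover have "1\<^sub>m m + MB * MA = mat m m (\<lambda>(i, j). (if i = j then 1 else 0) + (\<Sum>k<n. B i k * A k j))"
    by (intro eq_matI) (auto simp: MA_def MB_def scalar_prod_def atLeast0LessThan)
  ultimately show ?thesis by (simp add: fdet_def)
qed

section \<open>Counting paths\<close>

lemma finite_fam: "finite (families c n q e)"
  by (rule finite_subset[OF _ finite_lists_length_eq[of "Pow {..<c}" n]]) (auto simp: families_def)

lemma families_0: "families c 0 q e = (if strict_mono_on {..<c} q \<and> (\<forall>k<c. q k = e k) then {[]} else {})"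
proof -
  have "path_pos q S 0 = q" for S by (rule ext) simp
  thus ?thesis by (auto simp: families_def)
qed

lemma path_pos_Cons: "path_pos q ((!) (S # Ss)) (Suc i) k = path_pos (\<lambda>k. q k - (if k \<in> S then 1 else 0)) ((!) Ss) i k"
  by (induction i) auto

lemma families_Cons:
  "S # Ss \<in> families c (Suc n) q e \<longleftrightarrow> S \<subseteq> {..<c} \<and> strict_mono_on {..<c} q \<and>
     Ss \<in> families c n (\<lambda>k. q k - (if k \<in> S then 1 else 0)) e"
proof -
  let ?q = "\<lambda>k. q k - (if k \<in> S then 1 else 0)"
  have 0: "path_pos q ((!) (S # Ss)) 0 = q" by (rule ext) simp
  have 1: "path_pos q ((!) (S # Ss)) (Suc i) = path_pos ?q ((!) Ss) i" for i by (rule ext) (rule path_pos_Cons)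
  have all: "(\<forall>i\<le>Suc n. P i) \<longleftrightarrow> P 0 \<and> (\<forall>i\<le>n. P (Suc i))" for P
    by (metis Suc_le_mono le0 not0_implies_Suc)
  show ?thesis unfolding families_def mem_Collect_eq all 0 1 by auto
qed

lemma card_fam_Suc:
  assumes "strict_mono_on {..<c} q"
  shows "card (families c (Suc n) q e) = (\<Sum>S\<in>Pow {..<c}. card (families c n (\<lambda>k. q k - (if k \<in> S then 1 else 0)) e))"
proof -
  have "families c (Suc n) q e = (\<Union>S\<in>Pow {..<c}. (#) S ` families c n (\<lambda>k. q k - (if k \<in> S then 1 else 0)) e)" (is "?A = ?B")
  proof (rule Set.set_eqI)
    fix Ss show "Ss \<in> ?A \<longleftrightarrow> Ss \<in> ?B"
    proof (cases Ss)
      case Nil thus ?thesis by (auto simp: families_def)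
    next
      case (Cons S Ss') thus ?thesis using assms by (auto simp: families_Cons)
    qed
  qed
  also have "card \<dots> = (\<Sum>S\<in>Pow {..<c}. card ((#) S ` families c n (\<lambda>k. q k - (if k \<in> S then 1 else 0)) e))"
    by (rule card_UN_disjoint) (auto simp: finite_fam)
  also have "\<dots> = (\<Sum>S\<in>Pow {..<c}. card (families c n (\<lambda>k. q k - (if k \<in> S then 1 else 0)) e))"
    by (intro sum.cong refl card_image) (auto intro: inj_onI)
  finally show ?thesis .
qed

lemma path_pos_append: "i \<le> length Xs \<Longrightarrow> path_pos q ((!) (Xs @ Ys)) i k = path_pos q ((!) Xs) i k"
  by (rule path_pos_cong) (auto simp: nth_append)

lemma families_append:
  assumes "length Xs = m"
  shows "Xs @ Ys \<in> families c (m + n) q e \<and> (\<forall>k<c. path_pos q ((!) (Xs @ Ys)) m k = q' k) \<longleftrightarrow>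
    Xs \<in> families c m q q' \<and> Ys \<in> families c n q' e"
proof -
  have A: "path_pos q ((!) (Xs @ Ys)) i = path_pos q ((!) Xs) i" if "i \<le> m" for i
    using path_pos_append[of i Xs] assms that by (intro ext) auto
  have B: "path_pos q ((!) (Xs @ Ys)) (m + i) k = path_pos q' ((!) Ys) i k" if "path_pos q ((!) Xs) m k = q' k" for i k
    unfolding path_pos_add using that assms path_pos_append[of m Xs] by (intro path_pos_cong) (auto simp: nth_append)
  have all: "(\<forall>i\<le>m + n. P i) \<longleftrightarrow> (\<forall>i\<le>m. P i) \<and> (\<forall>i\<le>n. P (m + i))" for P
    by (metis add_le_cancel_left le_add_diff_inverse nat_le_linear trans_le_add1)
  show ?thesis
  proof (cases "\<forall>k<c. path_pos q ((!) Xs) m k = q' k")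
    case True
    have "strict_mono_on {..<c} (path_pos q ((!) (Xs @ Ys)) (m + i)) \<longleftrightarrow> strict_mono_on {..<c} (path_pos q' ((!) Ys) i)" for i
      by (rule strict_mono_on_cong) (use B True in auto)
    thus ?thesis unfolding families_def mem_Collect_eq all using True A B assms by auto
  next
    case False
    thus ?thesis unfolding families_def using A by auto
  qed
qed

text \<open>Once the positions at time \<open>m\<close> are fixed, the steps before and after it are
  independent choices. This factors the number of tilings with given particles into a left and a
  right count.\<close>

lemma card_fam_split:
  "card {Ss \<in> families c (m + n) q e. \<forall>k<c. path_pos q ((!) Ss) m k = q' k} = card (families c m q q') * card (families c n q' e)"
proof -
  have "bij_betw (\<lambda>(Xs, Ys). Xs @ Ys) (families c m q q' \<times> families c n q' e) {Ss \<in> families c (m + n) q e. \<forall>k<c. path_pos q ((!) Ss) m k = q' k}"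
  proof (rule bij_betwI[where g = "\<lambda>Ss. (take m Ss, drop m Ss)"])
    have len: "Xs \<in> families c m q q' \<Longrightarrow> length Xs = m" for Xs m q q' by (simp add: families_def)
    show "(\<lambda>(Xs, Ys). Xs @ Ys) \<in> families c m q q' \<times> families c n q' e \<rightarrow> {Ss \<in> families c (m + n) q e. \<forall>k<c. path_pos q ((!) Ss) m k = q' k}"
    proof (rule Pi_I, clarify)
      fix Xs Ys assume "Xs \<in> families c m q q'" "Ys \<in> families c n q' e"
      thus "Xs @ Ys \<in> families c (m + n) q e \<and> (\<forall>k<c. path_pos q ((!) (Xs @ Ys)) m k = q' k)"
        using families_append[OF len, of Xs m q q' Ys c n q e q'] by blast
    qed
    show "(\<lambda>Ss. (take m Ss, drop m Ss)) \<in> {Ss \<in> families c (m + n) q e. \<forall>k<c. path_pos q ((!) Ss) m k = q' k} \<rightarrow> families c m q q' \<times> families c n q' e"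
    proof (rule Pi_I)
      fix Ss assume S: "Ss \<in> {Ss \<in> families c (m + n) q e. \<forall>k<c. path_pos q ((!) Ss) m k = q' k}"
      have l: "length (take m Ss) = m" using S len[of Ss "m + n"] by auto
      show "(take m Ss, drop m Ss) \<in> families c m q q' \<times> families c n q' e"
        using families_append[OF l, of "drop m Ss" c n q e q'] S by auto
    qed
  qed (auto simp: families_def)
  from bij_betw_same_card[OF this] show ?thesis by (simp add: card_cartesian_product)
qed

text \<open>To the left of the line the start is fixed and the end varies, so that induction has to
  remove the last step instead of the first.\<close>

lemma card_fam_Suc_last:
  assumes "strict_mono_on {..<c} e"
  shows "card (families c (Suc n) q e) = (\<Sum>S\<in>Pow {..<c}. card (families c n q (\<lambda>k. e k + (if k \<in> S then 1 else 0))))"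
proof -
  have step: "Xs @ [S] \<in> families c (Suc n) q e \<longleftrightarrow> S \<subseteq> {..<c} \<and> Xs \<in> families c n q (\<lambda>k. e k + (if k \<in> S then 1 else 0))"
    if l: "length Xs = n" for Xs S
  proof -
    let ?q' = "\<lambda>k. e k + (if k \<in> S then 1 else 0)"
    let ?s = "\<lambda>k. path_pos q ((!) Xs) n k"
    have "(\<lambda>k. ?q' k - (if k \<in> S then 1 else 0)) = e" by auto
    have 1: "\<forall>k<c. ?s k - (if k \<in> S then 1 else 0) = e k" "S \<subseteq> {..<c}"
      if "Xs @ [S] \<in> families c (Suc n) q e"
      using that path_pos_append[of n Xs q "[S]"] l by (auto simp: families_def nth_append)
    have 2: "[S] \<in> families c 1 ?q' e \<longleftrightarrow> S \<subseteq> {..<c} \<and> strict_mono_on {..<c} ?q'"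
      unfolding One_nat_def families_Cons using assms by (auto simp: families_0)
    show ?thesis
    proof
      assume A: "Xs @ [S] \<in> families c (Suc n) q e"
      have "\<forall>k<c. path_pos q ((!) (Xs @ [S])) n k = ?q' k" using 1(1)[OF A] path_pos_append[of n Xs q "[S]"] l by (auto split: if_splits)
      thus "S \<subseteq> {..<c} \<and> Xs \<in> families c n q ?q'" using families_append[OF l, of "[S]" c 1 q e ?q'] A 1(2)[OF A] by simp
    next
      assume A: "S \<subseteq> {..<c} \<and> Xs \<in> families c n q ?q'"
      hence "strict_mono_on {..<c} (path_pos q ((!) Xs) n)" "\<forall>k<c. path_pos q ((!) Xs) n k = ?q' k" by (auto simp: families_def)
      hence "strict_mono_on {..<c} ?q'" using strict_mono_on_cong[of "{..<c}" "path_pos q ((!) Xs) n" ?q'] by auto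
      thus "Xs @ [S] \<in> families c (Suc n) q e" using families_append[OF l, of "[S]" c 1 q e ?q'] A 2 by simp
    qed
  qed
  have "families c (Suc n) q e = (\<Union>S\<in>Pow {..<c}. (\<lambda>Xs. Xs @ [S]) ` families c n q (\<lambda>k. e k + (if k \<in> S then 1 else 0)))" (is "?A = ?B")
  proof (rule Set.set_eqI)
    fix Ss show "Ss \<in> ?A \<longleftrightarrow> Ss \<in> ?B"
    proof (cases "length Ss = Suc n")
      case True
      then obtain Xs S where X: "Ss = Xs @ [S]" "length Xs = n" by (metis length_Suc_conv_rev)
      show ?thesis unfolding X using step[OF X(2)] by auto
    next
      case False thus ?thesis by (auto simp: families_def)
    qed
  qed
  also have "card \<dots> = (\<Sum>S\<in>Pow {..<c}. card ((\<lambda>Xs. Xs @ [S]) ` families c n q (\<lambda>k. e k + (if k \<in> S then 1 else 0))))"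
    by (rule card_UN_disjoint) (auto simp: finite_fam)
  also have "\<dots> = (\<Sum>S\<in>Pow {..<c}. card (families c n q (\<lambda>k. e k + (if k \<in> S then 1 else 0))))"
    by (intro sum.cong refl card_image) (auto intro: inj_onI)
  finally show ?thesis .
qed

lemma families_not_strict_start: "\<not> strict_mono_on {..<c} q \<Longrightarrow> families c n q e = {}"
proof -
  assume "\<not> strict_mono_on {..<c} q"
  moreover have "path_pos q S 0 = q" for S by (rule ext) simp
  ultimately show ?thesis by (auto simp: families_def)
qed

lemma families_not_strict_end: "\<not> strict_mono_on {..<c} e \<Longrightarrow> families c n q e = {}"
proof -
  assume *: "\<not> strict_mono_on {..<c} e"
  show ?thesis
  proof (rule ccontr)
    assume "families c n q e \<noteq> {}"
    then obtain Ss where "strict_mono_on {..<c} (path_pos q ((!) Ss) n)" "\<forall>k<c. path_pos q ((!) Ss) n k = e k"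
      by (auto simp: families_def)
    thus False using * strict_mono_on_cong[of "{..<c}" "path_pos q ((!) Ss) n" e] by auto
  qed
qed

text \<open>The number of k-step walks with steps 0 or s from p to the site i + z.\<close>

definition walks :: "int \<Rightarrow> int \<Rightarrow> nat \<Rightarrow> nat \<Rightarrow> int \<Rightarrow> real" where
  "walks s z k i p = (if 0 \<le> s * (int i + z - p) then real (k choose nat (s * (int i + z - p))) else 0)"

text \<open>Pascal's rule in the variable \<open>r = s * (int i + z - p)\<close>: a step of size
  \<open>s\<close> lowers \<open>r\<close> by 1 for either sign.\<close>

lemma walks_Suc:
  assumes "s = 1 \<or> s = -1"
  shows "walks s z (Suc k) i p = walks s z k i p + walks s z k i (p + s)"
proof -
  define r where "r = s * (int i + z - p)"
  have r1: "s * (int i + z - (p + s)) = r - 1" using assms by (auto simp: r_def)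
  consider "r < 0" | "r = 0" | "r > 0" by linarith
  thus ?thesis
  proof cases
    case 3
    define j where "j = nat (r - 1)"
    have "nat r = Suc j" "nat (r - 1) = j" using 3 by (auto simp: j_def)
    thus ?thesis using 3 unfolding walks_def r1 r_def[symmetric] by simp
  qed (auto simp: walks_def r1 r_def[symmetric])
qed

lemma fdet_add_cols:
  "fdet n (\<lambda>i j. f i j + g i j) = (\<Sum>S\<in>Pow {..<n}. fdet n (\<lambda>i j. if j \<in> S then g i j else f i j))"
proof -
  have "fdet n (\<lambda>i j. f i j + g i j) = fdet n (\<lambda>i j. f j i + g j i)"
    using fdet_transpose[of n "\<lambda>i j. f i j + g i j"] by simp
  also have "\<dots> = (\<Sum>S\<in>Pow {..<n}. fdet n (\<lambda>i j. if i \<in> S then g j i else f j i))" by (rule fdet_add_rows)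
  also have "\<dots> = (\<Sum>S\<in>Pow {..<n}. fdet n (\<lambda>i j. if j \<in> S then g i j else f i j))"
    by (intro sum.cong refl) (rule fdet_transpose)
  finally show ?thesis .
qed

text \<open>Expanding the determinant over the columns, the terms in which two paths collide have two
  equal columns.\<close>

lemma walk_count_det:
  fixes f :: "nat \<Rightarrow> (nat \<Rightarrow> int) \<Rightarrow> real"
  assumes s: "s = 1 \<or> s = -1"
    and f0: "\<And>q. strict_mono_on {..<c} q \<Longrightarrow> f 0 q = (if \<forall>k<c. q k = int k + z then 1 else 0)"
    and fS: "\<And>n q. strict_mono_on {..<c} q \<Longrightarrow> f (Suc n) q = (\<Sum>S\<in>Pow {..<c}. f n (\<lambda>k. q k + (if k \<in> S then s else 0)))"
    and fN: "\<And>n q. \<not> strict_mono_on {..<c} q \<Longrightarrow> f n q = 0"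
  shows "strict_mono_on {..<c} q \<Longrightarrow> f n q = fdet c (\<lambda>i j. walks s z n i (q j))"
proof (induction n arbitrary: q)
  case (0 q)
  have G0: "walks s z 0 i p = (if p = int i + z then 1 else 0)" for i p using s by (auto simp: walks_def)
  show ?case
  proof (cases "\<forall>k<c. q k = int k + z")
    case True
    have "fdet c (\<lambda>i j. walks s z 0 i (q j)) = fdet c (\<lambda>i j. if i = j then 1 else 0)"
      by (rule fdet_cong) (use True in \<open>auto simp: G0\<close>)
    thus ?thesis using f0[OF 0] True by (simp add: fdet_id)
  next
    case False
    \<comment> \<open>If every target site were hit, counting would make \<open>q\<close> an
      increasing bijection onto the target interval, hence the target itself. A missed site gives a
      zero row.\<close>
    have "\<exists>i<c. int i + z \<notin> q ` {..<c}"
    proof (rule ccontr)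
      assume N: "\<not> ?thesis"
      have "{z..<z + int c} \<subseteq> q ` {..<c}"
      proof
        fix x assume "x \<in> {z..<z + int c}"
        hence "nat (x - z) < c" "int (nat (x - z)) + z = x" by auto
        thus "x \<in> q ` {..<c}" using N by metis
      qed
      moreover have "card (q ` {..<c}) \<le> card {z..<z + int c}" using card_image_le[of "{..<c}" q] by simp
      ultimately have "{z..<z + int c} = q ` {..<c}" by (intro card_seteq) auto
      hence "q k = z + int k" if "k < c" for k using strict_mono_on_range_interval[OF 0 _ that] by simp
      thus False using False by auto
    qed
    then obtain i where i: "i < c" "int i + z \<notin> q ` {..<c}" by blast
    have "fdet c (\<lambda>i j. walks s z 0 i (q j)) = 0" by (rule fdet_zero_row[OF i(1)]) (use i in \<open>force simp: G0\<close>)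
    thus ?thesis using f0[OF 0] False by simp
  qed
next
  case (Suc n q)
  have "f (Suc n) q = (\<Sum>S\<in>Pow {..<c}. f n (\<lambda>k. q k + (if k \<in> S then s else 0)))" by (rule fS[OF Suc.prems])
  also have "\<dots> = (\<Sum>S\<in>Pow {..<c}. fdet c (\<lambda>i j. if j \<in> S then walks s z n i (q j + s) else walks s z n i (q j)))"
  proof (rule sum.cong[OF refl])
    fix S
    let ?q = "\<lambda>k. q k + (if k \<in> S then s else 0)"
    have eq: "fdet c (\<lambda>i j. if j \<in> S then walks s z n i (q j + s) else walks s z n i (q j)) = fdet c (\<lambda>i j. walks s z n i (?q j))"
      by (rule fdet_cong) auto
    show "f n ?q = fdet c (\<lambda>i j. if j \<in> S then walks s z n i (q j + s) else walks s z n i (q j))"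
    proof (cases "strict_mono_on {..<c} ?q")
      case True
      show ?thesis unfolding eq by (rule Suc.IH[OF True])
    next
      case False
      then obtain k l where kl: "k < c" "l < c" "k < l" "\<not> ?q k < ?q l" unfolding strict_mono_on_def by blast
      have "q k < q l" using Suc.prems kl unfolding strict_mono_on_def by auto
      \<comment> \<open>All steps have the same sign and size at most 1, so two ordered positions
        can meet but not cross.\<close>
      hence "?q k = ?q l" using kl(4) s by (auto split: if_splits)
      hence "fdet c (\<lambda>i j. walks s z n i (?q j)) = 0" using kl by (intro fdet_identical_cols[of k c l]) auto
      thus ?thesis unfolding eq fN[OF False] by simp
    qed
  qed
  also have "\<dots> = fdet c (\<lambda>i j. walks s z n i (q j) + walks s z n i (q j + s))" by (rule fdet_add_cols[symmetric])
  finally show ?case by (simp add: walks_Suc[OF s])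
qed

lemma card_fam_right:
  assumes "strict_mono_on {..<c} q"
  shows "real (card (families c n q (\<lambda>k. int k + z))) = fdet c (\<lambda>i j. walks (-1) z n i (q j))"
proof (rule walk_count_det[where f = "\<lambda>n q. real (card (families c n q (\<lambda>k. int k + z)))"])
  fix n q assume "strict_mono_on {..<c} (q :: nat \<Rightarrow> int)"
  moreover have "(\<lambda>k. q k - (if k \<in> S then 1 else 0)) = (\<lambda>k. q k + (if k \<in> S then - 1 else 0))" for S by auto
  ultimately show "real (card (families c (Suc n) q (\<lambda>k. int k + z))) = (\<Sum>S\<in>Pow {..<c}. real (card (families c n (\<lambda>k. q k + (if k \<in> S then - 1 else 0)) (\<lambda>k. int k + z))))"
    by (simp add: card_fam_Suc)
qed (auto simp: assms families_0 families_not_strict_start)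

lemma card_fam_left:
  assumes "strict_mono_on {..<c} e"
  shows "real (card (families c n int e)) = fdet c (\<lambda>i j. walks 1 0 n i (e j))"
proof (rule walk_count_det[where f = "\<lambda>n e. real (card (families c n int e))"])
  fix q assume "strict_mono_on {..<c} (q :: nat \<Rightarrow> int)"
  thus "real (card (families c 0 int q)) = (if \<forall>k<c. q k = int k + 0 then 1 else 0)"
    by (auto simp: families_0 strict_mono_on_def)
qed (auto simp: assms families_not_strict_end card_fam_Suc_last)

section \<open>Falling factorials and the polynomial part of the path counts\<close>

definition ffact :: "nat \<Rightarrow> real \<Rightarrow> real" where "ffact k y = (\<Prod>t<k. y - real t)"

lemma ffact_0 [simp]: "ffact 0 y = 1" and ffact_Suc: "ffact (Suc k) y = ffact k y * (y - real k)"
  by (simp_all add: ffact_def)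

text \<open>The polynomial functions of degree below \<open>n\<close>, in the basis on which the
  difference operator \<open>L\<close> will be bidiagonal.\<close>

definition ffact_span :: "nat \<Rightarrow> (real \<Rightarrow> real) set" where
  "ffact_span n = {f. \<exists>\<alpha>. \<forall>y. f y = (\<Sum>k<n. \<alpha> k * ffact k y)}"

lemma ffact_span_mult_affine:
  assumes "f \<in> ffact_span n"
  shows "(\<lambda>y. (A * y + B) * f y) \<in> ffact_span (Suc n)"
proof -
  obtain \<alpha> where \<alpha>: "\<And>y. f y = (\<Sum>k<n. \<alpha> k * ffact k y)" using assms by (auto simp: ffact_span_def)
  \<comment> \<open>From \<open>y * ffact k y = ffact (Suc k) y + k * ffact k y\<close>.\<close>
  let ?\<beta> = "\<lambda>k. (if k < n then \<alpha> k * (A * real k + B) else 0) + (if 0 < k then A * \<alpha> (k - 1) else 0)"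
  have "(A * y + B) * f y = (\<Sum>k<Suc n. ?\<beta> k * ffact k y)" for y
  proof -
    have "(A * y + B) * f y = (\<Sum>k<n. \<alpha> k * (A * real k + B) * ffact k y + A * \<alpha> k * ffact (Suc k) y)"
      unfolding \<alpha> sum_distrib_left by (intro sum.cong refl) (simp add: ffact_Suc algebra_simps)
    also have "\<dots> = (\<Sum>k<n. \<alpha> k * (A * real k + B) * ffact k y) + (\<Sum>k<n. A * \<alpha> k * ffact (Suc k) y)"
      by (rule sum.distrib)
    also have "(\<Sum>k<n. \<alpha> k * (A * real k + B) * ffact k y) = (\<Sum>k<Suc n. (if k < n then \<alpha> k * (A * real k + B) else 0) * ffact k y)"
      by simp
    also have "(\<Sum>k<n. A * \<alpha> k * ffact (Suc k) y) = (\<Sum>k<Suc n. (if 0 < k then A * \<alpha> (k - 1) else 0) * ffact k y)"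
      by (subst sum.lessThan_Suc_shift) simp
    finally show ?thesis by (simp only: sum.distrib[symmetric] distrib_right)
  qed
  thus ?thesis unfolding ffact_span_def by (intro CollectI exI[of _ ?\<beta>] allI)
qed

lemma ffact_span_prod_affine: "(\<lambda>y. \<Prod>t<n. A t * y + B t) \<in> ffact_span (Suc n)"
proof (induction n)
  case 0
  show ?case unfolding ffact_span_def by (auto intro!: exI[of _ "\<lambda>_. 1"])
next
  case (Suc n)
  from ffact_span_mult_affine[OF this, of "A n" "B n"] show ?case by (simp add: mult.commute)
qed

lemma prod_falling: "(\<Prod>u<i. real n - real u) = (if i \<le> n then fact n / fact (n - i) else 0)"
proof (induction i)
  case (Suc i)
  show ?case
  proof (cases "i < n")
    case True
    hence 1: "fact (n - i) = (real n - real i) * fact (n - Suc i)"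
      by (metis Suc_diff_Suc fact_Suc of_nat_diff less_imp_le of_nat_fact of_nat_mult)
    have "(\<Prod>u<Suc i. real n - real u) = fact n / fact (n - i) * (real n - real i)" using Suc True by simp
    also have "\<dots> = fact n / fact (n - Suc i)" unfolding 1 using True by simp
    finally show ?thesis using True by simp
  qed (use Suc in auto)
qed simp

text \<open>The polynomial part of the binomial coefficient \<open>walks 1 0 k i x\<close>; the other factor does not
  depend on i.\<close>

definition binom_poly :: "nat \<Rightarrow> nat \<Rightarrow> nat \<Rightarrow> real \<Rightarrow> real" where
  "binom_poly c k i x = (\<Prod>u<c - 1 - i. (real c - 1 - x) - real u) * (\<Prod>u<i. (real k + x) - real u)"

text \<open>With \<open>A = c - 1 - p\<close> and \<open>B = k + p\<close>, the factorials in the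
  denominator of the binomial coefficient are those of \<open>A - (c - 1 - i)\<close> and
  \<open>B - i\<close>: the factorials of \<open>A\<close> and \<open>B\<close> divided by falling
  factorials of total degree \<open>c - 1\<close>. Where the binomial coefficient is 0, one of the
  falling factorials vanishes.\<close>

lemma walks_factor:
  assumes "i < c" "- int k \<le> p" "p < int c"
  shows "walks 1 0 k i p = fact k / (fact (nat (int c - 1 - p)) * fact (nat (int k + p))) * binom_poly c k i (of_int p)"
proof -
  define A where "A = nat (int c - 1 - p)"
  define B where "B = nat (int k + p)"
  have A: "real c - 1 - of_int p = real A" and B: "real k + of_int p = real B" and p: "p = int c - 1 - int A" "p = int B - int k"
    using assms by (auto simp: A_def B_def)
  have AB: "A + B + 1 = c + k" using p by linarith
  have Q: "binom_poly c k i (of_int p) = (if c - 1 - i \<le> A then fact A / fact (A - (c - 1 - i)) else 0) * (if i \<le> B then fact B / fact (B - i) else 0)"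
    unfolding binom_poly_def A B prod_falling ..
  show ?thesis
  proof (cases "c - 1 - i \<le> A \<and> i \<le> B")
    case True
    define r where "r = A - (c - 1 - i)"
    have r: "int i - p = int r" "B - i = k - r" "r \<le> k" using True p assms(1) by (auto simp: r_def)
    have "walks 1 0 k i p = real (k choose r)" using r by (simp add: walks_def)
    also have "\<dots> = fact k / (fact r * fact (k - r))" using r(3) by (simp add: binomial_fact)
    finally show ?thesis using True r unfolding Q A_def[symmetric] B_def[symmetric] r_def[symmetric] by simp
  next
    case False
    have "walks 1 0 k i p = 0"
    proof (cases "c - 1 - i \<le> A")
      case True
      hence "int i - p > int k" using False p by linarith
      thus ?thesis by (simp add: walks_def binomial_eq_0)
    next
      case False
      hence "int i - p < 0" using p assms(1) by linarith
      thus ?thesis by (simp add: walks_def)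
    qed
    thus ?thesis using False unfolding Q by auto
  qed
qed

text \<open>Turning the picture upside down exchanges the two step directions, so that
  \<open>walks_factor\<close> also serves the part to the right of the line.\<close>

lemma walks_reflect: "i < c \<Longrightarrow> walks (-1) z k i p = walks 1 0 k (c - 1 - i) (int c - 1 + z - p)"
  unfolding walks_def by (simp add: of_nat_diff algebra_simps)

lemma prod_lessThan_add:
  fixes f :: "nat \<Rightarrow> real"
  shows "(\<Prod>t<n + i. f t) = (\<Prod>t<n. f t) * (\<Prod>t<i. f (n + t))"
  by (induction i) (simp_all add: mult.assoc)

lemma binom_poly_span:
  assumes "i < c"
  shows "(\<lambda>y. binom_poly c k i (\<sigma> * y + \<rho>)) \<in> ffact_span c"
proof -
  let ?n = "c - 1 - i"
  let ?A = "\<lambda>t. if t < ?n then - \<sigma> else \<sigma>"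
  let ?B = "\<lambda>t. if t < ?n then real c - 1 - \<rho> - real t else real k + \<rho> - real (t - ?n)"
  have "binom_poly c k i (\<sigma> * y + \<rho>) = (\<Prod>t<c - 1. ?A t * y + ?B t)" for y
  proof -
    have "(\<Prod>t<c - 1. ?A t * y + ?B t) = (\<Prod>t<?n + i. ?A t * y + ?B t)" using assms by simp
    also have "\<dots> = (\<Prod>t<?n. ?A t * y + ?B t) * (\<Prod>t<i. ?A (?n + t) * y + ?B (?n + t))"
      by (rule prod_lessThan_add)
    also have "(\<Prod>t<?n. ?A t * y + ?B t) = (\<Prod>u<?n. (real c - 1 - (\<sigma> * y + \<rho>)) - real u)"
      by (intro prod.cong refl) (simp add: algebra_simps)
    also have "(\<Prod>t<i. ?A (?n + t) * y + ?B (?n + t)) = (\<Prod>u<i. (real k + (\<sigma> * y + \<rho>)) - real u)"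
      by (intro prod.cong refl) (simp add: algebra_simps)
    finally show ?thesis unfolding binom_poly_def by simp
  qed
  moreover have "Suc (c - 1) = c" using assms by simp
  ultimately show ?thesis using ffact_span_prod_affine[where n = "c - 1" and A = ?A and B = ?B] by simp
qed

text \<open>The functions arise from the falling factorials by a constant matrix, and the
  determinant is multiplicative. Falling factorials are monic, so the right-hand determinant is the
  Vandermonde determinant of the points.\<close>

lemma fdet_ff_span:
  assumes "\<And>i. i < n \<Longrightarrow> f i \<in> ffact_span n"
  shows "\<exists>K. \<forall>y. fdet n (\<lambda>i j. f i (y j)) = K * fdet n (\<lambda>k j. ffact k (y j))"
proof -
  have "\<forall>i. \<exists>\<alpha>. i < n \<longrightarrow> (\<forall>y. f i y = (\<Sum>k<n. \<alpha> k * ffact k y))" using assms unfolding ffact_span_def by blast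
  then obtain \<alpha> where \<alpha>: "\<And>i y. i < n \<Longrightarrow> f i y = (\<Sum>k<n. \<alpha> i k * ffact k y)" by metis
  have "fdet n (\<lambda>i j. f i (y j)) = fdet n \<alpha> * fdet n (\<lambda>k j. ffact k (y j))" for y
    unfolding fdet_mult[symmetric] by (rule fdet_cong) (simp add: \<alpha>)
  thus ?thesis by blast
qed

section \<open>The distribution of the particles on a line\<close>

definition wt :: "nat \<Rightarrow> nat \<Rightarrow> nat \<Rightarrow> nat \<Rightarrow> real" where
  "wt N p q y = 1 / (fact y * fact (y + p) * fact (N - 1 - y) * fact (N - 1 - y + q))"

lemma strict_mono_on_int_unique:
  fixes q q' :: "nat \<Rightarrow> int"
  assumes "strict_mono_on {..<c} q" "strict_mono_on {..<c} q'" "q ` {..<c} = q' ` {..<c}" "k < c"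
  shows "q k = q' k"
proof -
  have s: "sorted (map q [0..<c]) \<and> distinct (map q [0..<c])" if "strict_mono_on {..<c} q" for q :: "nat \<Rightarrow> int"
    using that strict_mono_on_imp_inj_on[OF that]
    by (auto simp: sorted_iff_nth_mono_less distinct_map strict_mono_on_def atLeast0LessThan intro: less_imp_le)
  have "set (map q [0..<c]) = set (map q' [0..<c])" using assms(3) by (simp add: atLeast0LessThan)
  hence "map q [0..<c] = map q' [0..<c]" using s[OF assms(1)] s[OF assms(2)] by (intro sorted_distinct_set_unique) auto
  hence "map q [0..<c] ! k = map q' [0..<c] ! k" by (simp only:)
  thus ?thesis using assms(4) by simp
qed

context hex
begin

text \<open>Sites are numbered from the lowest one, of second coordinate \<open>lo m\<close>.\<close>

definition particles :: "nat \<Rightarrow> complex set set \<Rightarrow> nat set" where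
  "particles m T = {y. y < N m \<and> vtile (int m) (lo m + int y) \<notin> T}"

lemma particles_iff:
  assumes T: "T \<in> Tilings" and m: "m \<le> a + b"
    and P: "P \<subseteq> {..<N m}" "card P = c"
  shows "particles m T = P \<longleftrightarrow> (\<forall>k<c. path_pos int ((!) (path_family T)) m k = lo m + int (senum P k))"
proof -
  let ?q = "\<lambda>k. lo m + int (senum P k)"
  have fP: "finite P" using P(1) by (rule finite_subset) simp
  have bij: "bij_betw (senum P) {..<c} P" using senum_bij[OF fP] P(2) by simp
  have sq: "strict_mono_on {..<c} ?q" using senum_strict_mono[OF fP] P(2) by (auto simp: strict_mono_on_def)
  have img: "?q ` {..<c} = (\<lambda>y. lo m + int y) ` P"
  proof -
    have "(\<lambda>y. lo m + int y) ` P = (\<lambda>y. lo m + int y) ` (senum P ` {..<c})"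
      unfolding bij_betw_imp_surj_on[OF bij] ..
    thus ?thesis by (simp only: image_image)
  qed
  note Q = tiling_paths[OF T m]
  have imgQ: "tile_pos T m ` {..<c} = (\<lambda>y. lo m + int y) ` particles m T"
  proof (rule Set.set_eqI)
    fix j
    have "j \<in> tile_pos T m ` {..<c} \<longleftrightarrow> lo m \<le> j \<and> j < hi m \<and> vtile (int m) j \<notin> T" using Q seg_iff[OF m] by auto
    also have "\<dots> \<longleftrightarrow> j \<in> (\<lambda>y. lo m + int y) ` particles m T"
    proof
      assume A: "lo m \<le> j \<and> j < hi m \<and> vtile (int m) j \<notin> T"
      hence "nat (j - lo m) \<in> particles m T" "j = lo m + int (nat (j - lo m))" unfolding particles_def N_def by auto
      thus "j \<in> (\<lambda>y. lo m + int y) ` particles m T" by blast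
    qed (auto simp: particles_def N_def)
    finally show "j \<in> tile_pos T m ` {..<c} \<longleftrightarrow> j \<in> (\<lambda>y. lo m + int y) ` particles m T" .
  qed
  have "particles m T = P \<longleftrightarrow> tile_pos T m ` {..<c} = ?q ` {..<c}"
    unfolding img imgQ by (rule inj_image_eq_iff[symmetric]) (auto intro: injI)
  also have "\<dots> \<longleftrightarrow> (\<forall>k<c. tile_pos T m k = ?q k)"
    using strict_mono_on_int_unique[OF conjunct1[OF Q] sq] by (auto intro!: image_cong)
  also have "\<dots> \<longleftrightarrow> (\<forall>k<c. path_pos int ((!) (path_family T)) m k = ?q k)" using tile_pos_qpos[OF m] by auto
  finally show ?thesis .
qed

lemma particles_card:
  assumes T: "T \<in> Tilings" and m: "m \<le> a + b"
  shows "particles m T \<subseteq> {..<N m}" "card (particles m T) = c"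
proof -
  show "particles m T \<subseteq> {..<N m}" by (auto simp: particles_def)
  note Q = tiling_paths[OF T m]
  have "(\<lambda>j. nat (j - lo m)) ` (tile_pos T m ` {..<c}) = particles m T"
  proof (intro equalityI subsetI)
    fix y assume "y \<in> (\<lambda>j. nat (j - lo m)) ` (tile_pos T m ` {..<c})"
    then obtain j where "y = nat (j - lo m)" "lo m \<le> j" "j < hi m" "vtile (int m) j \<notin> T" using Q seg_iff[OF m] by auto
    thus "y \<in> particles m T" unfolding particles_def N_def by auto
  next
    fix y assume "y \<in> particles m T"
    hence "lo m + int y \<in> tile_pos T m ` {..<c}" using Q seg_iff[OF m] unfolding particles_def N_def by auto
    thus "y \<in> (\<lambda>j. nat (j - lo m)) ` (tile_pos T m ` {..<c})" by (rule image_eqI[rotated]) simp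
  qed
  moreover have "inj_on (\<lambda>j. nat (j - lo m)) (tile_pos T m ` {..<c})"
  proof (rule inj_onI)
    fix x y assume "x \<in> tile_pos T m ` {..<c}" "y \<in> tile_pos T m ` {..<c}" and e: "nat (x - lo m) = nat (y - lo m)"
    hence "lo m \<le> x" "lo m \<le> y" using Q seg_iff[OF m] by blast+
    thus "x = y" using e by simp
  qed
  moreover have "card (tile_pos T m ` {..<c}) = c"
    using conjunct1[OF Q] strict_mono_on_imp_inj_on[of "{..<c}" "tile_pos T m"] by (simp add: card_image)
  ultimately show "card (particles m T) = c" using card_image by fastforce
qed

definition wt_half :: "nat \<Rightarrow> int \<Rightarrow> real" where
  "wt_half k p = fact k / (fact (nat (int c - 1 - p)) * fact (nat (int k + p)))"

text \<open>The four factorials measure the position of the site relative to the four slanted sides,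
  extended to lines. Relative to the two lower ones it is \<open>y\<close> and
  \<open>y + \<bar>m - b\<bar>\<close>, relative to the upper ones \<open>N - 1 - y\<close> and
  \<open>N - 1 - y + \<bar>a - m\<bar>\<close>; which of the two sides is nearer depends on the
  order of \<open>m\<close> and \<open>b\<close>, or of \<open>m\<close> and
  \<open>a\<close>.\<close>

lemma weight_eq:
  assumes m: "m \<le> a + b" and y: "y < N m"
  shows "wt_half m (lo m + int y) * wt_half (a + b - m) (int c - 1 - int b - (lo m + int y)) =
    fact m * fact (a + b - m) * wt (N m) (nat \<bar>int m - int b\<bar>) (nat \<bar>int a - int m\<bar>) y"
proof -
  define p where "p = lo m + int y"
  let ?p = "nat \<bar>int m - int b\<bar>" and ?q = "nat \<bar>int a - int m\<bar>"
  have y': "int y < hi m - lo m" using y by (simp add: N_def)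
  have 1: "fact (nat (int m + p)) * fact (nat (int b + p)) = (fact y * fact (y + ?p) :: real)"
  proof (cases "m \<le> b")
    case True
    hence "nat (int m + p) = y" "nat (int b + p) = y + ?p" by (auto simp: p_def lo_def)
    thus ?thesis by simp
  next
    case False
    hence "nat (int m + p) = y + ?p" "nat (int b + p) = y" by (auto simp: p_def lo_def)
    thus ?thesis by simp
  qed
  have 2: "fact (nat (int c - 1 - p)) * fact (nat (int a + int c - 1 - int m - p)) = (fact (N m - 1 - y) * fact (N m - 1 - y + ?q) :: real)"
  proof (cases "m \<le> a")
    case True
    hence "nat (int c - 1 - p) = N m - 1 - y" "nat (int a + int c - 1 - int m - p) = N m - 1 - y + ?q"
      using y' unfolding p_def N_def hi_def by auto
    thus ?thesis by simp
  next
    case False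
    hence "nat (int c - 1 - p) = N m - 1 - y + ?q" "nat (int a + int c - 1 - int m - p) = N m - 1 - y"
      using y' unfolding p_def N_def hi_def by auto
    thus ?thesis by simp
  qed
  have "int c - 1 - (int c - 1 - int b - p) = int b + p" "int (a + b - m) + (int c - 1 - int b - p) = int a + int c - 1 - int m - p"
    using m by (auto simp: of_nat_diff)
  hence "wt_half m p * wt_half (a + b - m) (int c - 1 - int b - p) = fact m * fact (a + b - m) /
     ((fact (nat (int m + p)) * fact (nat (int b + p))) * (fact (nat (int c - 1 - p)) * fact (nat (int a + int c - 1 - int m - p))))"
    unfolding wt_half_def by (simp only: times_divide_times_eq mult_ac)
  also have "\<dots> = fact m * fact (a + b - m) * wt (N m) ?p ?q y" unfolding 1 2 wt_def by simp
  finally show ?thesis unfolding p_def .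
qed

text \<open>The left and the right count are each a product of one factor per particle and a
  multiple of the same Vandermonde determinant, whence the square.\<close>

theorem card_tilings_parts:
  assumes m: "m \<le> a + b"
  shows "\<exists>K. \<forall>P. P \<subseteq> {..<N m} \<longrightarrow> card P = c \<longrightarrow>
    real (card {T \<in> Tilings. particles m T = P}) =
    K * (\<Prod>y\<in>P. wt (N m) (nat \<bar>int m - int b\<bar>) (nat \<bar>int a - int m\<bar>) y) * (fdet c (\<lambda>k j. ffact k (real (senum P j))))\<^sup>2"
proof -
  let ?k = "a + b - m"
  let ?f1 = "\<lambda>i y. binom_poly c m i (1 * y + of_int (lo m))"
  \<comment> \<open>The right-hand count enters through \<open>walks_reflect\<close>: the rows are
    reversed and the sites are measured downwards.\<close>
  let ?f2 = "\<lambda>i y. binom_poly c ?k (c - 1 - i) ((-1) * y + of_int (int c - 1 - int b - lo m))"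
  obtain K1 where K1: "\<And>y. fdet c (\<lambda>i j. ?f1 i (y j)) = K1 * fdet c (\<lambda>k j. ffact k (y j))"
    using fdet_ff_span[of c ?f1] binom_poly_span[of _ c m 1 "of_int (lo m)"] by blast
  have "?f2 i \<in> ffact_span c" if "i < c" for i using that pos by (intro binom_poly_span) auto
  then obtain K2 where K2: "\<And>y. fdet c (\<lambda>i j. ?f2 i (y j)) = K2 * fdet c (\<lambda>k j. ffact k (y j))"
    using fdet_ff_span[of c ?f2] by blast
  have "real (card {T \<in> Tilings. particles m T = P}) = (K1 * K2 * (fact m * fact ?k) ^ c) *
      (\<Prod>y\<in>P. wt (N m) (nat \<bar>int m - int b\<bar>) (nat \<bar>int a - int m\<bar>) y) * (fdet c (\<lambda>k j. ffact k (real (senum P j))))\<^sup>2"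
    if P: "P \<subseteq> {..<N m}" "card P = c" for P
  proof -
    let ?q = "\<lambda>k. lo m + int (senum P k)"
    have fP: "finite P" using P(1) by (rule finite_subset) simp
    have bij: "bij_betw (senum P) {..<c} P" using senum_bij[OF fP] P(2) by simp
    have sq: "strict_mono_on {..<c} ?q" using senum_strict_mono[OF fP] P(2) by (auto simp: strict_mono_on_def)
    have senum: "senum P j < N m" if "j < c" for j using bij P(1) that by (auto simp: bij_betw_def)
    have ends: "endpos = (\<lambda>k. int k + (- int b))" by auto
    have img: "path_family ` {T \<in> Tilings. particles m T = P} = {Ss \<in> families c (m + ?k) int endpos. \<forall>k<c. path_pos int ((!) Ss) m k = ?q k}"
    proof -
      have "path_family ` {T \<in> Tilings. particles m T = P} = path_family ` {T \<in> Tilings. \<forall>k<c. path_pos int ((!) (path_family T)) m k = ?q k}"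
        using particles_iff[OF _ m P] by (intro image_cong) auto
      also have "\<dots> = {Ss \<in> path_family ` Tilings. \<forall>k<c. path_pos int ((!) Ss) m k = ?q k}" by blast
      also have "path_family ` Tilings = families c (m + ?k) int endpos" using tilings_bij m by (simp add: bij_betw_def)
      finally show ?thesis .
    qed
    have inj: "inj_on path_family {T \<in> Tilings. particles m T = P}"
      using tilings_bij by (auto simp: bij_betw_def intro: inj_on_subset)
    have "card {T \<in> Tilings. particles m T = P} = card (path_family ` {T \<in> Tilings. particles m T = P})"
      by (rule card_image[OF inj, symmetric])
    hence c0: "card {T \<in> Tilings. particles m T = P} = card (families c m int ?q) * card (families c ?k ?q endpos)"
      unfolding img card_fam_split .
    have "real (card {T \<in> Tilings. particles m T = P}) = fdet c (\<lambda>i j. walks 1 0 m i (?q j)) * fdet c (\<lambda>i j. walks (-1) (- int b) ?k i (?q j))"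
      unfolding c0 of_nat_mult ends card_fam_left[OF sq] card_fam_right[OF sq] ..
    also have "fdet c (\<lambda>i j. walks 1 0 m i (?q j)) = fdet c (\<lambda>i j. wt_half m (?q j) * ?f1 i (real (senum P j)))"
    proof (rule fdet_cong)
      fix i j assume ij: "i < c" "j < c"
      have "- int m \<le> ?q j" "?q j < int c" using senum[OF ij(2)] by (auto simp: lo_def N_def hi_def)
      from walks_factor[OF ij(1) this] show "walks 1 0 m i (?q j) = wt_half m (?q j) * ?f1 i (real (senum P j))"
        unfolding wt_half_def by (simp add: add.commute)
    qed
    also have "\<dots> = (\<Prod>j<c. wt_half m (?q j)) * (K1 * fdet c (\<lambda>k j. ffact k (real (senum P j))))"
      unfolding fdet_scale_cols K1 ..
    also have "fdet c (\<lambda>i j. walks (-1) (- int b) ?k i (?q j)) = fdet c (\<lambda>i j. wt_half ?k (int c - 1 - int b - ?q j) * ?f2 i (real (senum P j)))"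
    proof (rule fdet_cong)
      fix i j assume ij: "i < c" "j < c"
      have r: "- int ?k \<le> int c - 1 - int b - ?q j" "int c - 1 - int b - ?q j < int c"
        using senum[OF ij(2)] m by (auto simp: lo_def N_def hi_def of_nat_diff)
      have "walks (-1) (- int b) ?k i (?q j) = walks 1 0 ?k (c - 1 - i) (int c - 1 - int b - ?q j)"
        using walks_reflect[OF ij(1), of "- int b" ?k "?q j"] by simp
      also have "\<dots> = wt_half ?k (int c - 1 - int b - ?q j) * binom_poly c ?k (c - 1 - i) (of_int (int c - 1 - int b - ?q j))"
        using walks_factor[OF _ r, of "c - 1 - i"] ij unfolding wt_half_def by simp
      also have "of_int (int c - 1 - int b - ?q j) = (-1) * real (senum P j) + real_of_int (int c - 1 - int b - lo m)" by simp
      finally show "walks (-1) (- int b) ?k i (?q j) = wt_half ?k (int c - 1 - int b - ?q j) * ?f2 i (real (senum P j))" .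
    qed
    also have "\<dots> = (\<Prod>j<c. wt_half ?k (int c - 1 - int b - ?q j)) * (K2 * fdet c (\<lambda>k j. ffact k (real (senum P j))))"
      unfolding fdet_scale_cols K2 ..
    also have "(\<Prod>j<c. wt_half m (?q j)) * (K1 * fdet c (\<lambda>k j. ffact k (real (senum P j)))) *
       ((\<Prod>j<c. wt_half ?k (int c - 1 - int b - ?q j)) * (K2 * fdet c (\<lambda>k j. ffact k (real (senum P j))))) =
       K1 * K2 * (\<Prod>j<c. wt_half m (?q j) * wt_half ?k (int c - 1 - int b - ?q j)) * (fdet c (\<lambda>k j. ffact k (real (senum P j))))\<^sup>2"
      by (simp add: prod.distrib power2_eq_square)
    also have "(\<Prod>j<c. wt_half m (?q j) * wt_half ?k (int c - 1 - int b - ?q j)) =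
      (\<Prod>j<c. fact m * fact ?k * wt (N m) (nat \<bar>int m - int b\<bar>) (nat \<bar>int a - int m\<bar>) (senum P j))"
      by (intro prod.cong refl weight_eq[OF m] senum) simp
    also have "\<dots> = (fact m * fact ?k) ^ c * (\<Prod>j<c. wt (N m) (nat \<bar>int m - int b\<bar>) (nat \<bar>int a - int m\<bar>) (senum P j))"
      unfolding prod.distrib[of "\<lambda>_. fact m * fact ?k"] by simp
    also have "(\<Prod>j<c. wt (N m) (nat \<bar>int m - int b\<bar>) (nat \<bar>int a - int m\<bar>) (senum P j)) =
      (\<Prod>y\<in>P. wt (N m) (nat \<bar>int m - int b\<bar>) (nat \<bar>int a - int m\<bar>) y)" by (rule prod.reindex_bij_betw[OF bij])
    finally show ?thesis by (simp only: mult.assoc)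
  qed
  thus ?thesis by blast
qed

lemma tilings_nonempty: "Tilings \<noteq> {}" and finite_tilings: "finite Tilings"
proof -
  \<comment> \<open>All paths move in parallel, down in the first \<open>b\<close> steps and flat in
    the remaining \<open>a\<close>.\<close>
  let ?Ss = "replicate b {..<c} @ replicate a {} :: nat set list"
  have q: "path_pos int ((!) ?Ss) i k = int k - int (min i b)" if "k < c" "i \<le> a + b" for i k
    using that by (induction i) (auto simp: nth_append)
  have "strict_mono_on {..<c} (path_pos int ((!) ?Ss) i)" if "i \<le> a + b" for i
    using q[OF _ that] by (auto simp: strict_mono_on_def)
  hence "?Ss \<in> families c (a + b) int endpos" using q[of _ "a + b"] unfolding families_def by auto
  thus "Tilings \<noteq> {}" using families_tiling_in_tilings by blast
  show "finite Tilings" using bij_betw_finite[OF tilings_bij] finite_fam by blast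
qed

end

section \<open>Eigenfunctions of the Hahn difference operator\<close>

lemma ffact_shift: "ffact (Suc j) y = y * ffact j (y - 1)"
proof -
  have "ffact (Suc j) y = (\<Prod>t<Suc j. y - real t)" by (simp add: ffact_def)
  also have "\<dots> = (y - real 0) * (\<Prod>t<j. y - real (Suc t))" by (rule prod.lessThan_Suc_shift)
  also have "\<dots> = y * ffact j (y - 1)" by (simp add: ffact_def algebra_simps)
  finally show ?thesis .
qed

lemma ffact_nat_eq_0: "y < k \<Longrightarrow> ffact k (real y) = 0"
  unfolding ffact_def by (rule prod_zero) auto

lemma ffact_self_nonzero: "ffact k (real k) \<noteq> 0"
  unfolding ffact_def by (auto simp: prod_zero_iff)

locale hahn =
  fixes N p q :: nat
  assumes N_pos: "0 < N"
begin

text \<open>\<open>L\<close> is minus the generator of a birth and death chain with upward rate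
  \<open>B\<close> and downward rate \<open>C\<close>. Each rate vanishes where its step would leave
  \<open>{..<N}\<close>, so \<open>L\<close> acts on functions on the sites.\<close>

definition B :: "real \<Rightarrow> real" where "B y = (real N - 1 - y) * (real N - 1 - y + real q)"
definition C :: "real \<Rightarrow> real" where "C y = y * (y + real p)"
definition w :: "nat \<Rightarrow> real" where "w = wt N p q"
definition L :: "(real \<Rightarrow> real) \<Rightarrow> real \<Rightarrow> real" where
  "L f y = (B y + C y) * f y - B y * f (y + 1) - C y * f (y - 1)"
definition eigval :: "nat \<Rightarrow> real" where
  "eigval k = real k * (2 * real N - 1 + real p + real q - real k)"
definition eig_low :: "nat \<Rightarrow> real" where
  "eig_low k = real k * ((real k - 1) * (2 * real N - 1 + real q - real k) - (real N - 1) * (real N - 1 + real q))"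

lemma w_pos: "0 < w y" by (simp add: w_def wt_def)

text \<open>Detailed balance: the rates are read off from the ratio of consecutive weights, and this
  is what makes \<open>L\<close> symmetric.\<close>

lemma w_ratio:
  assumes "Suc y < N"
  shows "w y * B (real y) = w (Suc y) * C (real (Suc y))"
proof -
  define z where "z = N - 1 - Suc y"
  have z: "N - 1 - y = Suc z" "real N - 1 - real y = real (Suc z)" using assms by (auto simp: z_def)
  have "w y = 1 / (fact y * fact (y + p) * fact (Suc z) * fact (Suc z + q))"
    unfolding w_def wt_def z ..
  moreover have "w (Suc y) = 1 / (fact (Suc y) * fact (Suc y + p) * fact z * fact (z + q))"
    unfolding w_def wt_def z_def ..
  moreover have "fact (Suc y) = real (Suc y) * (fact y :: real)" "fact (Suc y + p) = real (Suc y + p) * (fact (y + p) :: real)"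
    "fact (Suc z) = real (Suc z) * (fact z :: real)" "fact (Suc z + q) = real (Suc z + q) * (fact (z + q) :: real)"
    by (simp_all del: of_nat_Suc add: fact_Suc)
  moreover have "B (real y) = real (Suc z) * real (Suc z + q)" unfolding B_def z by simp
  moreover have "C (real (Suc y)) = real (Suc y) * real (Suc y + p)" unfolding C_def by simp
  ultimately show ?thesis by (simp del: of_nat_Suc of_nat_add)
qed

text \<open>\<open>B\<close> and \<open>C\<close> have the same leading coefficient, so
  \<open>L\<close> does not raise the degree; on falling factorials it is even bidiagonal, with the
  eigenvalues on the diagonal.\<close>

lemma L_ff: "L (ffact k) y = eigval k * ffact k y + eig_low k * ffact (k - 1) y"
proof (cases k)
  case 0
  thus ?thesis by (simp add: L_def eigval_def eig_low_def algebra_simps)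
next
  case (Suc j)
  have 1: "ffact (Suc j) (y + 1) = (y + 1) * ffact j y" using ffact_shift[of j "y + 1"] by simp
  have 2: "C y * (ffact (Suc j) y - ffact (Suc j) (y - 1)) = (y + real p) * (real j + 1) * ffact (Suc j) y"
    unfolding ffact_Suc[of j "y - 1"] unfolding ffact_shift[of j y] C_def by (simp add: algebra_simps)
  have 3: "ffact (Suc j) (y + 1) - ffact (Suc j) y = (real j + 1) * ffact j y"
    unfolding 1 ffact_Suc[of j y] by (simp add: algebra_simps)
  have "L (ffact k) y = C y * (ffact (Suc j) y - ffact (Suc j) (y - 1)) - B y * (ffact (Suc j) (y + 1) - ffact (Suc j) y)"
    unfolding L_def Suc by (simp add: algebra_simps)
  also have "\<dots> = ((y + real p) * (real j + 1) * (y - real j) - B y * (real j + 1)) * ffact j y"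
    unfolding 2 3 unfolding ffact_Suc[of j y] by (simp add: algebra_simps)
  also have "(y + real p) * (real j + 1) * (y - real j) - B y * (real j + 1) = eigval (Suc j) * (y - real j) + eig_low (Suc j)"
    unfolding B_def eigval_def eig_low_def by (simp add: algebra_simps)
  finally show ?thesis unfolding Suc by (simp add: ffact_Suc[of j y] algebra_simps)
qed

lemma eigval_diff: "eigval k - eigval l = (real k - real l) * (2 * real N - 1 + real p + real q - real k - real l)"
  by (simp add: eigval_def algebra_simps)

text \<open>The second factor in \<open>eigval_diff\<close> is positive because
  \<open>k + l < 2 * N - 1\<close>. Ordering by degree and ordering by eigenvalue thus agree, which
  turns a cut in the degree into a cut in the spectrum.\<close>

lemma eigval_less: "l < k \<Longrightarrow> k < N \<Longrightarrow> eigval l < eigval k"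
proof -
  assume "l < k" "k < N"
  hence "0 < (real k - real l) * (2 * real N - 1 + real p + real q - real k - real l)"
    by (intro mult_pos_pos) linarith+
  thus ?thesis using eigval_diff[of k l] by linarith
qed

text \<open>The solution of the two-term recursion that the bidiagonal form of \<open>L\<close>
  imposes on an eigenvector, started from leading coefficient 1. For \<open>k < N\<close> the
  denominators are nonzero by \<open>eigval_less\<close>.\<close>

definition eig_coeff :: "nat \<Rightarrow> nat \<Rightarrow> real" where
  "eig_coeff k l = (\<Prod>t\<in>{l..<k}. eig_low (Suc t) / (eigval k - eigval t))"

definition eig_poly :: "nat \<Rightarrow> real \<Rightarrow> real" where
  "eig_poly k y = (\<Sum>l\<le>k. eig_coeff k l * ffact l y)"

lemma eig_coeff_self: "eig_coeff k k = 1" by (simp add: eig_coeff_def)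

lemma eig_coeff_rec:
  assumes "l < k" "k < N"
  shows "(eigval k - eigval l) * eig_coeff k l = eig_low (Suc l) * eig_coeff k (Suc l)"
proof -
  have "{l..<k} = insert l {Suc l..<k}" using assms(1) by auto
  hence "eig_coeff k l = eig_low (Suc l) / (eigval k - eigval l) * eig_coeff k (Suc l)" unfolding eig_coeff_def by simp
  thus ?thesis using eigval_less[OF assms] by simp
qed

lemma L_sum: "finite A \<Longrightarrow> L (\<lambda>y. \<Sum>l\<in>A. a l * f l y) y = (\<Sum>l\<in>A. a l * L (f l) y)"
  unfolding L_def by (simp add: sum_distrib_left sum_subtractf[symmetric] algebra_simps)

lemma L_ppi:
  assumes k: "k < N"
  shows "L (eig_poly k) y = eigval k * eig_poly k y"
proof -
  have "eig_poly k = (\<lambda>y. \<Sum>l\<le>k. eig_coeff k l * ffact l y)" by (rule ext) (simp add: eig_poly_def)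
  hence "L (eig_poly k) y = (\<Sum>l\<le>k. eig_coeff k l * L (ffact l) y)" using L_sum[of "{..k}" "eig_coeff k" ffact y] by simp
  also have "\<dots> = (\<Sum>l\<le>k. eig_coeff k l * eigval l * ffact l y) + (\<Sum>l\<le>k. eig_coeff k l * eig_low l * ffact (l - 1) y)"
    unfolding L_ff by (simp add: algebra_simps sum.distrib)
  \<comment> \<open>The term \<open>l = 0\<close>, where \<open>l - 1\<close> is truncated, drops
    out since \<open>eig_low 0 = 0\<close>.\<close>
  also have "(\<Sum>l\<le>k. eig_coeff k l * eig_low l * ffact (l - 1) y) = (\<Sum>l<k. eig_coeff k (Suc l) * eig_low (Suc l) * ffact l y)"
    using sum.lessThan_Suc_shift[of "\<lambda>l. eig_coeff k l * eig_low l * ffact (l - 1) y" k] by (simp add: lessThan_Suc_atMost eig_low_def)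
  also have "\<dots> = (\<Sum>l<k. (eigval k - eigval l) * eig_coeff k l * ffact l y)"
  proof (rule sum.cong[OF refl])
    fix l assume "l \<in> {..<k}"
    hence l: "l < k" by simp
    show "eig_coeff k (Suc l) * eig_low (Suc l) * ffact l y = (eigval k - eigval l) * eig_coeff k l * ffact l y" unfolding eig_coeff_rec[OF l k] by simp
  qed
  also have "\<dots> = (\<Sum>l\<le>k. (eigval k - eigval l) * eig_coeff k l * ffact l y)"
    by (simp add: lessThan_Suc_atMost[symmetric])
  also have "(\<Sum>l\<le>k. eig_coeff k l * eigval l * ffact l y) + (\<Sum>l\<le>k. (eigval k - eigval l) * eig_coeff k l * ffact l y) = eigval k * eig_poly k y"
    unfolding eig_poly_def sum_distrib_left sum.distrib[symmetric] by (intro sum.cong refl) (simp add: algebra_simps)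
  finally show ?thesis .
qed

text \<open>Summation by parts: by \<open>w_ratio\<close> the upward terms at \<open>y\<close>
  cancel the downward terms at \<open>Suc y\<close>, and the boundary terms vanish with
  \<open>B\<close> at \<open>N - 1\<close> and \<open>C\<close> at 0.\<close>

lemma L_symmetric:
  "(\<Sum>y<N. w y * (g (real y) * L f (real y))) = (\<Sum>y<N. w y * (f (real y) * L g (real y)))"
proof -
  define h where "h y = w y * B (real y) * (f (real y) * g (real y + 1) - f (real y + 1) * g (real y))" for y
  obtain n where n: "N = Suc n" using N_pos by (metis gr0_implies_Suc)
  have n': "{..<N} = {..<Suc n}" and n'': "\<And>y. y < n \<Longrightarrow> Suc y < N" using n by simp_all
  have "real N - 1 - real n = 0" using n by simp
  hence B0: "B (real n) = 0" by (simp add: B_def)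
  have "(\<Sum>y<N. w y * (g (real y) * L f (real y))) - (\<Sum>y<N. w y * (f (real y) * L g (real y))) =
     (\<Sum>y<N. h y + w y * C (real y) * (f (real y) * g (real y - 1) - f (real y - 1) * g (real y)))"
    unfolding sum_subtractf[symmetric] h_def L_def by (intro sum.cong refl) (simp add: algebra_simps)
  also have "\<dots> = (\<Sum>y<N. h y) + (\<Sum>y<N. w y * C (real y) * (f (real y) * g (real y - 1) - f (real y - 1) * g (real y)))"
    by (rule sum.distrib)
  also have "(\<Sum>y<N. w y * C (real y) * (f (real y) * g (real y - 1) - f (real y - 1) * g (real y))) = (\<Sum>y<n. - h y)"
  proof -
    have "w (Suc y) * C (real (Suc y)) * (f (real (Suc y)) * g (real (Suc y) - 1) - f (real (Suc y) - 1) * g (real (Suc y))) = - h y"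
      if "y < n" for y
      unfolding w_ratio[OF n''[OF that], symmetric] h_def by (simp add: algebra_simps)
    thus ?thesis unfolding n' sum.lessThan_Suc_shift by (simp add: C_def del: of_nat_Suc)
  qed
  also have "(\<Sum>y<N. h y) + (\<Sum>y<n. - h y) = 0" unfolding n' by (simp add: sum_negf h_def[of n] B0)
  finally show ?thesis by simp
qed

lemma eig_poly_orth:
  assumes "k < N" "l < N" "k \<noteq> l"
  shows "(\<Sum>y<N. w y * (eig_poly k (real y) * eig_poly l (real y))) = 0"
proof -
  have "eigval l * (\<Sum>y<N. w y * (eig_poly k (real y) * eig_poly l (real y))) = (\<Sum>y<N. w y * (eig_poly k (real y) * L (eig_poly l) (real y)))"
    unfolding L_ppi[OF assms(2)] sum_distrib_left by (simp add: mult_ac)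
  also have "\<dots> = (\<Sum>y<N. w y * (eig_poly l (real y) * L (eig_poly k) (real y)))" by (rule L_symmetric)
  also have "\<dots> = eigval k * (\<Sum>y<N. w y * (eig_poly k (real y) * eig_poly l (real y)))"
    unfolding L_ppi[OF assms(1)] sum_distrib_left by (simp add: mult_ac)
  finally have "(eigval l - eigval k) * (\<Sum>y<N. w y * (eig_poly k (real y) * eig_poly l (real y))) = 0" by (simp add: algebra_simps)
  moreover have "eigval l \<noteq> eigval k" using eigval_less[of k l] eigval_less[of l k] assms by (metis less_irrefl linorder_neqE_nat)
  ultimately show ?thesis by simp
qed

text \<open>A nontrivial combination of falling factorials does not vanish at the least index
  that occurs in it.\<close>

lemma eig_poly_norm_pos:
  assumes "k < N"
  shows "0 < (\<Sum>y<N. w y * (eig_poly k (real y))\<^sup>2)"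
proof -
  define l where "l = (LEAST l. eig_coeff k l \<noteq> 0)"
  have kk: "eig_coeff k k \<noteq> 0" by (simp add: eig_coeff_self)
  have l: "eig_coeff k l \<noteq> 0" "l \<le> k"
    unfolding l_def by (rule LeastI[of "\<lambda>l. eig_coeff k l \<noteq> 0", OF kk], rule Least_le[of "\<lambda>l. eig_coeff k l \<noteq> 0", OF kk])
  have l0: "eig_coeff k l' = 0" if "l' < l" for l' using not_less_Least[of l' "\<lambda>l. eig_coeff k l \<noteq> 0"] that l_def by blast
  have "eig_poly k (real l) = (\<Sum>l'\<in>{l}. eig_coeff k l' * ffact l' (real l))"
    unfolding eig_poly_def
  proof (rule sum.mono_neutral_right)
    show "\<forall>i\<in>{..k} - {l}. eig_coeff k i * ffact i (real l) = 0"
    proof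
      fix i assume "i \<in> {..k} - {l}"
      hence "i < l \<or> l < i" by auto
      thus "eig_coeff k i * ffact i (real l) = 0" using l0 ffact_nat_eq_0 by auto
    qed
  qed (use l in auto)
  hence "eig_poly k (real l) \<noteq> 0" using l(1) ffact_self_nonzero by simp
  hence "0 < w l * (eig_poly k (real l))\<^sup>2" using w_pos by simp
  also have "\<dots> \<le> (\<Sum>y<N. w y * (eig_poly k (real y))\<^sup>2)"
    by (rule member_le_sum) (use l assms in \<open>auto intro!: mult_nonneg_nonneg less_imp_le[OF w_pos]\<close>)
  finally show ?thesis .
qed

definition eig_norm :: "nat \<Rightarrow> real" where "eig_norm k = sqrt (\<Sum>y<N. w y * (eig_poly k (real y))\<^sup>2)"

text \<open>The alternating sign turns the off-diagonal entries of the Jacobi matrix positive.\<close>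

definition phi :: "nat \<Rightarrow> nat \<Rightarrow> real" where
  "phi k y = (-1) ^ y * sqrt (w y) * eig_poly k (real y) / eig_norm k"

lemma eig_norm_pos: "k < N \<Longrightarrow> 0 < eig_norm k" unfolding eig_norm_def using eig_poly_norm_pos by simp

lemma phi_mult: "phi k y * phi l y = w y * (eig_poly k (real y) * eig_poly l (real y)) / (eig_norm k * eig_norm l)"
proof -
  have "sqrt (w y) * sqrt (w y) = w y" using w_pos[of y] by simp
  moreover have "(-1) ^ y * (-1) ^ y = (1::real)" by (simp flip: power_add)
  ultimately show ?thesis unfolding phi_def
    by (simp add: divide_inverse mult_ac)
qed

lemma phi_orthonormal:
  assumes "k < N" "l < N"
  shows "(\<Sum>y<N. phi k y * phi l y) = (if k = l then 1 else 0)"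
proof (cases "k = l")
  case True
  have "eig_norm k * eig_norm k = (\<Sum>y<N. w y * (eig_poly k (real y) * eig_poly k (real y)))"
    unfolding eig_norm_def using eig_poly_norm_pos[OF assms(1)] by (simp add: power2_eq_square)
  moreover have "eig_norm k * eig_norm k \<noteq> 0" using eig_norm_pos[OF assms(1)] by simp
  ultimately show ?thesis unfolding phi_mult True sum_divide_distrib[symmetric] by simp
next
  case False
  thus ?thesis unfolding phi_mult sum_divide_distrib[symmetric] using eig_poly_orth[OF assms] by simp
qed

text \<open>There are as many eigenfunctions as sites, so the matrix with these orthonormal rows is
  square and its columns are orthonormal too.\<close>

lemma phi_complete:
  assumes "x < N" "y < N"
  shows "(\<Sum>k<N. phi k x * phi k y) = (if x = y then 1 else 0)"
proof -
  define A where "A = mat N N (\<lambda>(i, j). phi i j)"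
  have A: "A \<in> carrier_mat N N" "transpose_mat A \<in> carrier_mat N N" by (auto simp: A_def)
  have "A * transpose_mat A = 1\<^sub>m N"
    by (intro eq_matI) (auto simp: A_def scalar_prod_def atLeast0LessThan phi_orthonormal)
  hence T: "transpose_mat A * A = 1\<^sub>m N" by (rule mat_mult_left_right_inverse[OF A])
  have "(\<Sum>k<N. phi k x * phi k y) = (transpose_mat A * A) $$ (x, y)"
    using assms by (auto simp: A_def scalar_prod_def atLeast0LessThan)
  thus ?thesis unfolding T using assms by simp
qed

text \<open>Conjugation with the square root of the weight symmetrizes \<open>L\<close>: by detailed
  balance the two entries linking \<open>y\<close> and \<open>Suc y\<close> both become, up to sign,
  the geometric mean of \<open>B\<close> at \<open>y\<close> and \<open>C\<close> at
  \<open>Suc y\<close>.\<close>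

lemma phi_recurrence:
  assumes k: "k < N" and y: "0 < y" "Suc y < N"
  shows "eigval k * phi k y = (B (real y) + C (real y)) * phi k y +
     sqrt (B (real y) * C (real (Suc y))) * phi k (Suc y) + sqrt (B (real (y - 1)) * C (real y)) * phi k (y - 1)"
proof -
  obtain z where z: "y = Suc z" using y(1) by (metis gr0_implies_Suc)
  have Bn: "0 \<le> B (real u)" if "u < N" for u
  proof -
    have "0 \<le> real N - 1 - real u" using that by linarith
    thus ?thesis unfolding B_def by simp
  qed
  have Cn: "0 \<le> C (real u)" for u unfolding C_def by simp
  have 1: "sqrt (w u) * B (real u) = sqrt (B (real u) * C (real (Suc u))) * sqrt (w (Suc u))" if "Suc u < N" for u
  proof -
    have "sqrt (B (real u) * C (real (Suc u))) * sqrt (w (Suc u)) = sqrt (B (real u) * (w (Suc u) * C (real (Suc u))))"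
      by (simp add: real_sqrt_mult mult_ac)
    also have "\<dots> = sqrt (w u * (B (real u))\<^sup>2)" unfolding w_ratio[OF that, symmetric] by (simp add: power2_eq_square mult_ac)
    also have "\<dots> = sqrt (w u) * B (real u)" using Bn[of u] that by (simp add: real_sqrt_mult)
    finally show ?thesis by simp
  qed
  have 2: "sqrt (w (Suc u)) * C (real (Suc u)) = sqrt (B (real u) * C (real (Suc u))) * sqrt (w u)" if "Suc u < N" for u
  proof -
    have "sqrt (B (real u) * C (real (Suc u))) * sqrt (w u) = sqrt ((w u * B (real u)) * C (real (Suc u)))"
      by (simp add: real_sqrt_mult mult_ac)
    also have "\<dots> = sqrt (w (Suc u) * (C (real (Suc u)))\<^sup>2)" unfolding w_ratio[OF that] by (simp add: power2_eq_square mult_ac)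
    also have "\<dots> = sqrt (w (Suc u)) * C (real (Suc u))" using Cn[of "Suc u"] by (simp add: real_sqrt_mult)
    finally show ?thesis by simp
  qed
  have e: "eigval k * eig_poly k (real y) = (B (real y) + C (real y)) * eig_poly k (real y) - B (real y) * eig_poly k (real (Suc y)) - C (real y) * eig_poly k (real z)"
    using L_ppi[OF k, of "real y"] unfolding L_def z by (simp add: add.commute)
  let ?s = "(-1) ^ y / eig_norm k"
  have "eigval k * phi k y = ?s * sqrt (w y) * (eigval k * eig_poly k (real y))" by (simp add: phi_def)
  also have "\<dots> = (B (real y) + C (real y)) * (?s * sqrt (w y) * eig_poly k (real y)) - ?s * (sqrt (w y) * B (real y)) * eig_poly k (real (Suc y))
      - ?s * (sqrt (w y) * C (real y)) * eig_poly k (real z)"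
    unfolding e by (simp add: algebra_simps add_divide_distrib diff_divide_distrib)
  also have "?s * sqrt (w y) * eig_poly k (real y) = phi k y" by (simp add: phi_def)
  also have "?s * (sqrt (w y) * B (real y)) * eig_poly k (real (Suc y)) = - (sqrt (B (real y) * C (real (Suc y))) * phi k (Suc y))"
    unfolding 1[OF y(2)] by (simp add: phi_def)
  also have "?s * (sqrt (w y) * C (real y)) * eig_poly k (real z) = - (sqrt (B (real z) * C (real y)) * phi k z)"
    unfolding z using 2[of z] y(2) z by (simp add: phi_def)
  finally show ?thesis unfolding z by simp
qed

text \<open>The eigenfunctions come from the falling factorials by a triangular change of basis that
  does not depend on the points; the factors depending on the site are pulled out of the
  columns.\<close>

lemma fdet_phi:
  "\<exists>A. \<forall>y. fdet c (\<lambda>k j. phi k (y j)) = A * (\<Prod>j<c. (-1) ^ y j * sqrt (w (y j))) * fdet c (\<lambda>k j. ffact k (real (y j)))"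
proof -
  define M where "M k l = (if l \<le> k then eig_coeff k l / eig_norm k else 0)" for k l
  have "fdet c (\<lambda>k j. phi k (y j)) = fdet c M * (\<Prod>j<c. (-1) ^ y j * sqrt (w (y j))) * fdet c (\<lambda>k j. ffact k (real (y j)))" for y
  proof -
    have "fdet c (\<lambda>k j. phi k (y j)) = fdet c (\<lambda>k j. ((-1) ^ y j * sqrt (w (y j))) * (\<Sum>l<c. M k l * ffact l (real (y j))))"
    proof (rule fdet_cong)
      fix k j assume "k < c" "j < c"
      have "(\<Sum>l<c. M k l * ffact l (real (y j))) = (\<Sum>l\<le>k. M k l * ffact l (real (y j)))"
        by (rule sum.mono_neutral_right) (use \<open>k < c\<close> in \<open>auto simp: M_def\<close>)
      also have "\<dots> = eig_poly k (real (y j)) / eig_norm k"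
        unfolding eig_poly_def sum_divide_distrib by (intro sum.cong) (auto simp: M_def)
      finally show "phi k (y j) = ((-1) ^ y j * sqrt (w (y j))) * (\<Sum>l<c. M k l * ffact l (real (y j)))" by (simp add: phi_def)
    qed
    also have "\<dots> = (\<Prod>j<c. (-1) ^ y j * sqrt (w (y j))) * (fdet c M * fdet c (\<lambda>k j. ffact k (real (y j))))"
      unfolding fdet_scale_cols fdet_mult ..
    finally show ?thesis by simp
  qed
  thus ?thesis by blast
qed

end

section \<open>Local limit of the projection kernel\<close>

lemma integral_cos_int:
  fixes k :: int and a b :: real
  assumes "a \<le> b"
  shows "((\<lambda>t. cos (of_int k * t)) has_integral
    (if k = 0 then b - a else (sin (of_int k * b) - sin (of_int k * a)) / of_int k)) {a..b}"
proof (cases "k = 0")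
  case True
  thus ?thesis using has_integral_const_real[where c = "1::real" and a = a and b = b] assms by simp
next
  case False
  have "((\<lambda>t. cos (of_int k * t)) has_integral (sin (of_int k * b) / of_int k - sin (of_int k * a) / of_int k)) {a..b}"
  proof (rule fundamental_theorem_of_calculus[OF assms])
    fix t assume "t \<in> {a..b}"
    have "((\<lambda>t. sin (of_int k * t) / of_int k) has_real_derivative cos (of_int k * t)) (at t within {a..b})"
      using False by (auto intro!: derivative_eq_intros)
    thus "((\<lambda>t. sin (of_int k * t) / of_int k) has_vector_derivative cos (of_int k * t)) (at t within {a..b})"
      by (simp add: has_real_derivative_iff_has_vector_derivative)
  qed
  thus ?thesis using False by (simp add: diff_divide_distrib)
qed

text \<open>A general filter along which \<open>n\<close> grows lets the limit run through the
  admissible scales only, where all sizes are exact multiples of \<open>n\<close>.\<close>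

locale hahn_limit =
  fixes F :: "nat filter" and Nf pf qf cf yf :: "nat \<Rightarrow> nat" and \<nu> p' q' \<gamma> x :: real
  assumes inv0: "((\<lambda>n. 1 / real n) \<longlongrightarrow> 0) F"
    and scale: "\<forall>\<^sub>F n in F. 0 < n \<and> real (Nf n) = real n * \<nu> \<and> real (pf n) = real n * p' \<and> real (qf n) = real n * q' \<and>
       real (cf n) = real n * \<gamma> \<and> real (yf n) = real n * x"
    and params: "0 < x" "x < \<nu>" "0 \<le> p'" "0 \<le> q'" "0 \<le> \<gamma>" "\<gamma> \<le> \<nu>"
begin

definition P :: "nat \<Rightarrow> nat \<Rightarrow> int \<Rightarrow> real" where
  "P n k i = hahn.phi (Nf n) (pf n) (qf n) k (nat (int (yf n) + i))"
definition eigval_sc :: "nat \<Rightarrow> nat \<Rightarrow> real" where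
  "eigval_sc n k = hahn.eigval (Nf n) (pf n) (qf n) k / (real n)\<^sup>2"

text \<open>\<open>d\<close>, \<open>offd\<close> and \<open>thr\<close> are the limits of
  \<open>B + C\<close> and of the off-diagonal entry at the site \<open>n x\<close>, and of
  \<open>eigval\<close> at the index \<open>cf n\<close>, each divided by the square of
  \<open>n\<close>.\<close>

definition d :: real where "d = (\<nu> - x) * (\<nu> - x + q') + x * (x + p')"
definition offd :: real where "offd = sqrt ((\<nu> - x) * (\<nu> - x + q') * (x * (x + p')))"
definition symbol :: "real \<Rightarrow> real" where "symbol \<theta> = d + 2 * offd * cos \<theta>"
definition thr :: real where "thr = \<gamma> * (2 * \<nu> + p' + q' - \<gamma>)"

text \<open>Entry (i, j) of the function \<open>g\<close> of the rescaled Jacobi matrix, in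
  positions relative to \<open>yf n\<close>. The candidate limit \<open>spec_int\<close> is a
  Fourier coefficient of \<open>g\<close> composed with the symbol, that is, an entry of a Toeplitz
  matrix.\<close>

definition spec_sum :: "(real \<Rightarrow> real) \<Rightarrow> int \<Rightarrow> int \<Rightarrow> nat \<Rightarrow> real" where
  "spec_sum g i j n = (\<Sum>k<Nf n. g (eigval_sc n k) * (P n k i * P n k j))"
definition spec_int :: "(real \<Rightarrow> real) \<Rightarrow> int \<Rightarrow> real" where
  "spec_int g k = 1 / pi * integral {0..pi} (\<lambda>\<theta>. g (symbol \<theta>) * cos (of_int k * \<theta>))"

lemma offd_pos: "0 < offd" unfolding offd_def using params by (intro real_sqrt_gt_zero mult_pos_pos) auto

lemma lim_shift: "((\<lambda>n. a + b / real n) \<longlongrightarrow> a) F"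
proof -
  have "((\<lambda>n. a + b * (1 / real n)) \<longlongrightarrow> a + b * 0) F" by (intro tendsto_intros inv0)
  thus ?thesis by simp
qed

lemma ev_large: "0 < a \<Longrightarrow> \<forall>\<^sub>F n in F. b < real n * a"
proof -
  assume a: "0 < a"
  have "\<forall>\<^sub>F n in F. 0 < a + (- b) / real n" by (rule order_tendstoD(1)[OF lim_shift a])
  moreover have "\<forall>\<^sub>F n in F. 0 < n" using scale by eventually_elim simp
  ultimately show ?thesis by eventually_elim (simp add: field_simps)
qed

lemma ev_interior: "\<forall>\<^sub>F n in F. 0 < int (yf n) + i \<and> int (yf n) + i + 1 < int (Nf n)"
proof -
  have "\<forall>\<^sub>F n in F. - of_int i < real n * x" by (rule ev_large[OF params(1)])
  moreover have "\<forall>\<^sub>F n in F. of_int i + 1 < real n * (\<nu> - x)" by (rule ev_large) (use params in simp)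
  ultimately show ?thesis using scale
  proof eventually_elim
    case (elim n)
    have "(0::real) < of_int (int (yf n) + i)" using elim by simp
    moreover have "real_of_int (int (yf n) + i + 1) < real_of_int (int (Nf n))" using elim by (simp add: algebra_simps)
    ultimately show ?case by (simp only: of_int_0_less_iff of_int_less_iff)
  qed
qed

lemma ev_complete: "\<forall>\<^sub>F n in F. (\<Sum>k<Nf n. P n k i * P n k j) = (if i = j then 1 else 0)"
  using ev_interior[of i] ev_interior[of j]
proof eventually_elim
  case (elim n)
  interpret hahn "Nf n" "pf n" "qf n" by unfold_locales (use elim in linarith)
  have "nat (int (yf n) + i) < Nf n" "nat (int (yf n) + j) < Nf n" using elim by linarith+
  from phi_complete[OF this] show ?case unfolding P_def using elim by (auto simp: eq_nat_nat_iff)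
qed

text \<open>The exact matrix entries at the site \<open>yf n + i\<close>, divided by the square of
  \<open>n\<close>; the shift by -1 stems from the term \<open>N - 1 - y\<close> in
  \<open>B\<close>.\<close>

definition diag_n :: "int \<Rightarrow> nat \<Rightarrow> real" where
  "diag_n i n = (\<nu> - x + (- 1 - of_int i) / real n) * (\<nu> - x + q' + (- 1 - of_int i) / real n) +
            (x + of_int i / real n) * (x + p' + of_int i / real n)"
definition offd_n :: "int \<Rightarrow> nat \<Rightarrow> real" where
  "offd_n i n = sqrt ((\<nu> - x + (- 1 - of_int i) / real n) * (\<nu> - x + q' + (- 1 - of_int i) / real n) *
            ((x + of_int (i + 1) / real n) * (x + p' + of_int (i + 1) / real n)))"

lemma diag_n_lim: "(diag_n i \<longlongrightarrow> d) F" and offd_n_lim: "(offd_n i \<longlongrightarrow> offd) F"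
  unfolding diag_n_def offd_n_def d_def offd_def by (intro tendsto_intros lim_shift)+

text \<open>A factor \<open>s\<close> in front of \<open>g\<close> is one more application of the
  tridiagonal matrix in the first index. It reaches only the adjacent sites, so the entries near
  \<open>yf n\<close> suffice.\<close>

lemma spec_sum_rec: "\<forall>\<^sub>F n in F. spec_sum (\<lambda>s. s * g s) i j n =
    diag_n i n * spec_sum g i j n + offd_n i n * spec_sum g (i + 1) j n + offd_n (i - 1) n * spec_sum g (i - 1) j n"
  using ev_interior[of i] scale
proof eventually_elim
  case (elim n)
  interpret hahn "Nf n" "pf n" "qf n" by unfold_locales (use elim in linarith)
  define y where "y = nat (int (yf n) + i)"
  have y: "0 < y" "Suc y < Nf n" "real y = real n * x + of_int i" "nat (int (yf n) + (i + 1)) = Suc y" "nat (int (yf n) + (i - 1)) = y - 1"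
    using elim by (auto simp: y_def)
  have n: "0 < real n" and N: "real (Nf n) = real n * \<nu>" and p: "real (pf n) = real n * p'" and q: "real (qf n) = real n * q'" using elim by auto
  have Bs: "B (real n * x + t) = (real n)\<^sup>2 * ((\<nu> - x + (- 1 - t) / real n) * (\<nu> - x + q' + (- 1 - t) / real n))" for t
    unfolding B_def N q using n by (simp add: field_simps power2_eq_square)
  have Cs: "C (real n * x + t) = (real n)\<^sup>2 * ((x + t / real n) * (x + p' + t / real n))" for t
    unfolding C_def p using n by (simp add: field_simps power2_eq_square)
  have BC: "B (real y) + C (real y) = (real n)\<^sup>2 * diag_n i n" unfolding y(3) Bs Cs diag_n_def by (simp add: algebra_simps)
  have o: "sqrt (B (real n * x + t) * C (real n * x + (t + 1))) = (real n)\<^sup>2 * sqrt ((\<nu> - x + (- 1 - t) / real n) * (\<nu> - x + q' + (- 1 - t) / real n) *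
            ((x + (t + 1) / real n) * (x + p' + (t + 1) / real n)))" for t
  proof -
    let ?u = "(\<nu> - x + (- 1 - t) / real n) * (\<nu> - x + q' + (- 1 - t) / real n)"
    let ?v = "(x + (t + 1) / real n) * (x + p' + (t + 1) / real n)"
    have e: "B (real n * x + t) * C (real n * x + (t + 1)) = ((real n)\<^sup>2)\<^sup>2 * (?u * ?v)"
      unfolding Bs Cs by (simp only: power2_eq_square mult_ac)
    have s: "sqrt (((real n)\<^sup>2)\<^sup>2) = (real n)\<^sup>2" unfolding real_sqrt_abs by simp
    show ?thesis unfolding e real_sqrt_mult[of "((real n)\<^sup>2)\<^sup>2" "?u * ?v"] s ..
  qed
  have s1: "real (Suc y) = real n * x + (of_int i + 1)" using y(3) by simp
  have s2: "real (y - 1) = real n * x + of_int (i - 1)" using y(1,3) by (simp add: of_nat_diff)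
  have o1: "sqrt (B (real y) * C (real (Suc y))) = (real n)\<^sup>2 * offd_n i n"
    unfolding s1 y(3) o offd_n_def by simp
  have o2: "sqrt (B (real (y - 1)) * C (real y)) = (real n)\<^sup>2 * offd_n (i - 1) n"
  proof -
    have "real y = real n * x + (of_int (i - 1) + 1)" using y(3) by simp
    thus ?thesis unfolding s2 using o[of "of_int (i - 1)"] by (simp add: offd_n_def)
  qed
  have "eigval_sc n k * (P n k i * P n k j) = diag_n i n * (P n k i * P n k j) + offd_n i n * (P n k (i + 1) * P n k j) + offd_n (i - 1) n * (P n k (i - 1) * P n k j)"
    if k: "k < Nf n" for k
  proof -
    have "eigval k * P n k i = (real n)\<^sup>2 * (diag_n i n * P n k i + offd_n i n * P n k (i + 1) + offd_n (i - 1) n * P n k (i - 1))"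
      using phi_recurrence[OF k y(1,2)] unfolding BC o1 o2 P_def y(4,5) y_def[symmetric] by (simp add: algebra_simps)
    hence "eigval_sc n k * P n k i = diag_n i n * P n k i + offd_n i n * P n k (i + 1) + offd_n (i - 1) n * P n k (i - 1)"
      unfolding eigval_sc_def using n by (simp add: field_simps)
    hence "eigval_sc n k * P n k i * P n k j = (diag_n i n * P n k i + offd_n i n * P n k (i + 1) + offd_n (i - 1) n * P n k (i - 1)) * P n k j" by simp
    thus ?thesis by (simp add: algebra_simps)
  qed
  hence "spec_sum (\<lambda>s. s * g s) i j n = (\<Sum>k<Nf n. g (eigval_sc n k) * (diag_n i n * (P n k i * P n k j) + offd_n i n * (P n k (i + 1) * P n k j) + offd_n (i - 1) n * (P n k (i - 1) * P n k j)))"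
    unfolding spec_sum_def by (intro sum.cong refl) (simp add: mult_ac)
  also have "\<dots> = diag_n i n * spec_sum g i j n + offd_n i n * spec_sum g (i + 1) j n + offd_n (i - 1) n * spec_sum g (i - 1) j n"
    unfolding spec_sum_def sum_distrib_left sum.distrib[symmetric] by (intro sum.cong refl) (simp add: algebra_simps)
  finally show ?case .
qed

lemma cont_J: "continuous_on UNIV g \<Longrightarrow> continuous_on {0..pi} (\<lambda>\<theta>. g (symbol \<theta>) * cos (of_int k * \<theta>))"
proof -
  assume g: "continuous_on UNIV g"
  have "continuous_on {0..pi} symbol" unfolding symbol_def[abs_def] by (intro continuous_intros)
  hence "continuous_on {0..pi} (\<lambda>\<theta>. g (symbol \<theta>))" by (rule continuous_on_compose2[OF g]) simp
  thus ?thesis by (rule continuous_on_mult) (intro continuous_intros)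
qed

lemma spec_int_int: "continuous_on UNIV g \<Longrightarrow> (\<lambda>\<theta>. g (symbol \<theta>) * cos (of_int k * \<theta>)) integrable_on {0..pi}"
  by (rule integrable_continuous_interval[OF cont_J])

text \<open>The same recursion with constant coefficients, since twice the product of cos t and cos
  kt is the sum of cos (k + 1)t and cos (k - 1)t.\<close>

lemma spec_int_rec:
  assumes g: "continuous_on UNIV g"
  shows "spec_int (\<lambda>s. s * g s) k = d * spec_int g k + offd * spec_int g (k + 1) + offd * spec_int g (k - 1)"
proof -
  have "(\<lambda>\<theta>. symbol \<theta> * g (symbol \<theta>) * cos (of_int k * \<theta>)) =
     (\<lambda>\<theta>. d * (g (symbol \<theta>) * cos (of_int k * \<theta>)) + offd * (g (symbol \<theta>) * cos (of_int (k + 1) * \<theta>)) + offd * (g (symbol \<theta>) * cos (of_int (k - 1) * \<theta>)))"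
  proof
    fix \<theta> :: real
    have e: "of_int (k + 1) * \<theta> = of_int k * \<theta> + \<theta>" "of_int (k - 1) * \<theta> = of_int k * \<theta> - \<theta>"
      by (simp_all add: algebra_simps)
    have "cos (of_int (k + 1) * \<theta>) + cos (of_int (k - 1) * \<theta>) = 2 * cos \<theta> * cos (of_int k * \<theta>)"
      unfolding e cos_add cos_diff by simp
    hence "offd * (g (symbol \<theta>) * cos (of_int (k + 1) * \<theta>)) + offd * (g (symbol \<theta>) * cos (of_int (k - 1) * \<theta>)) = offd * g (symbol \<theta>) * (2 * cos \<theta> * cos (of_int k * \<theta>))"
      by (simp add: distrib_left[symmetric] mult.assoc)
    thus "symbol \<theta> * g (symbol \<theta>) * cos (of_int k * \<theta>) =
      d * (g (symbol \<theta>) * cos (of_int k * \<theta>)) + offd * (g (symbol \<theta>) * cos (of_int (k + 1) * \<theta>)) + offd * (g (symbol \<theta>) * cos (of_int (k - 1) * \<theta>))"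
      by (simp add: symbol_def algebra_simps)
  qed
  moreover define u where "u k \<theta> = g (symbol \<theta>) * cos (of_int k * \<theta>)" for k \<theta>
  moreover have i: "u k integrable_on {0..pi}" for k using spec_int_int[OF g] unfolding u_def[abs_def] .
  have "integral {0..pi} (\<lambda>\<theta>. d * u k \<theta> + offd * u (k + 1) \<theta> + offd * u (k - 1) \<theta>) =
     d * integral {0..pi} (u k) + offd * integral {0..pi} (u (k + 1)) + offd * integral {0..pi} (u (k - 1))"
    by (simp add: integral_add integrable_add integrable_on_mult_right i)
  ultimately show ?thesis unfolding spec_int_def u_def[symmetric] by (simp add: distrib_left mult_ac flip: u_def)
qed

text \<open>Both sides satisfy a three-term recursion, and the coefficients converge. The induction
  keeps \<open>i\<close> free because it moves to neighbouring sites; its start is the completeness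
  of the eigenfunctions.\<close>

lemma spec_sum_power: "(spec_sum (\<lambda>s. s ^ r) i j \<longlongrightarrow> spec_int (\<lambda>s. s ^ r) (i - j)) F"
proof (induction r arbitrary: i)
  case 0
  have "spec_int (\<lambda>s. s ^ 0) (i - j) = (if i = j then 1 else 0)"
  proof -
    have "integral {0..pi} (\<lambda>t. cos (of_int k * t)) = (if k = 0 then pi else 0)" for k :: int
      using integral_unique[OF integral_cos_int[of 0 pi k]] sin_times_pi_eq_0[of "of_int k"] by auto
    from this[of "i - j"] show ?thesis by (simp add: spec_int_def del: of_int_diff)
  qed
  moreover have "\<forall>\<^sub>F n in F. (if i = j then 1 else 0) = spec_sum (\<lambda>s. s ^ 0) i j n"
    using ev_complete[of i j] unfolding spec_sum_def by eventually_elim simp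
  ultimately show ?case by (simp add: tendsto_eventually eventually_mono)
next
  case (Suc r)
  have "((\<lambda>n. diag_n i n * spec_sum (\<lambda>s. s ^ r) i j n + offd_n i n * spec_sum (\<lambda>s. s ^ r) (i + 1) j n + offd_n (i - 1) n * spec_sum (\<lambda>s. s ^ r) (i - 1) j n)
     \<longlongrightarrow> d * spec_int (\<lambda>s. s ^ r) (i - j) + offd * spec_int (\<lambda>s. s ^ r) (i + 1 - j) + offd * spec_int (\<lambda>s. s ^ r) (i - 1 - j)) F"
    by (intro tendsto_intros diag_n_lim offd_n_lim Suc.IH)
  moreover have "i + 1 - j = i - j + 1" "i - 1 - j = i - j - 1" by auto
  ultimately have "((\<lambda>n. diag_n i n * spec_sum (\<lambda>s. s ^ r) i j n + offd_n i n * spec_sum (\<lambda>s. s ^ r) (i + 1) j n + offd_n (i - 1) n * spec_sum (\<lambda>s. s ^ r) (i - 1) j n)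
     \<longlongrightarrow> spec_int (\<lambda>s. s * s ^ r) (i - j)) F"
    by (simp only: spec_int_rec[OF continuous_on_power[OF continuous_on_id]])
  moreover have "\<forall>\<^sub>F n in F. diag_n i n * spec_sum (\<lambda>s. s ^ r) i j n + offd_n i n * spec_sum (\<lambda>s. s ^ r) (i + 1) j n + offd_n (i - 1) n * spec_sum (\<lambda>s. s ^ r) (i - 1) j n = spec_sum (\<lambda>s. s * s ^ r) i j n"
    using spec_sum_rec[of "\<lambda>s. s ^ r" i j] by eventually_elim simp
  ultimately show ?case unfolding power_Suc by (rule Lim_transform_eventually)
qed

lemma spec_sum_poly: "(spec_sum (\<lambda>s. \<Sum>r\<le>m. a r * s ^ r) i j \<longlongrightarrow> spec_int (\<lambda>s. \<Sum>r\<le>m. a r * s ^ r) (i - j)) F"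
proof -
  have "spec_sum (\<lambda>s. \<Sum>r\<le>m. a r * s ^ r) i j n = (\<Sum>r\<le>m. a r * spec_sum (\<lambda>s. s ^ r) i j n)" for n
    unfolding spec_sum_def sum_distrib_left sum_distrib_right by (subst sum.swap) (simp add: mult.assoc)
  moreover have "spec_int (\<lambda>s. \<Sum>r\<le>m. a r * s ^ r) k = (\<Sum>r\<le>m. a r * spec_int (\<lambda>s. s ^ r) k)" for k
  proof -
    have "(\<lambda>\<theta>. a r * (symbol \<theta> ^ r * cos (of_int k * \<theta>))) integrable_on {0..pi}" for r
      by (rule integrable_on_mult_right, rule spec_int_int[where g = "\<lambda>s. s ^ r"]) (intro continuous_intros)
    hence "integral {0..pi} (\<lambda>\<theta>. \<Sum>r\<le>m. a r * (symbol \<theta> ^ r * cos (of_int k * \<theta>))) = (\<Sum>r\<le>m. a r * integral {0..pi} (\<lambda>\<theta>. symbol \<theta> ^ r * cos (of_int k * \<theta>)))"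
      by (subst integral_sum) auto
    thus ?thesis unfolding spec_int_def sum_distrib_right sum_distrib_left by (simp add: mult_ac sum_distrib_left)
  qed
  ultimately have "spec_sum (\<lambda>s. \<Sum>r\<le>m. a r * s ^ r) i j = (\<lambda>n. \<Sum>r\<le>m. a r * spec_sum (\<lambda>s. s ^ r) i j n)"
    "spec_int (\<lambda>s. \<Sum>r\<le>m. a r * s ^ r) (i - j) = (\<Sum>r\<le>m. a r * spec_int (\<lambda>s. s ^ r) (i - j))" by auto
  thus ?thesis by (simp only:) (intro tendsto_sum tendsto_mult tendsto_const spec_sum_power)
qed

end

section \<open>From polynomials to continuous functions and to the sharp cut\<close>

context hahn_limit
begin

text \<open>A crude common bound for the rescaled eigenvalues (first summand) and for the symbol
  (the other two), so that one interval serves to approximate on both by polynomials.\<close>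

definition Rb :: real where "Rb = \<nu> * (2 * \<nu> + p' + q') + d + 2 * offd"

lemma d_pos: "0 < d"
proof -
  have "0 < (\<nu> - x) * (\<nu> - x + q')" "0 < x * (x + p')" using params by simp_all
  thus ?thesis unfolding d_def by simp
qed

lemma symbol_bound: "symbol \<theta> \<in> {- Rb..Rb}"
proof -
  have "\<bar>offd * cos \<theta>\<bar> \<le> offd * 1"
    unfolding abs_mult using offd_pos by (intro mult_mono) auto
  moreover have "0 \<le> \<nu> * (2 * \<nu> + p' + q')" using params by (intro mult_nonneg_nonneg) auto
  ultimately show ?thesis using d_pos unfolding symbol_def Rb_def atLeastAtMost_iff by (simp add: abs_le_iff)
qed

lemma eigval_sc_eq:
  assumes "0 < n" "real (Nf n) = real n * \<nu>" "real (pf n) = real n * p'" "real (qf n) = real n * q'" "k < Nf n"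
  shows "eigval_sc n k = (real k / real n) * (2 * \<nu> + p' + q' - (real k + 1) / real n)"
proof -
  interpret hahn "Nf n" "pf n" "qf n" by unfold_locales (use assms in simp)
  show ?thesis unfolding eigval_sc_def eigval_def assms(2-4) using assms(1) by (simp add: field_simps power2_eq_square)
qed

lemma eigval_sc_bound: "\<forall>\<^sub>F n in F. \<forall>k<Nf n. eigval_sc n k \<in> {- Rb..Rb}"
  using scale
proof eventually_elim
  case (elim n)
  show ?case
  proof (intro allI impI)
    fix k assume k: "k < Nf n"
    have n: "0 < real n" using elim by simp
    have "real k + 1 \<le> real n * \<nu>" using k elim by linarith
    hence k1: "(real k + 1) / real n \<le> \<nu>" "real k / real n \<le> \<nu>" using n by (auto simp: field_simps)
    have e: "eigval_sc n k = (real k / real n) * (2 * \<nu> + p' + q' - (real k + 1) / real n)" using eigval_sc_eq k elim by blast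
    have "0 \<le> eigval_sc n k" unfolding e using k1 params by (intro mult_nonneg_nonneg) auto
    moreover have "eigval_sc n k \<le> \<nu> * (2 * \<nu> + p' + q')" unfolding e
      using k1 params n by (intro mult_mono) auto
    moreover have "0 \<le> Rb" using symbol_bound[of 0] by auto
    ultimately show "eigval_sc n k \<in> {- Rb..Rb}" unfolding Rb_def using d_pos offd_pos by auto
  qed
qed

lemma abs_mult_le_squares: "\<bar>u * v\<bar> \<le> (u * u + v * v) / 2" for u v :: real
proof -
  have "0 \<le> (\<bar>u\<bar> - \<bar>v\<bar>)\<^sup>2" by simp
  thus ?thesis by (simp add: power2_eq_square algebra_simps abs_mult)
qed

text \<open>The products have either sign. Completeness at \<open>i\<close> and at \<open>j\<close>
  bounds their total variation uniformly in \<open>n\<close>, which turns uniform approximation of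
  \<open>g\<close> into an error independent of \<open>n\<close>.\<close>

lemma ev_abs_sum: "\<forall>\<^sub>F n in F. (\<Sum>k<Nf n. \<bar>P n k i * P n k j\<bar>) \<le> 1"
  using ev_complete[of i i] ev_complete[of j j]
proof eventually_elim
  case (elim n)
  have "(\<Sum>k<Nf n. \<bar>P n k i * P n k j\<bar>) \<le> (\<Sum>k<Nf n. (P n k i * P n k i + P n k j * P n k j) / 2)"
    by (intro sum_mono abs_mult_le_squares)
  also have "\<dots> = 1" using elim by (simp add: sum_divide_distrib[symmetric] sum.distrib)
  finally show ?case .
qed

lemma spec_sum_tendsto:
  assumes g: "continuous_on UNIV g"
  shows "(spec_sum g i j \<longlongrightarrow> spec_int g (i - j)) F"
proof (rule tendstoI)
  fix e :: real assume e: "0 < e"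
  obtain f where f: "real_polynomial_function f" "\<And>s. s \<in> {- Rb..Rb} \<Longrightarrow> \<bar>g s - f s\<bar> < e / 3"
    using Stone_Weierstrass_real_polynomial_function[of "{- Rb..Rb}" g "e / 3"] e continuous_on_subset[OF g] by auto
  obtain a m where am: "f = (\<lambda>s. \<Sum>r\<le>m. a r * s ^ r)" using f(1) unfolding real_polynomial_function_iff_sum by blast
  have fc: "continuous_on UNIV f" unfolding am by (intro continuous_intros)
  have "\<forall>\<^sub>F n in F. dist (spec_sum f i j n) (spec_int f (i - j)) < e / 3"
    using spec_sum_poly[of a m i j] e unfolding am[symmetric] by (intro tendstoD) auto
  moreover have "\<forall>\<^sub>F n in F. \<bar>spec_sum g i j n - spec_sum f i j n\<bar> \<le> e / 3"
    using eigval_sc_bound ev_abs_sum[of i j]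
  proof eventually_elim
    case (elim n)
    have e1: "spec_sum g i j n - spec_sum f i j n = (\<Sum>k<Nf n. (g (eigval_sc n k) - f (eigval_sc n k)) * (P n k i * P n k j))"
      unfolding spec_sum_def sum_subtractf[symmetric] by (simp add: algebra_simps)
    have "\<bar>spec_sum g i j n - spec_sum f i j n\<bar> \<le> (\<Sum>k<Nf n. \<bar>(g (eigval_sc n k) - f (eigval_sc n k)) * (P n k i * P n k j)\<bar>)"
      unfolding e1 by (rule sum_abs)
    also have "\<dots> \<le> (\<Sum>k<Nf n. e / 3 * \<bar>P n k i * P n k j\<bar>)"
    proof (rule sum_mono)
      fix k assume "k \<in> {..<Nf n}"
      hence kn: "k < Nf n" by simp
      have "eigval_sc n k \<in> {- Rb..Rb}" by (rule elim(1)[rule_format, OF kn])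
      hence "\<bar>g (eigval_sc n k) - f (eigval_sc n k)\<bar> \<le> e / 3" using f(2)[of "eigval_sc n k"] by linarith
      thus "\<bar>(g (eigval_sc n k) - f (eigval_sc n k)) * (P n k i * P n k j)\<bar> \<le> e / 3 * \<bar>P n k i * P n k j\<bar>"
        unfolding abs_mult[of "g (eigval_sc n k) - f (eigval_sc n k)"] by (rule mult_right_mono) simp
    qed
    also have "\<dots> = e / 3 * (\<Sum>k<Nf n. \<bar>P n k i * P n k j\<bar>)" by (rule sum_distrib_left[symmetric])
    also have "\<dots> \<le> e / 3 * 1" using elim e by (intro mult_left_mono) auto
    finally show ?case by simp
  qed
  ultimately have ev: "\<forall>\<^sub>F n in F. dist (spec_sum f i j n) (spec_int f (i - j)) < e / 3 \<and> \<bar>spec_sum g i j n - spec_sum f i j n\<bar> \<le> e / 3"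
    by (rule eventually_conj)
  have j: "\<bar>spec_int g (i - j) - spec_int f (i - j)\<bar> \<le> e / 3"
  proof -
    let ?h = "\<lambda>h \<theta>. h (symbol \<theta>) * cos (of_int (i - j) * \<theta>)"
    have e1: "integral {0..pi} (?h g) - integral {0..pi} (?h f) = integral {0..pi} (\<lambda>\<theta>. ?h g \<theta> - ?h f \<theta>)"
      by (rule integral_diff[symmetric]) (intro spec_int_int g fc)+
    have "norm (integral {0..pi} (\<lambda>\<theta>. ?h g \<theta> - ?h f \<theta>)) \<le> e / 3 * (pi - 0)"
    proof (rule integral_bound)
      show "continuous_on {0..pi} (\<lambda>\<theta>. ?h g \<theta> - ?h f \<theta>)" by (intro continuous_on_diff cont_J g fc)
      fix \<theta> assume "\<theta> \<in> {0..pi}"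
      have "norm (?h g \<theta> - ?h f \<theta>) = \<bar>g (symbol \<theta>) - f (symbol \<theta>)\<bar> * \<bar>cos (of_int (i - j) * \<theta>)\<bar>"
        by (simp add: abs_mult[symmetric] algebra_simps)
      also have "\<dots> \<le> e / 3 * 1" using f(2)[OF symbol_bound[of \<theta>]] e by (intro mult_mono) auto
      finally show "norm (?h g \<theta> - ?h f \<theta>) \<le> e / 3" by simp
    qed simp
    hence d1: "\<bar>integral {0..pi} (?h g) - integral {0..pi} (?h f)\<bar> \<le> e / 3 * pi" unfolding e1 by simp
    have d2: "spec_int g (i - j) - spec_int f (i - j) = (integral {0..pi} (?h g) - integral {0..pi} (?h f)) / pi"
      unfolding spec_int_def by (simp add: diff_divide_distrib)
    have "\<bar>t / pi\<bar> \<le> e / 3" if "\<bar>t\<bar> \<le> e / 3 * pi" for t using that by (simp add: abs_divide pos_divide_le_eq)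
    from this[OF d1] show ?thesis unfolding d2 .
  qed
  from ev show "\<forall>\<^sub>F n in F. dist (spec_sum g i j n) (spec_int g (i - j)) < e"
  proof eventually_elim
    case (elim n)
    thus ?case using j unfolding dist_real_def by linarith
  qed
qed

text \<open>The distance of the ramp from the indicator of the half line below thr is at most the bump,
  which shrinks to a point as \<open>\<epsilon>\<close> tends to 0.\<close>

definition ramp :: "real \<Rightarrow> real \<Rightarrow> real" where "ramp \<epsilon> s = max 0 (min 1 ((thr - s) / \<epsilon>))"
definition bump :: "real \<Rightarrow> real \<Rightarrow> real" where "bump \<epsilon> s = max 0 (2 - \<bar>s - thr\<bar> / \<epsilon>)"

lemma ramp_cont: "continuous_on UNIV (ramp \<epsilon>)" and bump_cont: "continuous_on UNIV (bump \<epsilon>)"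
  unfolding ramp_def bump_def divide_inverse by (intro continuous_intros)+

lemma bump_nonneg: "0 \<le> bump \<epsilon> s" by (simp add: bump_def)

text \<open>The bump is at least 1 within distance \<open>\<epsilon>\<close> of \<open>thr\<close>,
  which covers the transition of the ramp. The slack \<open>thr - \<epsilon> \<le> s\<close> for
  \<open>u = 0\<close> is there because the eigenvalue at index \<open>cf n\<close> may lie slightly
  below \<open>thr\<close>.\<close>

lemma ramp_bump:
  assumes "0 < \<epsilon>" "u = 1 \<and> s < thr \<or> u = 0 \<and> thr - \<epsilon> \<le> s"
  shows "\<bar>u - ramp \<epsilon> s\<bar> \<le> bump \<epsilon> s"
proof -
  have r: "0 \<le> ramp \<epsilon> s" "ramp \<epsilon> s \<le> 1" by (auto simp: ramp_def)
  consider "s \<le> thr - \<epsilon>" "u = 1" | "thr \<le> s" "u = 0" | "thr - \<epsilon> \<le> s" "s \<le> thr" "u = 0 \<or> u = 1" using assms by linarith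
  thus ?thesis
  proof cases
    case 1
    hence "1 \<le> (thr - s) / \<epsilon>" using assms(1) by (simp add: field_simps)
    hence "ramp \<epsilon> s = 1" by (simp add: ramp_def)
    thus ?thesis using 1 bump_nonneg by simp
  next
    case 2
    hence "(thr - s) / \<epsilon> \<le> 0" using assms(1) by (simp add: field_simps)
    hence "ramp \<epsilon> s = 0" by (simp add: ramp_def)
    thus ?thesis using 2 bump_nonneg by simp
  next
    case 3
    have "\<bar>s - thr\<bar> / \<epsilon> \<le> 1" using 3 assms(1) by (simp add: field_simps)
    hence "1 \<le> bump \<epsilon> s" unfolding bump_def by simp
    thus ?thesis using r 3(3) by auto
  qed
qed

text \<open>The cosine is injective on \<open>{0..pi}\<close> and \<open>offd\<close> is positive,
  so the symbol takes the value \<open>thr\<close> at no more than one angle. The pointwise limit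
  vanishes off a null set, and 2 is a dominating function.\<close>

lemma bump_integral: "(\<lambda>m. spec_int (bump (1 / real (Suc m))) 0) \<longlonglongrightarrow> 0"
proof -
  let ?f = "\<lambda>m \<theta>. bump (1 / real (Suc m)) (symbol \<theta>) * cos (of_int 0 * \<theta>)"
  let ?g = "\<lambda>\<theta>. if symbol \<theta> = thr then 2 else (0::real)"
  have "(\<lambda>m. integral {0..pi} (?f m)) \<longlonglongrightarrow> integral {0..pi} ?g"
  proof (rule dominated_convergence(2))
    show "?f m integrable_on {0..pi}" for m by (rule spec_int_int[OF bump_cont])
    show "(\<lambda>\<theta>. 2::real) integrable_on {0..pi}" by (rule integrable_const_ivl)
    show "norm (?f m \<theta>) \<le> 2" for m \<theta>
    proof -
      have "0 \<le> \<bar>symbol \<theta> - thr\<bar> / (1 / real (Suc m))" by (intro divide_nonneg_nonneg) auto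
      hence "bump (1 / real (Suc m)) (symbol \<theta>) \<le> 2" unfolding bump_def by linarith
      thus ?thesis using bump_nonneg[of "1 / real (Suc m)" "symbol \<theta>"] by simp
    qed
    fix \<theta>
    show "(\<lambda>m. ?f m \<theta>) \<longlonglongrightarrow> ?g \<theta>"
    proof (cases "symbol \<theta> = thr")
      case True
      thus ?thesis by (simp add: bump_def)
    next
      case False
      obtain M where M: "2 / \<bar>symbol \<theta> - thr\<bar> < real M" using reals_Archimedean2 by blast
      have "?f m \<theta> = 0" if "m \<ge> M" for m
      proof -
        have "2 / \<bar>symbol \<theta> - thr\<bar> < real (Suc m)" using M that by linarith
        hence "2 < \<bar>symbol \<theta> - thr\<bar> * real (Suc m)" using False by (simp add: field_simps)
        hence "2 - \<bar>symbol \<theta> - thr\<bar> / (1 / real (Suc m)) < 0" by simp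
        thus ?thesis unfolding bump_def by simp
      qed
      hence "\<forall>\<^sub>F m in sequentially. ?f m \<theta> = ?g \<theta>" using False by (auto simp: eventually_sequentially)
      thus ?thesis by (rule tendsto_eventually)
    qed
  qed
  moreover have "integral {0..pi} ?g = integral {0..pi} (\<lambda>_. 0)"
  proof (rule integral_spike)
    show "negligible {arccos ((thr - d) / (2 * offd))}" by simp
    fix \<theta> assume t: "\<theta> \<in> {0..pi} - {arccos ((thr - d) / (2 * offd))}"
    have "symbol \<theta> \<noteq> thr"
    proof
      assume "symbol \<theta> = thr"
      hence "cos \<theta> = (thr - d) / (2 * offd)" using offd_pos by (simp add: symbol_def field_simps)
      thus False using t arccos_cos[of \<theta>] by auto
    qed
    thus "0 = ?g \<theta>" by simp
  qed
  ultimately have "(\<lambda>m. 1 / pi * integral {0..pi} (?f m)) \<longlonglongrightarrow> 1 / pi * 0"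
    by (intro tendsto_mult tendsto_const) simp
  thus ?thesis unfolding spec_int_def by simp
qed

text \<open>The angle at which the symbol, decreasing on \<open>{0..pi}\<close>, crosses
  \<open>thr\<close>. Clamping keeps the argument of \<open>arccos\<close> in its domain; a
  threshold above or below the range of the symbol yields 0 or \<open>pi\<close>.\<close>

definition kappa :: real where "kappa = arccos (max (- 1) (min 1 ((thr - d) / (2 * offd))))"

lemma kappa_range: "0 \<le> kappa" "kappa \<le> pi"
  unfolding kappa_def by (auto intro: arccos_lbound arccos_ubound)

text \<open>The cosine is decreasing. The angle 0 is excluded: for a threshold above the range of
  the symbol the left side would hold there although \<open>kappa = 0\<close>.\<close>

lemma symbol_less_iff:
  assumes "0 < \<theta>" "\<theta> \<le> pi"
  shows "symbol \<theta> < thr \<longleftrightarrow> kappa < \<theta>"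
proof -
  define v where "v = (thr - d) / (2 * offd)"
  let ?u = "max (- 1) (min 1 v)"
  have "symbol \<theta> < thr \<longleftrightarrow> cos \<theta> < v" using offd_pos by (simp add: symbol_def v_def field_simps)
  also have "\<dots> \<longleftrightarrow> cos \<theta> < ?u"
  proof -
    have "cos \<theta> < 1" using cos_monotone_0_pi[of 0 \<theta>] assms by simp
    moreover have "- 1 \<le> cos \<theta>" by simp
    ultimately have "\<not> cos \<theta> < - 1" "v < - 1 \<Longrightarrow> \<not> cos \<theta> < v" "cos \<theta> < 1" by linarith+
    thus ?thesis by (cases "v < - 1"; cases "1 < v") (simp_all add: max_def min_def)
  qed
  also have "\<dots> \<longleftrightarrow> cos \<theta> < cos kappa" unfolding kappa_def v_def by (subst cos_arccos) auto
  also have "\<dots> \<longleftrightarrow> kappa < \<theta>" using assms kappa_range by (intro cos_mono_less_eq) auto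
  finally show ?thesis .
qed

text \<open>The limit of the particle kernel; its complement, the sine kernel, belongs to the
  holes.\<close>

definition hole_limit :: "int \<Rightarrow> real" where
  "hole_limit k = (if k = 0 then 1 else 0) - sine_kernel kappa k 0"

text \<open>The indicator is that of the angles above \<open>kappa\<close>. In its Fourier
  coefficient the boundary term at \<open>pi\<close> vanishes because \<open>k\<close> is an
  integer, which leaves the sine at \<open>kappa\<close> with a minus sign.\<close>

lemma hole_limit_integral:
  "((\<lambda>\<theta>. (if symbol \<theta> < thr then 1 else 0) * cos (of_int k * \<theta>)) has_integral pi * hole_limit k) {0..pi}"
proof -
  have "(if k = 0 then pi - kappa else (sin (of_int k * pi) - sin (of_int k * kappa)) / of_int k) = pi * hole_limit k"
    by (simp add: hole_limit_def sine_kernel_def sin_int_times_real mult.commute right_diff_distrib)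
  hence "((\<lambda>t. cos (of_int k * t)) has_integral pi * hole_limit k) {kappa..pi}"
    using integral_cos_int[OF kappa_range(2), of k] by simp
  hence "((\<lambda>t. if t \<in> {kappa..pi} then cos (of_int k * t) else 0) has_integral pi * hole_limit k) {0..pi}"
    by (subst has_integral_restrict) (use kappa_range in auto)
  thus ?thesis
  proof (rule has_integral_spike[rotated 2])
    show "negligible {0, kappa}" by simp
    fix \<theta> assume "\<theta> \<in> {0..pi} - {0, kappa}"
    thus "(if symbol \<theta> < thr then 1 else 0) * cos (of_int k * \<theta>) = (if \<theta> \<in> {kappa..pi} then cos (of_int k * \<theta>) else 0)"
      using symbol_less_iff[of \<theta>] by auto
  qed
qed

lemma spec_int_ramp_diff:
  assumes "0 < \<epsilon>"
  shows "\<bar>hole_limit k - spec_int (ramp \<epsilon>) k\<bar> \<le> spec_int (bump \<epsilon>) 0"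
proof -
  let ?i = "\<lambda>\<theta>. (if symbol \<theta> < thr then 1 else 0) * cos (of_int k * \<theta>)"
  let ?r = "\<lambda>\<theta>. ramp \<epsilon> (symbol \<theta>) * cos (of_int k * \<theta>)"
  let ?b = "\<lambda>\<theta>. bump \<epsilon> (symbol \<theta>) * cos (of_int 0 * \<theta>)"
  have 1: "?i integrable_on {0..pi}" using hole_limit_integral by blast
  have 2: "?r integrable_on {0..pi}" by (rule spec_int_int[OF ramp_cont])
  have le: "norm (integral {0..pi} (\<lambda>\<theta>. ?i \<theta> - ?r \<theta>)) \<le> integral {0..pi} ?b"
  proof (rule integral_norm_bound_integral)
    show "(\<lambda>\<theta>. ?i \<theta> - ?r \<theta>) integrable_on {0..pi}" by (rule integrable_diff[OF 1 2])
    show "?b integrable_on {0..pi}" by (rule spec_int_int[OF bump_cont])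
    fix \<theta>
    have "norm (?i \<theta> - ?r \<theta>) = \<bar>(if symbol \<theta> < thr then 1 else 0) - ramp \<epsilon> (symbol \<theta>)\<bar> * \<bar>cos (of_int k * \<theta>)\<bar>"
      by (simp add: abs_mult[symmetric] left_diff_distrib)
    also have "\<dots> \<le> bump \<epsilon> (symbol \<theta>) * 1"
      using assms bump_nonneg by (intro mult_mono ramp_bump) auto
    finally show "norm (?i \<theta> - ?r \<theta>) \<le> ?b \<theta>" by simp
  qed
  have "integral {0..pi} (\<lambda>\<theta>. ?i \<theta> - ?r \<theta>) = pi * hole_limit k - integral {0..pi} ?r"
    unfolding integral_diff[OF 1 2] integral_unique[OF hole_limit_integral] ..
  also have "\<dots> = pi * (hole_limit k - spec_int (ramp \<epsilon>) k)" unfolding spec_int_def by (simp add: right_diff_distrib)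
  finally have e1: "integral {0..pi} (\<lambda>\<theta>. ?i \<theta> - ?r \<theta>) = pi * (hole_limit k - spec_int (ramp \<epsilon>) k)" .
  have e2: "integral {0..pi} ?b = pi * spec_int (bump \<epsilon>) 0" unfolding spec_int_def by simp
  show ?thesis using le unfolding e1 e2 by (simp add: abs_mult)
qed

text \<open>The cut at index \<open>cf n\<close> is compared with the ramp. The error of the entry
  (i, j) is bounded by the mean of the diagonal entries of the bump at \<open>i\<close> and at
  \<open>j\<close>, and both tend to the same small number
  \<open>spec_int (bump \<epsilon>) 0\<close>.\<close>

theorem kernel_limit: "((\<lambda>n. \<Sum>k<cf n. P n k i * P n k j) \<longlongrightarrow> hole_limit (i - j)) F"
proof (rule tendstoI)
  fix e :: real assume e: "0 < e"
  obtain m where m: "spec_int (bump (1 / real (Suc m))) 0 < e / 4"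
    using order_tendstoD(2)[OF bump_integral, of "e / 4"] e by (auto simp: eventually_sequentially)
  define \<epsilon> where "\<epsilon> = 1 / real (Suc m)"
  have \<epsilon>: "0 < \<epsilon>" "spec_int (bump \<epsilon>) 0 < e / 4" using m by (auto simp: \<epsilon>_def)
  have cmp: "\<forall>\<^sub>F n in F. \<bar>(\<Sum>k<cf n. P n k i * P n k j) - spec_sum (ramp \<epsilon>) i j n\<bar> \<le> (spec_sum (bump \<epsilon>) i i n + spec_sum (bump \<epsilon>) j j n) / 2"
    using scale ev_large[OF \<epsilon>(1), of \<gamma>]
  proof eventually_elim
    case (elim n)
    have n: "0 < real n" using elim by simp
    have cN: "cf n \<le> Nf n"
    proof -
      have "real (cf n) \<le> real (Nf n)" using elim params by (simp add: mult_left_mono)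
      thus ?thesis by simp
    qed
    interpret hahn "Nf n" "pf n" "qf n"
    proof
      have "0 < real n * \<nu>" using n params by simp
      thus "0 < Nf n" using elim by linarith
    qed
    \<comment> \<open>The gap \<open>\<gamma> / real n\<close> comes from the summand -1 in
      \<open>eigval\<close>.\<close>
    have t: "eigval (cf n) / (real n)\<^sup>2 = thr - \<gamma> / real n"
      unfolding eigval_def thr_def using elim n by (simp add: field_simps power2_eq_square)
    have g: "\<gamma> / real n < \<epsilon>" using elim n by (simp add: field_simps)
    have u: "(if k < cf n then 1 else 0) = (1::real) \<and> eigval_sc n k < thr \<or> (if k < cf n then 1 else 0) = (0::real) \<and> thr - \<epsilon> \<le> eigval_sc n k"
      if k: "k < Nf n" for k
    proof (cases "k < cf n")
      case True
      \<comment> \<open>\<open>cf n\<close> may equal \<open>Nf n\<close>, out of reach of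
        \<open>eigval_less\<close>, so only a weak inequality is shown; strictness comes from the
        gap \<open>\<gamma> / real n\<close>.\<close>
      have "eigval (cf n) - eigval k = (real (cf n) - real k) * (2 * real (Nf n) - 1 + real (pf n) + real (qf n) - real (cf n) - real k)"
        by (rule eigval_diff)
      also have "\<dots> \<ge> 0" using True cN by (intro mult_nonneg_nonneg) linarith+
      finally have le: "eigval_sc n k \<le> thr - \<gamma> / real n" unfolding t[symmetric] eigval_sc_def by (simp add: divide_right_mono)
      have "eigval_sc n k < thr"
      proof (cases "\<gamma> = 0")
        case True
        hence "cf n = 0" using elim by simp
        thus ?thesis using \<open>k < cf n\<close> by simp
      next
        case False
        hence "0 < \<gamma> / real n" using params n by simp
        thus ?thesis using le by linarith
      qed
      thus ?thesis using True by simp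
    next
      case False
      have "eigval k - eigval (cf n) = (real k - real (cf n)) * (2 * real (Nf n) - 1 + real (pf n) + real (qf n) - real k - real (cf n))"
        by (rule eigval_diff)
      also have "\<dots> \<ge> 0" using False k by (intro mult_nonneg_nonneg) linarith+
      finally have "thr - \<gamma> / real n \<le> eigval_sc n k" unfolding t[symmetric] eigval_sc_def by (simp add: divide_right_mono)
      thus ?thesis using False g by auto
    qed
    have "(\<Sum>k<cf n. P n k i * P n k j) = (\<Sum>k<Nf n. (if k < cf n then 1 else 0) * (P n k i * P n k j))"
      by (rule sum.mono_neutral_cong_left) (use cN in auto)
    hence e1: "(\<Sum>k<cf n. P n k i * P n k j) - spec_sum (ramp \<epsilon>) i j n = (\<Sum>k<Nf n. ((if k < cf n then 1 else 0) - ramp \<epsilon> (eigval_sc n k)) * (P n k i * P n k j))"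
      unfolding spec_sum_def by (simp only: sum_subtractf[symmetric] left_diff_distrib)
    have "\<bar>(\<Sum>k<cf n. P n k i * P n k j) - spec_sum (ramp \<epsilon>) i j n\<bar> \<le> (\<Sum>k<Nf n. \<bar>((if k < cf n then 1 else 0) - ramp \<epsilon> (eigval_sc n k)) * (P n k i * P n k j)\<bar>)"
      unfolding e1 by (rule sum_abs)
    also have "\<dots> \<le> (\<Sum>k<Nf n. (bump \<epsilon> (eigval_sc n k) * (P n k i * P n k i) + bump \<epsilon> (eigval_sc n k) * (P n k j * P n k j)) / 2)"
    proof (rule sum_mono)
      fix k assume "k \<in> {..<Nf n}"
      hence "\<bar>(if k < cf n then 1 else 0) - ramp \<epsilon> (eigval_sc n k)\<bar> \<le> bump \<epsilon> (eigval_sc n k)" using u[of k] by (intro ramp_bump \<epsilon>(1)) auto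
      hence "\<bar>(if k < cf n then 1 else 0) - ramp \<epsilon> (eigval_sc n k)\<bar> * \<bar>P n k i * P n k j\<bar> \<le> bump \<epsilon> (eigval_sc n k) * ((P n k i * P n k i + P n k j * P n k j) / 2)"
        using bump_nonneg abs_mult_le_squares by (intro mult_mono) auto
      thus "\<bar>((if k < cf n then 1 else 0) - ramp \<epsilon> (eigval_sc n k)) * (P n k i * P n k j)\<bar> \<le> (bump \<epsilon> (eigval_sc n k) * (P n k i * P n k i) + bump \<epsilon> (eigval_sc n k) * (P n k j * P n k j)) / 2"
        unfolding abs_mult[of "_ - ramp _ _"] by (simp add: distrib_left)
    qed
    also have "\<dots> = (spec_sum (bump \<epsilon>) i i n + spec_sum (bump \<epsilon>) j j n) / 2"
      unfolding spec_sum_def sum.distrib[symmetric] sum_divide_distrib[symmetric] ..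
    finally show ?case .
  qed
  have "\<forall>\<^sub>F n in F. spec_sum (bump \<epsilon>) i i n < e / 4" "\<forall>\<^sub>F n in F. spec_sum (bump \<epsilon>) j j n < e / 4"
    using order_tendstoD(2)[OF spec_sum_tendsto[OF bump_cont, of \<epsilon> i i], of "e / 4"] order_tendstoD(2)[OF spec_sum_tendsto[OF bump_cont, of \<epsilon> j j], of "e / 4"] \<epsilon>(2) by auto
  moreover have "\<forall>\<^sub>F n in F. dist (spec_sum (ramp \<epsilon>) i j n) (spec_int (ramp \<epsilon>) (i - j)) < e / 4"
    using spec_sum_tendsto[OF ramp_cont, of \<epsilon> i j] e by (intro tendstoD) auto
  ultimately show "\<forall>\<^sub>F n in F. dist (\<Sum>k<cf n. P n k i * P n k j) (hole_limit (i - j)) < e"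
    using cmp
  proof eventually_elim
    case (elim n)
    have "\<bar>hole_limit (i - j) - spec_int (ramp \<epsilon>) (i - j)\<bar> < e / 4" using spec_int_ramp_diff[OF \<epsilon>(1), of "i - j"] \<epsilon>(2) by linarith
    moreover have "(spec_sum (bump \<epsilon>) i i n + spec_sum (bump \<epsilon>) j j n) / 2 < e / 4" using elim(1,2) by argo
    ultimately show ?case using elim(3,4) unfolding dist_real_def by linarith
  qed
qed

end

section \<open>The number of holes\<close>

text \<open>For the distribution given by the squared determinants this is the generating function
  of the number of sites in \<open>ys\<close> without a particle. Cauchy-Binet sums over all
  \<open>P\<close>, orthonormality leaves the identity plus a term of rank at most
  \<open>length ys\<close>, and \<open>sylvester_det\<close> passes to a determinant of that
  size.\<close>

lemma dpp_generating:
  fixes \<phi> :: "nat \<Rightarrow> nat \<Rightarrow> real"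
  assumes orth: "\<And>i j. i < c \<Longrightarrow> j < c \<Longrightarrow> (\<Sum>y<N. \<phi> i y * \<phi> j y) = (if i = j then 1 else 0)"
    and ys: "distinct ys" "set ys \<subseteq> {..<N}" and u: "u \<noteq> 0"
  shows "(\<Sum>P | P \<subseteq> {..<N} \<and> card P = c. (fdet c (\<lambda>i j. \<phi> i (senum P j)))\<^sup>2 * u ^ card (set ys - P)) =
    fdet (length ys) (\<lambda>r s. (if r = s then u else 0) + (1 - u) * (\<Sum>k<c. \<phi> k (ys ! r) * \<phi> k (ys ! s)))"
proof -
  let ?M = "length ys"
  \<comment> \<open>Sites without a particle are counted by factoring out \<open>u ^ ?M\<close> and
    marking the particles on \<open>ys\<close> with the inverse of \<open>u\<close>; this is why
    \<open>u\<close> must not be 0.\<close>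
  define h where "h y = (if y \<in> set ys then 1 / u else 1)" for y
  have pw: "u ^ card (set ys - P) = u ^ ?M * (\<Prod>y\<in>P. h y)" if "P \<subseteq> {..<N}" for P
  proof -
    have fP: "finite P" using that by (rule finite_subset) simp
    have "(\<Prod>y\<in>P. h y) = (1 / u) ^ card (P \<inter> set ys)"
      unfolding h_def using prod.inter_restrict[OF fP, of "\<lambda>_. 1 / u" "set ys"] by simp
    moreover have "?M = card (set ys - P) + card (P \<inter> set ys)"
    proof -
      have "?M = card (set ys)" using ys(1) by (simp add: distinct_card)
      also have "\<dots> = card (set ys - P) + card (set ys \<inter> P)"
        using card_Int_Diff[of "set ys" P] by simp
      finally show ?thesis by (simp add: Int_commute)
    qed
    ultimately show ?thesis using u by (simp add: power_add power_one_over)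
  qed
  have inner: "(\<Sum>y<N. h y * \<phi> i y * \<phi> j y) = (if i = j then 1 else 0) + (\<Sum>r<?M. (1 / u - 1) * \<phi> i (ys ! r) * \<phi> j (ys ! r))"
    if "i < c" "j < c" for i j
  proof -
    have "(\<Sum>y<N. h y * \<phi> i y * \<phi> j y) = (\<Sum>y<N. \<phi> i y * \<phi> j y + (if y \<in> set ys then (1 / u - 1) * \<phi> i y * \<phi> j y else 0))"
      by (intro sum.cong refl) (simp add: h_def algebra_simps)
    also have "\<dots> = (if i = j then 1 else 0) + (\<Sum>y<N. if y \<in> set ys then (1 / u - 1) * \<phi> i y * \<phi> j y else 0)"
      by (simp add: sum.distrib orth[OF that])
    also have "(\<Sum>y<N. if y \<in> set ys then (1 / u - 1) * \<phi> i y * \<phi> j y else 0) = (\<Sum>y\<in>set ys. (1 / u - 1) * \<phi> i y * \<phi> j y)"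
      using ys(2) by (subst sum.inter_restrict[symmetric]) (auto simp: Int_absorb1)
    also have "\<dots> = (\<Sum>r<?M. (1 / u - 1) * \<phi> i (ys ! r) * \<phi> j (ys ! r))"
      by (rule sum.reindex_bij_betw[symmetric, OF bij_betw_nth]) (use ys(1) in auto)
    finally show ?thesis .
  qed
  have "(\<Sum>P | P \<subseteq> {..<N} \<and> card P = c. (fdet c (\<lambda>i j. \<phi> i (senum P j)))\<^sup>2 * u ^ card (set ys - P)) =
    u ^ ?M * (\<Sum>P | P \<subseteq> {..<N} \<and> card P = c. (\<Prod>y\<in>P. h y) * fdet c (\<lambda>i j. \<phi> i (senum P j)) * fdet c (\<lambda>i j. \<phi> i (senum P j)))"
    unfolding sum_distrib_left by (intro sum.cong refl) (simp add: pw power2_eq_square mult_ac)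
  also have "(\<Sum>P | P \<subseteq> {..<N} \<and> card P = c. (\<Prod>y\<in>P. h y) * fdet c (\<lambda>i j. \<phi> i (senum P j)) * fdet c (\<lambda>i j. \<phi> i (senum P j))) =
    fdet c (\<lambda>i j. \<Sum>y<N. h y * \<phi> i y * \<phi> j y)"
    by (rule cauchy_binet[symmetric]) simp
  also have "\<dots> = fdet c (\<lambda>i j. (if i = j then 1 else 0) + (\<Sum>r<?M. (1 / u - 1) * \<phi> i (ys ! r) * \<phi> j (ys ! r)))"
    by (rule fdet_cong) (rule inner)
  also have "\<dots> = fdet ?M (\<lambda>r s. (if r = s then 1 else 0) + (\<Sum>k<c. \<phi> k (ys ! r) * ((1 / u - 1) * \<phi> k (ys ! s))))"
    by (rule sylvester_det[where A = "\<lambda>i r. (1 / u - 1) * \<phi> i (ys ! r)" and B = "\<lambda>r j. \<phi> j (ys ! r)"])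
  also have "u ^ ?M * \<dots> = fdet ?M (\<lambda>r s. u * ((if r = s then 1 else 0) + (\<Sum>k<c. \<phi> k (ys ! r) * ((1 / u - 1) * \<phi> k (ys ! s)))))"
    unfolding fdet_scale_rows[of ?M "\<lambda>_. u"] by simp
  also have "\<dots> = fdet ?M (\<lambda>r s. (if r = s then u else 0) + (1 - u) * (\<Sum>k<c. \<phi> k (ys ! r) * \<phi> k (ys ! s)))"
  proof (rule fdet_cong)
    fix r s
    have "(\<Sum>k<c. \<phi> k (ys ! r) * ((1 / u - 1) * \<phi> k (ys ! s))) = (1 / u - 1) * (\<Sum>k<c. \<phi> k (ys ! r) * \<phi> k (ys ! s))"
      unfolding sum_distrib_left by (intro sum.cong refl) simp
    moreover have "u * ((1 / u - 1) * S) = (1 - u) * S" for S using u by (simp add: field_simps)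
    ultimately show "u * ((if r = s then 1 else 0) + (\<Sum>k<c. \<phi> k (ys ! r) * ((1 / u - 1) * \<phi> k (ys ! s)))) =
      (if r = s then u else 0) + (1 - u) * (\<Sum>k<c. \<phi> k (ys ! r) * \<phi> k (ys ! s))" by (simp only: distrib_left) simp
  qed
  finally show ?thesis .
qed

section \<open>Determinants of polynomial matrices and their coefficients\<close>

definition pdet :: "nat \<Rightarrow> (nat \<Rightarrow> nat \<Rightarrow> real poly) \<Rightarrow> real poly" where
  "pdet n f = (\<Sum>p | p permutes {..<n}. of_int (sign p) * (\<Prod>i<n. f i (p i)))"

lemma poly_pdt: "poly (pdet n f) u = fdet n (\<lambda>i j. poly (f i j) u)"
  unfolding pdet_def fdet_def' by (simp add: poly_sum poly_prod)

text \<open>Convergence of coefficients instead of values, since the probabilities are coefficients.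
  For determinants of fixed size it follows from the entries by the Leibniz formula.\<close>

definition poly_tendsto :: "('i \<Rightarrow> real poly) \<Rightarrow> real poly \<Rightarrow> 'i filter \<Rightarrow> bool" where
  "poly_tendsto f g F \<longleftrightarrow> (\<forall>k. ((\<lambda>n. coeff (f n) k) \<longlongrightarrow> coeff g k) F)"

lemma poly_tendsto_const: "poly_tendsto (\<lambda>_. g) g F" by (simp add: poly_tendsto_def)

lemma poly_tendsto_mult:
  "poly_tendsto f g F \<Longrightarrow> poly_tendsto f' g' F \<Longrightarrow> poly_tendsto (\<lambda>n. f n * f' n) (g * g') F"
  unfolding poly_tendsto_def coeff_mult by (auto intro!: tendsto_sum tendsto_mult)

lemma poly_tendsto_sum:
  "(\<And>i. i \<in> A \<Longrightarrow> poly_tendsto (f i) (g i) F) \<Longrightarrow> poly_tendsto (\<lambda>n. \<Sum>i\<in>A. f i n) (\<Sum>i\<in>A. g i) F"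
  unfolding poly_tendsto_def coeff_sum by (auto intro!: tendsto_sum)

lemma poly_tendsto_prod:
  "finite A \<Longrightarrow> (\<And>i. i \<in> A \<Longrightarrow> poly_tendsto (f i) (g i) F) \<Longrightarrow> poly_tendsto (\<lambda>n. \<Prod>i\<in>A. f i n) (\<Prod>i\<in>A. g i) F"
  by (induction A rule: finite_induct) (auto intro: poly_tendsto_const poly_tendsto_mult)

lemma poly_tendsto_linear:
  assumes "(a \<longlongrightarrow> a') F" "(b \<longlongrightarrow> b') F"
  shows "poly_tendsto (\<lambda>n. [:a n, b n:]) [:a', b':] F"
  unfolding poly_tendsto_def
proof
  fix k show "((\<lambda>n. coeff [:a n, b n:] k) \<longlongrightarrow> coeff [:a', b':] k) F"
    using assms by (cases k; cases "k - 1") (auto simp: coeff_pCons split: nat.splits)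
qed

lemma poly_tendsto_pdt:
  assumes "\<And>i j. i < m \<Longrightarrow> j < m \<Longrightarrow> poly_tendsto (\<lambda>n. f n i j) (g i j) F"
  shows "poly_tendsto (\<lambda>n. pdet m (f n)) (pdet m g) F"
  unfolding pdet_def
proof (intro poly_tendsto_sum poly_tendsto_mult poly_tendsto_const poly_tendsto_prod)
  fix p i assume "p \<in> {p. p permutes {..<m}}" "i \<in> {..<m}"
  thus "poly_tendsto (\<lambda>n. f n i (p i)) (g i (p i)) F"
    using permutes_in_image[of p "{..<m}" i] by (intro assms) auto
qed simp

text \<open>Fills in the exception \<open>u = 0\<close> of \<open>dpp_generating\<close>, the very
  point at which the Taylor coefficients are read off.\<close>

lemma poly_eq_punctured:
  fixes p q :: "real poly"
  assumes "\<And>u. u \<noteq> 0 \<Longrightarrow> poly p u = poly q u"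
  shows "p = q"
proof (rule ccontr)
  assume "p \<noteq> q"
  hence "finite {u. poly (p - q) u = 0}" by (intro poly_roots_finite) simp
  moreover have "- {0} \<subseteq> {u. poly (p - q) u = 0}" using assms by auto
  ultimately have "finite (- {0 :: real})" by (rule finite_subset[rotated])
  thus False using infinite_UNIV_char_0[where 'a = real] by (simp add: finite_compl)
qed

lemma funpow_neg_deriv:
  fixes D :: "real poly"
  shows "((\<lambda>f t. - deriv f t) ^^ p) (\<lambda>t. poly D (1 - t)) = (\<lambda>t. poly ((pderiv ^^ p) D) (1 - t))"
proof (induction p)
  case (Suc p)
  have "deriv (\<lambda>t. poly q (1 - t)) t = - poly (pderiv q) (1 - t)" for q :: "real poly" and t
  proof (rule DERIV_imp_deriv)
    have "((\<lambda>t. poly q (1 - t)) has_real_derivative poly (pderiv q) (1 - t) * (0 - 1)) (at t)"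
      by (rule DERIV_chain2[OF poly_DERIV]) (intro derivative_intros)
    thus "((\<lambda>t. poly q (1 - t)) has_real_derivative - poly (pderiv q) (1 - t)) (at t)" by simp
  qed
  thus ?case by (simp add: Suc)
qed simp

text \<open>With \<open>u = 1 - t\<close>, applying -d/dt at \<open>t = 1\<close> is differentiating
  in \<open>u\<close> at 0, and the factorial turns the derivative into the Taylor
  coefficient.\<close>

lemma neg_deriv_coeff:
  fixes D :: "real poly"
  shows "1 / fact p * ((\<lambda>f t. - deriv f t) ^^ p) (\<lambda>t. poly D (1 - t)) 1 = coeff D p"
proof -
  have "poly ((pderiv ^^ p) D) 0 = fact p * coeff D p"
    by (simp add: poly_0_coeff_0 coeff_higher_pderiv pochhammer_fact)
  thus ?thesis unfolding funpow_neg_deriv by simp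
qed

section \<open>Hole probabilities as coefficients\<close>

context hex
begin

abbreviation "efun m \<equiv> hahn.phi (N m) (nat \<bar>int m - int b\<bar>) (nat \<bar>int a - int m\<bar>)"

definition kern :: "nat \<Rightarrow> nat \<Rightarrow> nat \<Rightarrow> real" where
  "kern m y z = (\<Sum>k<c. efun m k y * efun m k z)"

text \<open>The determinant of K + u (1 - K) on the sites \<open>ys\<close>, with K the particle
  kernel. At u = 1 - t it is the determinant of 1 - t (1 - K), the shape of the limit
  formula.\<close>

definition hole_poly :: "nat \<Rightarrow> nat list \<Rightarrow> real poly" where
  "hole_poly m ys = pdet (length ys) (\<lambda>r s.
     [:kern m (ys ! r) (ys ! s), (if r = s then 1 else 0) - kern m (ys ! r) (ys ! s):])"

lemma c_le_N: "m \<le> a + b \<Longrightarrow> c \<le> N m"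
  unfolding N_def hi_def lo_def using pos by auto

lemma sum_over_parts:
  assumes m: "m \<le> a + b"
  shows "real (card {T \<in> Tilings. Q (particles m T)}) =
    (\<Sum>P | P \<subseteq> {..<N m} \<and> card P = c. real (card {T \<in> Tilings. particles m T = P}) * of_bool (Q P))"
proof -
  let ?S = "{P. P \<subseteq> {..<N m} \<and> card P = c}"
  have e1: "{T \<in> Tilings. Q (particles m T)} = (\<Union>P\<in>{P \<in> ?S. Q P}. {T \<in> Tilings. particles m T = P})"
    using particles_card[OF _ m] by auto
  have "card {T \<in> Tilings. Q (particles m T)} = (\<Sum>P\<in>{P \<in> ?S. Q P}. card {T \<in> Tilings. particles m T = P})"
    unfolding e1 by (rule card_UN_disjoint) (auto simp: finite_tilings)
  hence "real (card {T \<in> Tilings. Q (particles m T)}) = (\<Sum>P\<in>{P \<in> ?S. Q P}. real (card {T \<in> Tilings. particles m T = P}))" by simp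
  also have "\<dots> = (\<Sum>P\<in>?S. real (card {T \<in> Tilings. particles m T = P}) * of_bool (Q P))"
    by (rule sum.mono_neutral_cong_left) auto
  finally show ?thesis .
qed

text \<open>Both proportionality constants are determined by summing over all particle sets.\<close>

lemma card_parts_phi:
  assumes m: "m \<le> a + b"
    and P: "P \<subseteq> {..<N m}" "card P = c"
  shows "real (card {T \<in> Tilings. particles m T = P}) = real (card Tilings) * (fdet c (\<lambda>i j. efun m i (senum P j)))\<^sup>2"
proof -
  let ?p = "nat \<bar>int m - int b\<bar>" and ?q = "nat \<bar>int a - int m\<bar>"
  let ?S = "{P. P \<subseteq> {..<N m} \<and> card P = c}"
  interpret hahn "N m" ?p ?q by unfold_locales (use c_le_N[OF m] pos in linarith)
  obtain K where K: "\<And>P. P \<subseteq> {..<N m} \<Longrightarrow> card P = c \<Longrightarrow> real (card {T \<in> Tilings. particles m T = P}) =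
    K * (\<Prod>y\<in>P. w y) * (fdet c (\<lambda>k j. ffact k (real (senum P j))))\<^sup>2"
    using card_tilings_parts[OF m] unfolding w_def by blast
  obtain A where A: "\<And>y. fdet c (\<lambda>k j. phi k (y j)) = A * (\<Prod>j<c. (-1) ^ y j * sqrt (w (y j))) * fdet c (\<lambda>k j. ffact k (real (y j)))"
    using fdet_phi[of c] by blast
  have phi2: "(fdet c (\<lambda>k j. phi k (senum P j)))\<^sup>2 = A\<^sup>2 * ((\<Prod>y\<in>P. w y) * (fdet c (\<lambda>k j. ffact k (real (senum P j))))\<^sup>2)"
    if P: "P \<subseteq> {..<N m}" "card P = c" for P
  proof -
    have fP: "finite P" using P(1) by (rule finite_subset) simp
    have bij: "bij_betw (senum P) {..<c} P" using senum_bij[OF fP] P(2) by simp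
    have "(\<Prod>j<c. (-1) ^ senum P j * sqrt (w (senum P j)))\<^sup>2 = (\<Prod>j<c. w (senum P j))"
    proof -
      have "((-1) ^ y)\<^sup>2 = (1 :: real)" for y :: nat by (cases "even y") auto
      hence "((-1) ^ y * sqrt (w y))\<^sup>2 = w y" for y using w_pos[of y] by (simp add: power_mult_distrib)
      thus ?thesis by (simp add: prod_power_distrib)
    qed
    also have "\<dots> = (\<Prod>y\<in>P. w y)" by (rule prod.reindex_bij_betw[OF bij])
    finally show ?thesis unfolding A by (simp add: power_mult_distrib)
  qed
  have orth: "(\<Sum>y<N m. phi i y * phi j y) = (if i = j then 1 else 0)" if "i < c" "j < c" for i j
    using phi_orthonormal[of i j] that c_le_N[OF m] by simp
  \<comment> \<open>The generating function for the empty list at \<open>u = 1\<close> is the total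
    mass, and it equals a determinant of size 0.\<close>
  have tot: "(\<Sum>P\<in>?S. (fdet c (\<lambda>k j. phi k (senum P j)))\<^sup>2) = 1"
    using dpp_generating[OF orth, where ys = "[]" and u = 1] by (simp add: fdet_def')
  have A0: "A \<noteq> 0"
  proof
    assume "A = 0"
    hence "(\<Sum>P\<in>?S. (fdet c (\<lambda>k j. phi k (senum P j)))\<^sup>2) = 0" by (intro sum.neutral) (auto simp: phi2)
    thus False using tot by simp
  qed
  have KA: "real (card {T \<in> Tilings. particles m T = P}) = K / A\<^sup>2 * (fdet c (\<lambda>k j. phi k (senum P j)))\<^sup>2"
    if "P \<subseteq> {..<N m}" "card P = c" for P
    using K[OF that] phi2[OF that] A0 by simp
  have "real (card Tilings) = (\<Sum>P\<in>?S. K / A\<^sup>2 * (fdet c (\<lambda>k j. phi k (senum P j)))\<^sup>2)"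
    using sum_over_parts[OF m, of "\<lambda>_. True"] KA by simp
  also have "\<dots> = K / A\<^sup>2" unfolding sum_distrib_left[symmetric] tot by simp
  finally show ?thesis unfolding KA[OF P] by simp
qed

text \<open>By \<open>card_parts_phi\<close> the squared determinants are the probabilities of the
  particle sets, so \<open>R\<close> is the generating polynomial of the number of holes. It agrees
  with \<open>hole_poly\<close> wherever \<open>u\<close> is not 0, hence as a polynomial.\<close>

lemma coeff_hole_poly:
  assumes m: "m \<le> a + b" and ys: "distinct ys" "set ys \<subseteq> {..<N m}"
  shows "coeff (hole_poly m ys) p = real (card {T \<in> Tilings. card (set ys - particles m T) = p}) / real (card Tilings)"
proof -
  let ?S = "{P. P \<subseteq> {..<N m} \<and> card P = c}"
  let ?W = "\<lambda>P. (fdet c (\<lambda>i j. efun m i (senum P j)))\<^sup>2"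
  have T0: "0 < real (card Tilings)" using tilings_nonempty finite_tilings by (simp add: card_gt_0_iff)
  interpret hahn "N m" "nat \<bar>int m - int b\<bar>" "nat \<bar>int a - int m\<bar>" by unfold_locales (use c_le_N[OF m] pos in linarith)
  have orth: "(\<Sum>y<N m. phi i y * phi j y) = (if i = j then 1 else 0)" if "i < c" "j < c" for i j
    using phi_orthonormal[of i j] that c_le_N[OF m] by simp
  have fS: "finite ?S" by simp
  define R where "R = (\<Sum>P\<in>?S. monom (?W P) (card (set ys - P)))"
  have "R = hole_poly m ys"
  proof (rule poly_eq_punctured)
    fix u :: real assume u: "u \<noteq> 0"
    have "poly R u = (\<Sum>P\<in>?S. ?W P * u ^ card (set ys - P))" by (simp add: R_def poly_sum poly_monom)
    also have "\<dots> = fdet (length ys) (\<lambda>r s. (if r = s then u else 0) + (1 - u) * (\<Sum>k<c. phi k (ys ! r) * phi k (ys ! s)))"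
      by (rule dpp_generating[OF orth ys u])
    also have "\<dots> = poly (hole_poly m ys) u"
      unfolding hole_poly_def kern_def poly_pdt by (rule fdet_cong) (simp add: algebra_simps)
    finally show "poly R u = poly (hole_poly m ys) u" .
  qed
  hence "coeff (hole_poly m ys) p = coeff R p" by (simp only:)
  also have "\<dots> = (\<Sum>P\<in>?S. ?W P * of_bool (card (set ys - P) = p))"
    unfolding R_def coeff_sum by (intro sum.cong refl) simp
  also have "\<dots> = real (card {T \<in> Tilings. card (set ys - particles m T) = p}) / real (card Tilings)"
    unfolding sum_over_parts[OF m, of "\<lambda>P. card (set ys - P) = p"] sum_divide_distrib using T0
    by (intro sum.cong refl) (simp add: card_parts_phi[OF m])
  finally show ?thesis .
qed

lemma holes_parts:
  assumes m: "m \<le> a + b"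
  shows "holes (real a) (real b) (real c) (real m) T = real ` ({..<N m} - particles m T)"
proof -
  have "{j. lo m \<le> j \<and> j < hi m \<and> vtile (int m) j \<in> T} = (\<lambda>y. lo m + int y) ` ({..<N m} - particles m T)"
  proof (intro equalityI subsetI)
    fix j assume "j \<in> {j. lo m \<le> j \<and> j < hi m \<and> vtile (int m) j \<in> T}"
    hence "j = lo m + int (nat (j - lo m))" "nat (j - lo m) \<in> {..<N m} - particles m T" by (auto simp: particles_def N_def)
    thus "j \<in> (\<lambda>y. lo m + int y) ` ({..<N m} - particles m T)" by blast
  qed (auto simp: particles_def N_def)
  thus ?thesis unfolding holes_eq[OF m] by (simp add: image_image)
qed

lemma hole_prob_coeff:
  assumes m: "m \<le> a + b" and ys: "distinct ys" "set ys \<subseteq> {..<N m}"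
  shows "hole_prob (real a) (real b) (real c) (real m) (real ` set ys) p = coeff (hole_poly m ys) p"
proof -
  have "card (real ` set ys \<inter> holes (real a) (real b) (real c) (real m) T) = card (set ys - particles m T)" for T
  proof -
    have "real ` set ys \<inter> holes (real a) (real b) (real c) (real m) T = real ` (set ys \<inter> ({..<N m} - particles m T))"
      unfolding holes_parts[OF m] by (rule image_Int[symmetric]) (auto intro: injI)
    also have "set ys \<inter> ({..<N m} - particles m T) = set ys - particles m T" using ys(2) by auto
    finally show ?thesis by (simp add: card_image)
  qed
  moreover have "Tilings \<inter> {T. Q T} = {T \<in> Tilings. Q T}" for Q by auto
  ultimately show ?thesis unfolding hole_prob_def coeff_hole_poly[OF m ys]
    by (simp add: measure_pmf_of_set[OF tilings_nonempty finite_tilings])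
qed

end

section \<open>The limit along the admissible scales\<close>

theorem theorem9:
  fixes \<alpha> \<beta> \<gamma> \<tau> x :: real and E :: "complex set"
  assumes "\<alpha> \<ge> \<beta>" and "\<beta> > 0" and "\<gamma> > 0" and "0 < \<tau>" and "\<tau> < \<alpha> + \<beta>"
    and "x > 0" and "x \<in> \<rat>"
    and "infinite (scales \<alpha> \<beta> \<gamma> \<tau> x)"
    and "\<forall>n\<in>scales \<alpha> \<beta> \<gamma> \<tau> x.
           n * x \<in> real ` {..<card (sites (n * \<alpha>) (n * \<beta>) (n * \<gamma>) (n * \<tau>))}"
    and "inscribed_ellipse \<alpha> \<beta> \<gamma> E"
    and "\<exists>\<delta>>0. \<forall>n\<in>scales \<alpha> \<beta> \<gamma> \<tau> x.
           rescaled_site \<alpha> \<beta> \<gamma> \<tau> x n \<in> inside E \<and>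
           infdist (rescaled_site \<alpha> \<beta> \<gamma> \<tau> x n) E \<ge> \<delta>"
  shows "\<exists>\<kappa>. \<forall>js :: int list. distinct js \<longrightarrow> 0 \<notin> set js \<longrightarrow>
           (\<forall>p \<le> length js + 1.
              ((\<lambda>n. hole_prob (n * \<alpha>) (n * \<beta>) (n * \<gamma>) (n * \<tau>)
                      ((\<lambda>j. n * x + of_int j) ` set (0 # js)) p)
               \<longlongrightarrow>
               1 / fact p *
               ((\<lambda>f t. - deriv f t) ^^ p)
                 (\<lambda>t. Determinant.det
                        (1\<^sub>m (length js + 1) - t \<cdot>\<^sub>m sine_matrix \<kappa> (0 # js))) 1)
              (inf sequentially (principal (scales \<alpha> \<beta> \<gamma> \<tau> x))))"
proof -
  note ab = assms(1-6) and inf = assms(8) and site = assms(9)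
  let ?S = "scales \<alpha> \<beta> \<gamma> \<tau> x"
  let ?F = "inf sequentially (principal ?S)"
  define nn where "nn t n = nat \<lfloor>real n * t\<rfloor>" for t n
  have nn: "real (nn t n) = real n * t" if "real n * t \<in> \<nat>" for t n
    using that by (auto simp: nn_def elim: Nats_cases)
  define a b c m y where "a = nn \<alpha>" and "b = nn \<beta>" and "c = nn \<gamma>" and "m = nn \<tau>" and "y = nn x"
  have S: "0 < n" "real (a n) = real n * \<alpha>" "real (b n) = real n * \<beta>" "real (c n) = real n * \<gamma>" "real (m n) = real n * \<tau>" "real (y n) = real n * x"
    if "n \<in> ?S" for n
    using that nn unfolding scales_def a_def b_def c_def m_def y_def by auto
  have hex: "hex (a n) (b n) (c n)" if n: "n \<in> ?S" for n
  proof -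
    have "0 < real (a n)" "0 < real (b n)" "0 < real (c n)" using S[OF n] ab by simp_all
    thus ?thesis by unfold_locales simp_all
  qed
  have mab: "m n \<le> a n + b n" if n: "n \<in> ?S" for n
  proof -
    have "real n * \<tau> \<le> real n * (\<alpha> + \<beta>)" using ab by (intro mult_left_mono) auto
    hence "real (m n) \<le> real (a n + b n)" using S[OF n] by (simp add: distrib_left)
    thus ?thesis by simp
  qed
  define Nf where "Nf n = hex.N (a n) (b n) (c n) (m n)" for n
  define pf where "pf n = nat \<bar>int (m n) - int (b n)\<bar>" for n
  define qf where "qf n = nat \<bar>int (a n) - int (m n)\<bar>" for n
  \<comment> \<open>\<open>hi - lo\<close> divided by \<open>n\<close>, so that the line has
    \<open>n * \<nu>\<close> sites.\<close>
  define \<nu> where "\<nu> = min \<gamma> (\<alpha> + \<gamma> - \<tau>) + min \<tau> \<beta>"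
  have pq: "real (pf n) = real n * \<bar>\<tau> - \<beta>\<bar>" "real (qf n) = real n * \<bar>\<alpha> - \<tau>\<bar>" if n: "n \<in> ?S" for n
  proof -
    have "real (pf n) = \<bar>real (m n) - real (b n)\<bar>" "real (qf n) = \<bar>real (a n) - real (m n)\<bar>" unfolding pf_def qf_def by simp_all
    thus "real (pf n) = real n * \<bar>\<tau> - \<beta>\<bar>" "real (qf n) = real n * \<bar>\<alpha> - \<tau>\<bar>"
      using S[OF n] by (simp_all add: abs_mult flip: right_diff_distrib)
  qed
  have Nn: "real (Nf n) = real n * \<nu>" if n: "n \<in> ?S" for n
  proof -
    interpret hex "a n" "b n" "c n" by (rule hex[OF n])
    have "real (Nf n) = of_int (hi (m n)) - of_int (lo (m n))"
      unfolding Nf_def N_def using lo_less_hi[OF mab[OF n]] by simp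
    also have "\<dots> = min (real (c n)) (real (a n) + real (c n) - real (m n)) + min (real (m n)) (real (b n))"
      unfolding hi_def lo_def by (simp add: of_int_min of_nat_min)
    also have "\<dots> = min (real n * \<gamma>) (real n * (\<alpha> + \<gamma> - \<tau>)) + min (real n * \<tau>) (real n * \<beta>)"
      using S[OF n] by (simp add: algebra_simps)
    also have "\<dots> = real n * \<nu>" unfolding \<nu>_def distrib_left min_mult_distrib_left by simp
    finally show ?thesis .
  qed
  have "?S \<noteq> {}" using inf by auto
  then obtain n0 where n0: "n0 \<in> ?S" by blast
  \<comment> \<open>One scale suffices: there \<open>n0 * x\<close> is the number of a site, hence
    less than \<open>Nf n0 = n0 * \<nu>\<close>.\<close>
  have x\<nu>: "x < \<nu>"
  proof -
    interpret hex "a n0" "b n0" "c n0" by (rule hex[OF n0])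
    have "card (sites (n0 * \<alpha>) (n0 * \<beta>) (n0 * \<gamma>) (n0 * \<tau>)) = Nf n0"
      using card_sites[OF mab[OF n0]] S[OF n0] by (simp add: Nf_def)
    hence "real n0 * x < real (Nf n0)" using site n0 by force
    thus ?thesis unfolding Nn[OF n0] using S(1)[OF n0] by simp
  qed
  have g\<nu>: "\<gamma> \<le> \<nu>" unfolding \<nu>_def using ab by (auto simp: min_def)
  have ev: "\<forall>\<^sub>F n in ?F. Q n" if "\<And>n. n \<in> ?S \<Longrightarrow> Q n" for Q
    unfolding eventually_inf_principal using that by auto
  interpret hahn_limit ?F Nf pf qf c y \<nu> "\<bar>\<tau> - \<beta>\<bar>" "\<bar>\<alpha> - \<tau>\<bar>" \<gamma> x
  proof
    have "(\<lambda>n. 1 / real n) \<longlonglongrightarrow> 0" by (rule lim_1_over_n)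
    thus "((\<lambda>n. 1 / real n) \<longlongrightarrow> 0) ?F" by (rule tendsto_mono[OF inf_le1])
    show "\<forall>\<^sub>F n in ?F. 0 < n \<and> real (Nf n) = real n * \<nu> \<and> real (pf n) = real n * \<bar>\<tau> - \<beta>\<bar> \<and>
        real (qf n) = real n * \<bar>\<alpha> - \<tau>\<bar> \<and> real (c n) = real n * \<gamma> \<and> real (y n) = real n * x"
      by (rule ev) (use S Nn pq in blast)
  qed (use ab x\<nu> g\<nu> in auto)
  show ?thesis
  proof (rule exI[of _ kappa], intro allI impI)
    fix js :: "int list" and p :: nat
    assume js: "distinct js" "0 \<notin> set js"
    define bs where "bs = 0 # js"
    have bs: "distinct bs" "length bs = length js + 1" using js by (auto simp: bs_def)
    let ?M = "length bs"
    \<comment> \<open>The limit of the hole polynomials: the particle kernel K tends to 1 - S with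
      the sine kernel S, so K + u (1 - K) tends to 1 - S + u S.\<close>
    define D where "D = pdet ?M (\<lambda>r s. [:(if r = s then 1 else 0) - sine_kernel kappa (bs ! r) (bs ! s), sine_kernel kappa (bs ! r) (bs ! s):])"
    define K where "K n r s = (\<Sum>k<c n. P n k (bs ! r) * P n k (bs ! s))" for n r s
    have Klim: "((\<lambda>n. K n r s) \<longlongrightarrow> (if r = s then 1 else 0) - sine_kernel kappa (bs ! r) (bs ! s)) ?F"
      if "r < ?M" "s < ?M" for r s
    proof -
      have "hole_limit (bs ! r - bs ! s) = (if r = s then 1 else 0) - sine_kernel kappa (bs ! r) (bs ! s)"
        using nth_eq_iff_index_eq[OF bs(1) that] by (simp add: hole_limit_def sine_kernel_def)
      thus ?thesis using kernel_limit[of "bs ! r" "bs ! s"] unfolding K_def by simp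
    qed
    have "poly_tendsto (\<lambda>n. pdet ?M (\<lambda>r s. [:K n r s, (if r = s then 1 else 0) - K n r s:])) D ?F"
      unfolding D_def
    proof (rule poly_tendsto_pdt, rule poly_tendsto_linear)
      fix r s assume rs: "r < ?M" "s < ?M"
      show "((\<lambda>n. K n r s) \<longlongrightarrow> (if r = s then 1 else 0) - sine_kernel kappa (bs ! r) (bs ! s)) ?F" by (rule Klim[OF rs])
      have "((\<lambda>n. (if r = s then 1 else 0) - K n r s) \<longlongrightarrow> (if r = s then 1 else 0) - ((if r = s then 1 else 0) - sine_kernel kappa (bs ! r) (bs ! s))) ?F"
        by (intro tendsto_diff tendsto_const Klim rs)
      thus "((\<lambda>n. (if r = s then 1 else 0) - K n r s) \<longlongrightarrow> sine_kernel kappa (bs ! r) (bs ! s)) ?F" by simp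
    qed
    hence lim: "((\<lambda>n. coeff (pdet ?M (\<lambda>r s. [:K n r s, (if r = s then 1 else 0) - K n r s:])) p) \<longlongrightarrow> coeff D p) ?F"
      unfolding poly_tendsto_def by blast
    have inS: "\<forall>\<^sub>F n in ?F. n \<in> ?S" by (rule ev)
    \<comment> \<open>The finitely many sites of the pattern lie on the line once \<open>n\<close>
      is large, because \<open>0 < x\<close> and \<open>x < \<nu>\<close>. The conversion by
      \<open>nat\<close> is faithful from then on.\<close>
    have inner: "\<forall>\<^sub>F n in ?F. \<forall>j\<in>set bs. 0 < int (y n) + j \<and> int (y n) + j + 1 < int (Nf n)"
      by (rule eventually_ball_finite) (use ev_interior in auto)
    have "\<forall>\<^sub>F n in ?F. coeff (pdet ?M (\<lambda>r s. [:K n r s, (if r = s then 1 else 0) - K n r s:])) p =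
       hole_prob (n * \<alpha>) (n * \<beta>) (n * \<gamma>) (n * \<tau>) ((\<lambda>j. n * x + of_int j) ` set (0 # js)) p"
      using inS inner
    proof eventually_elim
      case (elim n)
      interpret hx: hex "a n" "b n" "c n" by (rule hex[OF elim(1)])
      define ys where "ys = map (\<lambda>j. nat (int (y n) + j)) bs"
      have "inj_on (\<lambda>j. nat (int (y n) + j)) (set bs)"
      proof (rule inj_onI)
        fix i j assume "i \<in> set bs" "j \<in> set bs" "nat (int (y n) + i) = nat (int (y n) + j)"
        thus "i = j" using elim(2) by (metis add_left_cancel eq_nat_nat_iff less_imp_le)
      qed
      hence ys: "distinct ys" using bs(1) by (simp add: ys_def distinct_map)
      have ysN: "set ys \<subseteq> {..<hx.N (m n)}"
      proof
        fix z assume "z \<in> set ys"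
        then obtain j where j: "j \<in> set bs" "z = nat (int (y n) + j)" by (auto simp: ys_def)
        have "0 < int (y n) + j" "int (y n) + j + 1 < int (Nf n)" using elim(2) j(1) by blast+
        hence "z < Nf n" unfolding j(2) by linarith
        thus "z \<in> {..<hx.N (m n)}" by (simp add: Nf_def)
      qed
      have img: "(\<lambda>j. n * x + of_int j) ` set (0 # js) = real ` set ys"
      proof -
        have "real ` set ys = (\<lambda>j. real (nat (int (y n) + j))) ` set bs" unfolding ys_def by (simp add: image_image)
        also have "\<dots> = (\<lambda>j. n * x + of_int j) ` set bs"
        proof (rule image_cong[OF refl])
          fix j assume "j \<in> set bs"
          hence "0 < int (y n) + j" using elim(2) by blast
          hence "real (nat (int (y n) + j)) = real (y n) + of_int j" by simp
          thus "real (nat (int (y n) + j)) = n * x + of_int j" using S(6)[OF elim(1)] by simp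
        qed
        finally show ?thesis by (simp add: bs_def)
      qed
      have "pdet ?M (\<lambda>r s. [:K n r s, (if r = s then 1 else 0) - K n r s:]) = hx.hole_poly (m n) ys"
      proof -
        have "P n k (bs ! r) = hahn.phi (Nf n) (pf n) (qf n) k (ys ! r)" if "r < ?M" for k r
          using that by (simp add: P_def ys_def)
        hence "K n r s = (\<Sum>k<c n. hahn.phi (Nf n) (pf n) (qf n) k (ys ! r) * hahn.phi (Nf n) (pf n) (qf n) k (ys ! s))"
          if "r < ?M" "s < ?M" for r s using that unfolding K_def by simp
        moreover have "length ys = ?M" by (simp add: ys_def)
        ultimately show ?thesis unfolding hx.hole_poly_def hx.kern_def Nf_def pf_def qf_def pdet_def
          by (intro sum.cong refl arg_cong2[where f = "(*)"] prod.cong) (auto dest: permutes_in_image)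
      qed
      moreover have "hole_prob (real (a n)) (real (b n)) (real (c n)) (real (m n)) (real ` set ys) p = coeff (hx.hole_poly (m n) ys) p"
        by (rule hx.hole_prob_coeff[OF mab[OF elim(1)] ys ysN])
      ultimately show ?case unfolding img using S[OF elim(1)] by simp
    qed
    from Lim_transform_eventually[OF lim this]
    have L: "((\<lambda>n. hole_prob (n * \<alpha>) (n * \<beta>) (n * \<gamma>) (n * \<tau>) ((\<lambda>j. n * x + of_int j) ` set (0 # js)) p) \<longlongrightarrow> coeff D p) ?F" .
    have "Determinant.det (1\<^sub>m (length js + 1) - t \<cdot>\<^sub>m sine_matrix kappa (0 # js)) = poly D (1 - t)" for t
    proof -
      have "1\<^sub>m (length js + 1) - t \<cdot>\<^sub>m sine_matrix kappa (0 # js) =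
        mat ?M ?M (\<lambda>(r, s). (if r = s then 1 else 0) - t * sine_kernel kappa (bs ! r) (bs ! s))"
        unfolding sine_matrix_def bs_def[symmetric] bs(2)[symmetric] by (intro eq_matI) auto
      hence "Determinant.det (1\<^sub>m (length js + 1) - t \<cdot>\<^sub>m sine_matrix kappa (0 # js)) =
        fdet ?M (\<lambda>r s. (if r = s then 1 else 0) - t * sine_kernel kappa (bs ! r) (bs ! s))" by (simp add: fdet_def)
      also have "\<dots> = poly D (1 - t)" unfolding D_def poly_pdt by (rule fdet_cong) (simp add: algebra_simps)
      finally show ?thesis .
    qed
    hence "(\<lambda>t. Determinant.det (1\<^sub>m (length js + 1) - t \<cdot>\<^sub>m sine_matrix kappa (0 # js))) = (\<lambda>t. poly D (1 - t))" by auto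
    hence "1 / fact p * ((\<lambda>f t. - deriv f t) ^^ p) (\<lambda>t. Determinant.det (1\<^sub>m (length js + 1) - t \<cdot>\<^sub>m sine_matrix kappa (0 # js))) 1 = coeff D p"
      by (simp only: neg_deriv_coeff)
    thus "((\<lambda>n. hole_prob (n * \<alpha>) (n * \<beta>) (n * \<gamma>) (n * \<tau>)
                      ((\<lambda>j. n * x + of_int j) ` set (0 # js)) p)
               \<longlongrightarrow>
               1 / fact p *
               ((\<lambda>f t. - deriv f t) ^^ p)
                 (\<lambda>t. Determinant.det
                        (1\<^sub>m (length js + 1) - t \<cdot>\<^sub>m sine_matrix kappa (0 # js))) 1) ?F"
      using L by (simp only:)
  qed
qed

end
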